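(* Let $\sigma(\mathbf{Q})=\{\lambda^{\mathbf Q}_1,\dots,\lambda^{\mathbf Q}_n\}$ with $\lambda_1^{\mathbf Q}=0$, and let $\sigma(\mathbf{Q}^\varepsilon)$ be the collection of the $N$ eigenvalues of $\mathbf{Q}^\varepsilon$ (all eigenvalues listed with algebraic multiplicity). For all sufficiently small $\varepsilon>0$, the spectrum $\sigma(\mathbf{Q}^\varepsilon)=\{\lambda^\varepsilon_1,\dots,\lambda^\varepsilon_N\}$ can be divided (with a suitable enumeration) into two disjoint parts $\sigma_1(\mathbf{Q}^\varepsilon)=\{\lambda^\varepsilon_1,\dots,\lambda^\varepsilon_n\}$ and $\sigma_2(\mathbf{Q}^\varepsilon)=\{\lambda^\varepsilon_{n+1},\dots,\lambda^\varepsilon_N\}$ such that the following hold. (i) $\sigma_1(\mathbf{Q}^\varepsilon)$ contains precisely $n$ eigenvalues $\lambda^\varepsilon_1,\dots,\lambda^\varepsilon_n$, with $\lambda_1^\varepsilon=\lambda_1^{\mathbf Q}=0$ and $$\lim_{\varepsilon\to0}\lambda_i^\varepsilon=\lambda_i^{\mathbf Q},\qquad 2\le i\le n.$$ (ii) For any family $\{r_\varepsilon\}_{\varepsilon>0}$ such that $r_\varepsilon\to+\infty$ and $r_\varepsilon\,\varepsilon^{\frac{\alpha}{n+1}}\to0$ as $\varepsilon\to0$, there is $\varepsilon_0>0$ such that for all $\varepsilon\in(0,\varepsilon_0]$ and all $i=n+1,\dots,N$ $$|\lambda_i^\varepsilon|\ge r_\varepsilon .$$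
   Context: Potential. Let $n\ge2$ and let $U\in C^3(\mathbb R,\mathbb R)$ satisfy $|U'(x)|>c|x|^{1+c}$ for all sufficiently large $|x|$ and some $c>0$, with exactly $n$ local minima $\mathfrak m_1,\dots,\mathfrak m_n$ and exactly $n-1$ local maxima $\mathfrak s_1,\dots,\mathfrak s_{n-1}$, ordered as $-\infty=\mathfrak s_0<\mathfrak m_1<\mathfrak s_1<\mathfrak m_2<\dots<\mathfrak m_n<\mathfrak s_n=\infty$, all non-degenerate: $U''(\mathfrak m_i)>0$, $U''(\mathfrak s_i)<0$. Put $\mathcal M=\{\mathfrak m_1,\dots,\mathfrak m_n\}$. Noise. Let $\alpha\in(0,2)$ and let $L_1$ be a symmetric $\alpha$-stable random variable with $\mathbb E e^{\mathrm i uL_1}=e^{-c(\alpha)|u|^\alpha}$, $c(\alpha)=\alpha\int_0^\infty\frac{1-\cos y}{y^{1+\alpha}}\,dy$ (so that $\lim_{u\to\infty}u^\alpha\mathbb P(|L_1|\ge u)=1$). The matrix $\mathbf Q$. $\mathbf Q=(q_{i,j})_{i,j=1}^n$ with $q_{i,j}=\frac12\Big|\frac1{|\mathfrak s_{j-1}-\mathfrak m_i|^\alpha}-\frac1{|\mathfrak s_j-\mathfrak m_i|^\alpha}\Big|$ for $i\ne j$ and $q_{i,i}=-\frac12\Big(\frac1{|\mathfrak s_{i-1}-\mathfrak m_i|^\alpha}+\frac1{|\mathfrak s_i-\mathfrak m_i|^\alpha}\Big)$, where $\mathfrak s_0=-\infty$, $\mathfrak s_n=\infty$ and $1/\infty=0$.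 Discretization (fixed, independent of $\varepsilon$). Fix $R,h,\delta>0$ with $-R<\mathfrak m_1$, $\mathfrak m_n<R$ and $\mathfrak s_1,\dots,\mathfrak s_{n-1}\in(-R,R)$. Fix a finite set $\mathcal S\subset[-R,R)$ with $N=|\mathcal S|$ and a partition $[-R,R)=\bigsqcup_{x\in\mathcal S}I_x$, $I_x=[a_x,b_x)$, such that $\max_x(b_x-a_x)\le\delta/2$, $x\in(a_x,b_x)$, $I_x\cap\mathcal S=\{x\}$, $\mathcal M\subset\mathcal S$, and $\{-R,\mathfrak s_1,\dots,\mathfrak s_{n-1},R\}\subset\{a_x,b_x\}_{x\in\mathcal S}$. For $x\in\mathcal S$ the point $x-hU'(x)$ lies in $[-R,R)$, and $y^*(x)=Tx$ denotes the unique element of $\mathcal S$ with $x-hU'(x)\in I_{y^*(x)}$; it is assumed that $x-hU'(x)\notin I_x$ (i.e. $Tx\neq x$) for $x\in\mathcal S\setminus\mathcal M$, while $Tx=x$ for $x\in\mathcal M$. Let $\mathcal S_i$ be the set of points of $\mathcal S$ lying between $\mathfrak s_{i-1}$ and $\mathfrak s_i$. For every $x\in\mathcal S$ the sequence $(T^kx)_{k\ge0}$ is monotone, and for $x\in\mathcal S_i$ it reaches $\mathfrak m_i$ in finitely many steps; moreover $x-hU'(x)$ is an interior point of $I_{y^*(x)}$ for every $x\in\mathcal S$. Perturbed chain. Let $\tilde y=\min\mathcal S$, $\hat y=\max\mathcal S$. For $\varepsilon>0$ let $\mathbf P^\varepsilon=(p^\varepsilon_{x,y})_{x,y\in\mathcal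 S}$ be the stochastic matrix $p^\varepsilon_{x,y}=\mathbb P(x-hU'(x)+\varepsilon h^{1/\alpha}L_1\in I_y)$ for $y\ne\tilde y,\hat y$, $p^\varepsilon_{x,\tilde y}=\mathbb P(x-hU'(x)+\varepsilon h^{1/\alpha}L_1\le b_{\tilde y})$, $p^\varepsilon_{x,\hat y}=\mathbb P(x-hU'(x)+\varepsilon h^{1/\alpha}L_1\ge a_{\hat y})$. Set $\mathbf Q^\varepsilon=\frac1{h\varepsilon^\alpha}(\mathbf P^\varepsilon-\mathbf I_N)$. *)

theory Defs
  imports
    "HOL-Probability.Probability"
    "Jordan_Normal_Form.Char_Poly"
begin

definition C_k :: "nat \<Rightarrow> (real \<Rightarrow> real) \<Rightarrow> bool" where
  "C_k k f \<longleftrightarrow>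
     (\<forall>j<k. \<forall>x. ((deriv ^^ j) f) differentiable (at x)) \<and>
     (\<forall>j\<le>k. continuous_on UNIV ((deriv ^^ j) f))"

definition local_min :: "(real \<Rightarrow> real) \<Rightarrow> real \<Rightarrow> bool" where
  "local_min f x \<longleftrightarrow> (\<forall>\<^sub>F y in nhds x. f x \<le> f y)"

definition local_max :: "(real \<Rightarrow> real) \<Rightarrow> real \<Rightarrow> bool" where
  "local_max f x \<longleftrightarrow> (\<forall>\<^sub>F y in nhds x. f y \<le> f x)"

text \<open>Only the values \<open>s 1, \<dots>, s (n - 1)\<close> of \<open>s\<close> matter; the boundary points
  at index \<open>0\<close> and \<open>n\<close> are infinite.\<close>

definition saddle :: "nat \<Rightarrow> (nat \<Rightarrow> real) \<Rightarrow> nat \<Rightarrow> ereal" where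
  "saddle n s j = (if j = 0 then -\<infinity> else if j = n then \<infinity> else ereal (s j))"

definition multiwell_potential ::
  "nat \<Rightarrow> (real \<Rightarrow> real) \<Rightarrow> (nat \<Rightarrow> real) \<Rightarrow> (nat \<Rightarrow> real) \<Rightarrow> bool" where
  "multiwell_potential n U m s \<longleftrightarrow>
     n \<ge> 2 \<and>
     C_k 3 U \<and>
     (\<exists>c>0. \<forall>\<^sub>F x in at_infinity. \<bar>deriv U x\<bar> > c * \<bar>x\<bar> powr (1 + c)) \<and>
     {x. local_min U x} = m ` {1..n} \<and>
     {x. local_max U x} = s ` {1..n-1} \<and>
     (\<forall>i\<in>{1..n}. saddle n s (i - 1) < ereal (m i) \<and> ereal (m i) < saddle n s i) \<and>
     (\<forall>i\<in>{1..n}. deriv (deriv U) (m i) > 0) \<and>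
     (\<forall>i\<in>{1..n-1}. deriv (deriv U) (s i) < 0)"

definition stable_const :: "real \<Rightarrow> real" where
  "stable_const \<alpha> = \<alpha> * (LBINT y:{0<..}. (1 - cos y) / y powr (1 + \<alpha>))"

definition symmetric_stable_rv :: "real \<Rightarrow> 'w measure \<Rightarrow> ('w \<Rightarrow> real) \<Rightarrow> bool" where
  "symmetric_stable_rv \<alpha> M L \<longleftrightarrow>
     L \<in> borel_measurable M \<and>
     (\<forall>u. char (distr M borel L) u = complex_of_real (exp (- stable_const \<alpha> * \<bar>u\<bar> powr \<alpha>)))"

definition inv_dist_powr :: "real \<Rightarrow> ereal \<Rightarrow> real \<Rightarrow> real" where
  "inv_dist_powr \<alpha> a x = (if \<bar>a\<bar> = \<infinity> then 0 else 1 / \<bar>real_of_ereal a - x\<bar> powr \<alpha>)"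

definition q_entry :: "nat \<Rightarrow> real \<Rightarrow> (nat \<Rightarrow> real) \<Rightarrow> (nat \<Rightarrow> real) \<Rightarrow> nat \<Rightarrow> nat \<Rightarrow> real" where
  "q_entry n \<alpha> m s i j =
     (if i = j
      then - (1/2) * (inv_dist_powr \<alpha> (saddle n s (i - 1)) (m i) + inv_dist_powr \<alpha> (saddle n s i) (m i))
      else 1/2 * \<bar>inv_dist_powr \<alpha> (saddle n s (j - 1)) (m i) - inv_dist_powr \<alpha> (saddle n s j) (m i)\<bar>)"

text \<open>Matrix entries are indexed from \<open>0\<close>, whereas \<open>q_entry\<close> is indexed by \<open>{1..n}\<close>.\<close>

definition Q_mat :: "nat \<Rightarrow> real \<Rightarrow> (nat \<Rightarrow> real) \<Rightarrow> (nat \<Rightarrow> real) \<Rightarrow> real Matrix.mat" where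
  "Q_mat n \<alpha> m s = Matrix.mat n n (\<lambda>(i, j). q_entry n \<alpha> m s (Suc i) (Suc j))"

text \<open>The cell of \<open>x \<in> S\<close> is \<open>{a x..<b x}\<close>. If the cells partition an interval containing
  \<open>x - h * U' x\<close>, then \<open>euler_step\<close> is well defined at \<open>x\<close>.\<close>

definition euler_step ::
  "(real \<Rightarrow> real) \<Rightarrow> real \<Rightarrow> real set \<Rightarrow> (real \<Rightarrow> real) \<Rightarrow> (real \<Rightarrow> real) \<Rightarrow> real \<Rightarrow> real" where
  "euler_step U h S a b x = (THE y. y \<in> S \<and> x - h * deriv U x \<in> {a y..<b y})"

definition well_points :: "nat \<Rightarrow> (nat \<Rightarrow> real) \<Rightarrow> real set \<Rightarrow> nat \<Rightarrow> real set" where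
  "well_points n s S i = {x \<in> S. saddle n s (i - 1) < ereal x \<and> ereal x < saddle n s i}"

definition discretization ::
  "nat \<Rightarrow> (real \<Rightarrow> real) \<Rightarrow> (nat \<Rightarrow> real) \<Rightarrow> (nat \<Rightarrow> real) \<Rightarrow> real \<Rightarrow> real \<Rightarrow> real \<Rightarrow>
   real set \<Rightarrow> (real \<Rightarrow> real) \<Rightarrow> (real \<Rightarrow> real) \<Rightarrow> bool" where
  "discretization n U m s R h \<delta> S a b \<longleftrightarrow>
     R > 0 \<and> h > 0 \<and> \<delta> > 0 \<and>
     -R < m 1 \<and> m n < R \<and> s ` {1..n-1} \<subseteq> {-R<..<R} \<and>
     finite S \<and> S \<subseteq> {-R..<R} \<and>
     (\<Union>x\<in>S. {a x..<b x}) = {-R..<R} \<and>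
     disjoint_family_on (\<lambda>x. {a x..<b x}) S \<and>
     (\<forall>x\<in>S. b x - a x \<le> \<delta> / 2) \<and>
     (\<forall>x\<in>S. x \<in> {a x<..<b x}) \<and>
     (\<forall>x\<in>S. {a x..<b x} \<inter> S = {x}) \<and>
     m ` {1..n} \<subseteq> S \<and>
     {-R, R} \<union> s ` {1..n-1} \<subseteq> a ` S \<union> b ` S \<and>
     (\<forall>x\<in>S. x - h * deriv U x \<in> {-R..<R}) \<and>
     (\<forall>x\<in>S - m ` {1..n}. x - h * deriv U x \<notin> {a x..<b x}) \<and>
     (\<forall>x\<in>m ` {1..n}. euler_step U h S a b x = x) \<and>
     (\<forall>x\<in>S. monoseq (\<lambda>k. (euler_step U h S a b ^^ k) x)) \<and>
     (\<forall>i\<in>{1..n}. \<forall>x\<in>well_points n s S i. \<exists>k. (euler_step U h S a b ^^ k) x = m i) \<and>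
     (\<forall>x\<in>S. x - h * deriv U x \<in>
        interior {a (euler_step U h S a b x)..<b (euler_step U h S a b x)})"

definition p_entry ::
  "real \<Rightarrow> 'w measure \<Rightarrow> ('w \<Rightarrow> real) \<Rightarrow> (real \<Rightarrow> real) \<Rightarrow> real \<Rightarrow> real set \<Rightarrow>
   (real \<Rightarrow> real) \<Rightarrow> (real \<Rightarrow> real) \<Rightarrow> real \<Rightarrow> real \<Rightarrow> real \<Rightarrow> real" where
  "p_entry \<alpha> M L U h S a b \<epsilon> x y =
     (let X = (\<lambda>\<omega>. x - h * deriv U x + \<epsilon> * h powr (1 / \<alpha>) * L \<omega>) in
      if y = Min S then \<P>(\<omega> in M. X \<omega> \<le> b y)
      else if y = Max S then \<P>(\<omega> in M. X \<omega> \<ge> a y)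
      else \<P>(\<omega> in M. X \<omega> \<in> {a y..<b y}))"

text \<open>Rows and columns are indexed by \<open>S\<close> in increasing order; the spectrum does not depend on
  this choice.\<close>

definition P_mat ::
  "real \<Rightarrow> 'w measure \<Rightarrow> ('w \<Rightarrow> real) \<Rightarrow> (real \<Rightarrow> real) \<Rightarrow> real \<Rightarrow> real set \<Rightarrow>
   (real \<Rightarrow> real) \<Rightarrow> (real \<Rightarrow> real) \<Rightarrow> real \<Rightarrow> real Matrix.mat" where
  "P_mat \<alpha> M L U h S a b \<epsilon> = Matrix.mat (card S) (card S)
     (\<lambda>(i, j). p_entry \<alpha> M L U h S a b \<epsilon> (sorted_list_of_set S ! i) (sorted_list_of_set S ! j))"

definition Q_eps_mat ::
  "real \<Rightarrow> 'w measure \<Rightarrow> ('w \<Rightarrow> real) \<Rightarrow> (real \<Rightarrow> real) \<Rightarrow> real \<Rightarrow> real set \<Rightarrow>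
   (real \<Rightarrow> real) \<Rightarrow> (real \<Rightarrow> real) \<Rightarrow> real \<Rightarrow> real Matrix.mat" where
  "Q_eps_mat \<alpha> M L U h S a b \<epsilon> =
     (1 / (h * \<epsilon> powr \<alpha>)) \<cdot>\<^sub>m (P_mat \<alpha> M L U h S a b \<epsilon> - 1\<^sub>m (card S))"

text \<open>The complex eigenvalues of a real matrix, with algebraic multiplicity.\<close>

definition spec_mset :: "real Matrix.mat \<Rightarrow> complex multiset" where
  "spec_mset A = proots (char_poly (map_mat complex_of_real A))"

definition enumerates_spec :: "(nat \<Rightarrow> complex) \<Rightarrow> nat \<Rightarrow> real Matrix.mat \<Rightarrow> bool" where
  "enumerates_spec l k A \<longleftrightarrow> image_mset l (mset_set {1..k}) = spec_mset A"

end

theory Submission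
  imports Defs "HOL-Real_Asymp.Real_Asymp"
begin

text \<open>
Put \<open>\<eta> = h \<epsilon> powr \<alpha>\<close>. The law of \<open>L\<close> has tails \<open>P (L \<ge> u) \<sim> u powr (-\<alpha>) / 2\<close>, so
\<open>P\<^sup>\<epsilon> = P\<^sup>0 + \<eta> B + o(\<eta>)\<close>, where \<open>P\<^sup>0\<close> is the deterministic map \<open>T\<close> and \<open>B\<close> collects rates of long jumps. The map
\<open>T\<close> fixes the \<open>n\<close> minima and moves every other state closer to the minimum of its well. Hence \<open>P\<^sup>0\<close> is
triangular in a suitable order, with eigenvalue \<open>1\<close> of multiplicity \<open>n\<close> and eigenvalue \<open>0\<close> of multiplicity
\<open>N - n\<close>. By continuity of roots, \<open>N - n\<close> of the eigenvalues \<open>(\<mu> - 1) / \<eta>\<close> of \<open>Q\<^sup>\<epsilon>\<close> are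
of size at least \<open>1 / (2 \<eta>)\<close>, far above every admissible \<open>r\<close>.

For the other \<open>n\<close> eigenvalues one looks at \<open>\<eta>\<^sup>N\<^sup>-\<^sup>n det (z - Q\<^sup>\<epsilon>)\<close>, the power of \<open>\<eta>\<close> being used to
rescale the rows of the states that are not minima. The rescaled matrix converges, and its limit becomes
block triangular once the columns of every well are added up. The diagonal blocks are \<open>z - Q\<close>, because the
jump rates from a minimum into the states of a well add up to an entry of \<open>Q\<close>, and a unitriangular matrix.
So the limit is the characteristic polynomial of \<open>Q\<close> (\<open>tree_determinants\<close>), and since the large
eigenvalues contribute a factor tending to \<open>1\<close>, the remaining ones converge to the spectrum of \<open>Q\<close>
(\<open>spectrum_splits\<close>). Continuity of roots (\<open>roots_tendsto\<close>) is elementary: the nearest root is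
split off repeatedly.

The tail of \<open>L\<close> (\<open>stable_tail\<close>) has to be extracted from the characteristic function. The rescaled laws of
\<open>L / u\<close>, weighted by \<open>1 - sinc y\<close>, have explicitly computable characteristic functions, which converge to
that of the weighted jump measure \<open>\<alpha>/2 \<bar>y\<bar> powr (-1-\<alpha>) dy\<close>; the Levy continuity theorem turns this into
convergence of the tails. The absence of atoms (\<open>stable_no_atom\<close>) makes the transition matrix exactly
stochastic, so that \<open>0\<close> is an eigenvalue of \<open>Q\<^sup>\<epsilon>\<close> for every \<open>\<epsilon>\<close>.
\<close>

section \<open>The function 1 - sinc\<close>

lemma abs_sin_less_abs:
  fixes y :: real
  assumes "y \<noteq> 0"
  shows "\<bar>sin y\<bar> < \<bar>y\<bar>"
proof (rule ccontr)
  assume "\<not> \<bar>sin y\<bar> < \<bar>y\<bar>"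
  then have "\<bar>sin y\<bar> = \<bar>y\<bar>" using abs_sin_x_le_abs_x[of y] by simp
  moreover have "\<bar>sin y\<bar> = 2 * \<bar>sin (y/2)\<bar> * \<bar>cos (y/2)\<bar>"
    using sin_double[of "y/2"] by (simp add: abs_mult)
  moreover have "\<bar>sin (y/2)\<bar> \<le> \<bar>y/2\<bar>" by (rule abs_sin_x_le_abs_x)
  ultimately have "\<bar>y\<bar> \<le> \<bar>y\<bar> * \<bar>cos (y/2)\<bar>"
    by (smt (verit) abs_ge_zero abs_divide mult_right_mono abs_numeral field_sum_of_halves)
  then have "\<bar>cos (y/2)\<bar> = 1"
    using assms abs_cos_le_one[of "y/2"] by simp
  then have "sin (y/2) = 0"
    using sin_cos_squared_add[of "y/2"] by (simp add: power2_eq_square abs_mult_self_eq[of "cos (y/2)", symmetric])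
  then show False
    using sin_double[of "y/2"] \<open>\<bar>sin y\<bar> = \<bar>y\<bar>\<close> assms by simp
qed

lemma sinc_less_1: "y \<noteq> 0 \<Longrightarrow> sinc y < 1"
  using abs_sin_less_abs[of y] by (auto simp: divide_simps)

lemma sinc_le_1: "sinc y \<le> 1"
  by (metis sinc_less_1 less_eq_real_def)

text \<open>On \<open>[2, \<infinity>)\<close> the bound \<open>\<bar>sin\<bar> \<le> 1\<close> gives a gap of \<open>1/2\<close>; on \<open>[1, 2]\<close> compactness does.
The gap makes \<open>1 / (1 - sinc y)\<close> an admissible bounded test function away from \<open>0\<close>.\<close>

lemma sinc_bounded_away:
  obtains d where "0 < d" "\<And>y. 1 \<le> y \<Longrightarrow> d \<le> 1 - sinc y"
proof -
  have "continuous_on {1..2} (\<lambda>y. 1 - sinc y)"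
    by (intro continuous_intros continuous_on_sinc)
  then obtain x where x: "x \<in> {1..2}" "\<And>y. y \<in> {1..2} \<Longrightarrow> 1 - sinc x \<le> 1 - sinc y"
    using continuous_attains_inf[of "{1..2::real}" "\<lambda>y. 1 - sinc y"] by auto
  show thesis
  proof (rule that[of "min (1/2) (1 - sinc x)"])
    show "0 < min (1/2) (1 - sinc x)" using sinc_less_1[of x] x(1) by auto
    show "min (1/2) (1 - sinc x) \<le> 1 - sinc y" if "1 \<le> y" for y
    proof (cases "y \<le> 2")
      case True then show ?thesis using x(2)[of y] that by auto
    next
      case False
      then have "sin y / y \<le> 1/2" using order_trans[OF sin_le_one[of y]] by (simp add: divide_simps) (smt (verit) sin_le_one)
      then have "1/2 \<le> 1 - sinc y" using False by auto
      then show ?thesis by linarith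
    qed
  qed
qed

text \<open>Averaging \<open>1 - cos (v * y)\<close> over the frequencies \<open>v\<close> in \<open>[0, 1]\<close> removes the zeros that each
single frequency has at its periods: the average vanishes only at \<open>y = 0\<close>, where it is of
second order.\<close>

lemma integral_one_minus_cos:
  fixes y :: real
  shows "(\<integral>v. indicator {0..1} v * (1 - cos (v * y)) \<partial>lborel) = 1 - sinc y"
proof -
  define F where "F v = (if y = 0 then 0 else v - sin (v * y) / y)" for v
  have "(\<integral>v. (1 - cos (v * y)) * indicator {0..1} v \<partial>lborel) = F 1 - F 0"
  proof (rule integral_FTC_Icc_real)
    show "(F has_real_derivative 1 - cos (v * y)) (at v)" if "0 \<le> v" "v \<le> 1" for v
      unfolding F_def by (cases "y = 0") (auto intro!: derivative_eq_intros)
  qed (auto intro!: continuous_intros)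
  then show ?thesis by (simp add: F_def mult.commute)
qed

section \<open>Weighting a symmetric measure by 1 - sinc\<close>

text \<open>The product formula
\<open>(1 - cos (v y)) cos (t y) = (1 - cos ((t+v) y)) / 2 + (1 - cos ((t-v) y)) / 2 - (1 - cos (t y))\<close>,
integrated against \<open>K\<close> and then over \<open>v\<close>, expresses the cosine transform of the measure
\<open>(1 - sinc y) K(dy)\<close> through \<open>\<psi>\<close> alone. This covers measures \<open>K\<close> of infinite mass near \<open>0\<close>, for
which only \<open>1 - cos\<close>, and not \<open>cos\<close> itself, can be integrated.\<close>

lemma sinc_weighted_cosine_transform:
  fixes K :: "real measure" and \<psi> :: "real \<Rightarrow> real"
  assumes sf: "sigma_finite_measure K" and sets [measurable_cong]: "sets K = sets borel"
    and int: "\<And>t. integrable K (\<lambda>y. 1 - cos (t * y))"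
    and \<psi>: "\<And>t. \<psi> t = (\<integral>y. 1 - cos (t * y) \<partial>K)"
    and cont: "continuous_on UNIV \<psi>"
  shows integrable_one_minus_sinc: "integrable K (\<lambda>y. 1 - sinc y)"
    and integral_cos_one_minus_sinc: "(\<integral>y. (1 - sinc y) * cos (t * y) \<partial>K) =
      (\<integral>v. indicator {0..1} v * (\<psi> (t + v) / 2 + \<psi> (t - v) / 2 - \<psi> t) \<partial>lborel)"
proof -
  interpret K: sigma_finite_measure K by fact
  interpret pair_sigma_finite lborel K by (simp add: pair_sigma_finite_def sf lborel.sigma_finite_measure_axioms)
  define g where "g p = (case p of (v, y) \<Rightarrow> indicator {0..1} v * (1 - cos (v * y)))" for p :: "real \<times> real"
  have [measurable]: "g \<in> borel_measurable (lborel \<Otimes>\<^sub>M K)"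
    unfolding g_def by measurable
  have g_nonneg: "g p \<ge> 0" for p
    by (auto simp: g_def indicator_def split: prod.splits)
  have int_g: "(\<integral>y. g (v, y) \<partial>K) = indicator {0..1} v * \<psi> v" for v
    by (simp add: g_def \<psi>)
  have int_\<psi>: "integrable lborel (\<lambda>v. indicator {0..1} v * f v)" if "continuous_on UNIV f" for f :: "real \<Rightarrow> real"
    using borel_integrable_atLeastAtMost'[of 0 1 f] continuous_on_subset[OF that]
    by (simp add: set_integrable_def mult.commute)
  have g: "integrable (lborel \<Otimes>\<^sub>M K) g"
  proof (rule Fubini_integrable)
    show "integrable lborel (\<lambda>v. \<integral>y. norm (g (v, y)) \<partial>K)"
      using int_\<psi>[OF cont] g_nonneg int_g by simp
    show "AE v in lborel. integrable K (\<lambda>y. g (v, y))"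
      using int by (simp add: g_def)
  qed measurable
  have g2: "(\<integral>v. g (v, y) \<partial>lborel) = 1 - sinc y" for y
    using integral_one_minus_cos[of y] by (simp add: g_def)
  show "integrable K (\<lambda>y. 1 - sinc y)"
    using integrable_snd[of "\<lambda>v y. g (v, y)"] g g2 by simp
  define f where "f v y = g (v, y) * cos (t * y)" for v y
  have f: "integrable (lborel \<Otimes>\<^sub>M K) (case_prod f)"
  proof (rule Bochner_Integration.integrable_bound[OF g])
    show "case_prod f \<in> borel_measurable (lborel \<Otimes>\<^sub>M K)"
      unfolding f_def by measurable
    show "AE p in lborel \<Otimes>\<^sub>M K. norm (case_prod f p) \<le> norm (g p)"
      by (auto simp: f_def abs_mult mult_left_le)
  qed
  have "(\<integral>y. (1 - sinc y) * cos (t * y) \<partial>K) = (\<integral>y. (\<integral>v. f v y \<partial>lborel) \<partial>K)"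
    unfolding f_def using g2 by simp
  also have "\<dots> = (\<integral>v. (\<integral>y. f v y \<partial>K) \<partial>lborel)"
    by (rule Fubini_integral[OF f])
  also have "(\<lambda>v. \<integral>y. f v y \<partial>K) = (\<lambda>v. indicator {0..1} v * (\<psi> (t + v) / 2 + \<psi> (t - v) / 2 - \<psi> t))"
  proof
    fix v
    have eq: "(1 - cos (v * y)) * cos (t * y) =
        ((1 - cos ((t + v) * y)) / 2 + (1 - cos ((t - v) * y)) / 2) - (1 - cos (t * y))" for y
      by (simp add: cos_add cos_diff ring_distribs) (simp add: field_simps)
    have "(\<integral>y. f v y \<partial>K) = indicator {0..1} v * (\<integral>y. (1 - cos (v * y)) * cos (t * y) \<partial>K)"
      by (simp add: f_def g_def mult.assoc)
    also have "(\<integral>y. (1 - cos (v * y)) * cos (t * y) \<partial>K) = \<psi> (t + v) / 2 + \<psi> (t - v) / 2 - \<psi> t"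
      unfolding eq \<psi> using int by simp
    finally show "(\<integral>y. f v y \<partial>K) = indicator {0..1} v * (\<psi> (t + v) / 2 + \<psi> (t - v) / 2 - \<psi> t)" .
  qed
  finally show "(\<integral>y. (1 - sinc y) * cos (t * y) \<partial>K) =
      (\<integral>v. indicator {0..1} v * (\<psi> (t + v) / 2 + \<psi> (t - v) / 2 - \<psi> t) \<partial>lborel)" .
qed

lemma integral_odd_symmetric:
  fixes f :: "real \<Rightarrow> real"
  assumes sets [measurable_cong]: "sets K = sets borel" and sym: "distr K borel uminus = K"
    and [measurable]: "f \<in> borel_measurable borel" and odd: "\<And>y. f (- y) = - f y"
  shows "(\<integral>y. f y \<partial>K) = 0"
proof -
  have "(\<integral>y. f y \<partial>K) = (\<integral>y. f y \<partial>distr K borel uminus)" by (simp add: sym)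
  also have "\<dots> = (\<integral>y. f (- y) \<partial>K)" by (subst integral_distr) auto
  finally show ?thesis by (simp add: odd)
qed

text \<open>The weight \<open>1 - sinc y\<close> turns a measure that may explode at \<open>0\<close> into a finite one, and
normalization makes it a probability measure, to which the Levy continuity theorem applies.\<close>

definition sinc_mass :: "real measure \<Rightarrow> real" where
  "sinc_mass K = (\<integral>y. 1 - sinc y \<partial>K)"

definition sinc_distr :: "real measure \<Rightarrow> real measure" where
  "sinc_distr K = density K (\<lambda>y. ennreal ((1 - sinc y) / sinc_mass K))"

text \<open>The characteristic function of \<open>sinc_distr K\<close> is a quotient of two expressions linear in \<open>\<psi>\<close>. So it
does not see constant factors of \<open>K\<close>, and it converges as soon as suitable multiples of \<open>\<psi>\<close> do.\<close>

lemma sinc_distr: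
  fixes K :: "real measure" and \<psi> :: "real \<Rightarrow> real"
  assumes sf: "sigma_finite_measure K" and sets [measurable_cong]: "sets K = sets borel"
    and sym: "distr K borel uminus = K"
    and int: "\<And>t. integrable K (\<lambda>y. 1 - cos (t * y))"
    and \<psi>: "\<And>t. \<psi> t = (\<integral>y. 1 - cos (t * y) \<partial>K)"
    and cont: "continuous_on UNIV \<psi>"
    and ae: "AE y in K. y \<noteq> 0" and nz: "emeasure K UNIV \<noteq> 0"
  shows sinc_mass_pos: "0 < sinc_mass K"
    and real_distribution_sinc_distr: "real_distribution (sinc_distr K)"
    and char_sinc_distr: "char (sinc_distr K) t =
      of_real ((\<integral>v. indicator {0..1} v * (\<psi> (t + v) / 2 + \<psi> (t - v) / 2 - \<psi> t) \<partial>lborel) / sinc_mass K)"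
    and integral_sinc_distr: "\<And>f :: real \<Rightarrow> real. f \<in> borel_measurable borel \<Longrightarrow>
      (\<integral>y. f y \<partial>sinc_distr K) = (\<integral>y. (1 - sinc y) * f y \<partial>K) / sinc_mass K"
proof -
  note ints = integrable_one_minus_sinc[OF sf sets int \<psi> cont]
  have nn: "1 - sinc y \<ge> 0" for y using sinc_le_1[of y] by simp
  have space: "space K = UNIV" using sets_eq_imp_space_eq[OF sets] by simp
  show pos: "0 < sinc_mass K"
  proof (rule ccontr)
    assume "\<not> 0 < sinc_mass K"
    then have "(\<integral>y. 1 - sinc y \<partial>K) = 0"
      unfolding sinc_mass_def using Bochner_Integration.integral_nonneg[of K "\<lambda>y. 1 - sinc y"] nn by (simp only: not_less) (metis order_antisym)
    then have "AE y in K. 1 - sinc y = 0"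
      using integral_nonneg_eq_0_iff_AE[OF ints] nn by simp
    with ae have "AE y in K. False"
      by eventually_elim (use sinc_less_1 in fastforce)
    then show False
      using nz space ae_filter_eq_bot_iff[of K] by (simp add: eventually_False)
  qed
  have emb: "emeasure (sinc_distr K) UNIV = 1"
  proof -
    have "emeasure (sinc_distr K) UNIV = (\<integral>\<^sup>+y. ennreal ((1 - sinc y) / sinc_mass K) \<partial>K)"
      unfolding sinc_distr_def by (subst emeasure_density) (simp_all add: space measurable_cong_sets[OF sets refl])
    also have "\<dots> = ennreal (\<integral>y. (1 - sinc y) / sinc_mass K \<partial>K)"
      using ints pos nn by (intro nn_integral_eq_integral) auto
    also have "\<dots> = 1" using pos by (simp add: sinc_mass_def)
    finally show ?thesis .
  qed
  have spc: "space (sinc_distr K) = UNIV" by (simp add: sinc_distr_def space)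
  interpret prob_space "sinc_distr K"
    by standard (simp add: emb spc)
  show rd: "real_distribution (sinc_distr K)"
    by standard (simp add: sinc_distr_def sets)
  show int_f: "(\<integral>y. f y \<partial>sinc_distr K) = (\<integral>y. (1 - sinc y) * f y \<partial>K) / sinc_mass K"
    if [measurable]: "f \<in> borel_measurable borel" for f :: "real \<Rightarrow> real"
    unfolding sinc_distr_def using pos nn by (subst integral_density) auto
  show "char (sinc_distr K) t =
      of_real ((\<integral>v. indicator {0..1} v * (\<psi> (t + v) / 2 + \<psi> (t - v) / 2 - \<psi> t) \<partial>lborel) / sinc_mass K)"
  proof -
    interpret R: real_distribution "sinc_distr K" by fact
    have "char (sinc_distr K) t = (\<integral>y. complex_of_real (cos (t * y)) + \<i> * complex_of_real (sin (t * y)) \<partial>sinc_distr K)"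
      unfolding char_def
      by (intro Bochner_Integration.integral_cong refl) (simp add: cis_conv_exp[symmetric] complex_eq_iff flip: of_real_mult)
    also have "\<dots> = of_real (\<integral>y. cos (t * y) \<partial>sinc_distr K) + \<i> * of_real (\<integral>y. sin (t * y) \<partial>sinc_distr K)"
      by (subst Bochner_Integration.integral_add)
         (auto intro!: integrable_const_bound[where B=1] simp: norm_mult)
    also have "(\<integral>y. cos (t * y) \<partial>sinc_distr K) =
        (\<integral>v. indicator {0..1} v * (\<psi> (t + v) / 2 + \<psi> (t - v) / 2 - \<psi> t) \<partial>lborel) / sinc_mass K"
      by (simp add: int_f integral_cos_one_minus_sinc[OF sf sets int \<psi> cont])
    also have "(\<integral>y. sin (t * y) \<partial>sinc_distr K) = 0"
      using integral_odd_symmetric[OF sets sym, of "\<lambda>y. (1 - sinc y) * sin (t * y)"]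
      by (simp add: int_f)
    finally show ?thesis by simp
  qed
qed

section \<open>The jump measure of a symmetric stable law\<close>

lemma set_integrable_powr_tail:
  fixes p :: real
  assumes "0 < p"
  shows "set_integrable lborel {1<..} (\<lambda>y. y powr (-1 - p))"
    and "(LBINT y:{1<..}. y powr (-1 - p)) = 1 / p"
proof -
  define F where "F y = - (y powr (-p) / p)" for y :: real
  have [simp]: "einterval 1 \<infinity> = {1::real<..}"
    by (auto simp: einterval_def one_ereal_def)
  have D: "(F has_real_derivative y powr (-1 - p)) (at y)" if "1 < y" for y
    unfolding F_def using that assms
    by (auto intro!: derivative_eq_intros simp: field_simps minus_diff_commute)
  have A: "((F \<circ> real_of_ereal) \<longlongrightarrow> - (1 / p)) (at_right 1)"
    unfolding F_def one_ereal_def using assms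
    by (auto simp: ereal_tendsto_simps intro!: tendsto_eq_intros)
  have B: "((F \<circ> real_of_ereal) \<longlongrightarrow> 0) (at_left \<infinity>)"
    using tendsto_divide[OF tendsto_minus[OF tendsto_neg_powr[of "-p", OF _ filterlim_ident]] tendsto_const[of p]] assms
    by (simp add: ereal_tendsto_simps F_def[abs_def])
  have C: "isCont (\<lambda>y. y powr (-1 - p)) y" if "1 < y" for y :: real
    using that by (auto intro!: continuous_intros)
  note FTC = interval_integral_FTC_nonneg[of 1 \<infinity> F "\<lambda>y. y powr (-1 - p)", OF _ _ _ _ A B]
  show "set_integrable lborel {1<..} (\<lambda>y. y powr (-1 - p))"
    using FTC(1) D C by (simp add: one_ereal_def)
  have "(LBINT y=1..\<infinity>. y powr (-1 - p)) = 1 / p"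
    using FTC(2) D C by (simp add: one_ereal_def)
  then show "(LBINT y:{1<..}. y powr (-1 - p)) = 1 / p"
    by (simp add: interval_lebesgue_integral_def)
qed

lemma set_integrable_powr_0_1:
  fixes p :: real
  assumes "-1 < p"
  shows "set_integrable lborel {0<..<1} (\<lambda>y. y powr p)"
proof -
  define F where "F y = y powr (p + 1) / (p + 1)" for y :: real
  have [simp]: "einterval 0 1 = {0::real<..<1}"
    by (auto simp: einterval_def one_ereal_def zero_ereal_def)
  have "set_integrable lborel (einterval 0 1) (\<lambda>y. y powr p)"
  proof (rule interval_integral_FTC_nonneg)
    show "(F has_real_derivative y powr p) (at y)" if "0 < ereal y" for y
      using DERIV_cdivide[OF has_real_derivative_powr[of y "p + 1"], of "p + 1"] that assms
      by (simp add: F_def[abs_def])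
    show "isCont (\<lambda>y. y powr p) y" if "0 < ereal y" for y :: real
      using that by (auto intro!: continuous_intros)
    show "((F \<circ> real_of_ereal) \<longlongrightarrow> 0) (at_right 0)"
      unfolding F_def zero_ereal_def using assms
      by (auto simp: ereal_tendsto_simps intro!: tendsto_eq_intros tendsto_zero_powrI[where b="p+1"])
         (auto simp: eventually_at_right_less intro: eventually_mono[OF eventually_at_right_less])
    show "((F \<circ> real_of_ereal) \<longlongrightarrow> 1 / (p + 1)) (at_left 1)"
      unfolding F_def one_ereal_def using assms
      by (auto simp: ereal_tendsto_simps intro!: tendsto_eq_intros)
  qed auto
  then show ?thesis by simp
qed

lemma even_integral:
  fixes f :: "real \<Rightarrow> real"
  assumes [measurable]: "f \<in> borel_measurable borel" and even: "\<And>y. f (- y) = f y"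
    and int: "set_integrable lborel {0<..} f"
  shows "integrable lborel f" and "(\<integral>y. f y \<partial>lborel) = 2 * (LBINT y:{0<..}. f y)"
proof -
  define g where "g y = indicator {0<..} y * f y" for y
  have g: "integrable lborel g" using int by (simp add: g_def[abs_def] set_integrable_def)
  have g': "integrable lborel (\<lambda>y. g (- y))"
    using lborel_integrable_real_affine[OF g, of "-1" 0] by simp
  have gI: "(\<integral>y. g (- y) \<partial>lborel) = (\<integral>y. g y \<partial>lborel)"
    using lborel_integral_real_affine[of "-1" g 0] by simp
  have ae: "AE y in lborel. g y + g (- y) = f y"
    using AE_lborel_singleton[of "0::real"]
    by eventually_elim (auto simp: g_def indicator_def even)
  have [measurable]: "g \<in> borel_measurable borel" unfolding g_def by measurable
  have "integrable lborel (\<lambda>y. g y + g (- y))" using g g' by simp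
  then show "integrable lborel f"
    using ae by (subst (asm) integrable_cong_AE[of _ _ f]) auto
  have "(\<integral>y. f y \<partial>lborel) = (\<integral>y. g y + g (- y) \<partial>lborel)"
    using ae by (intro integral_cong_AE) auto
  also have "\<dots> = 2 * (\<integral>y. g y \<partial>lborel)" using g g' gI by simp
  finally show "(\<integral>y. f y \<partial>lborel) = 2 * (LBINT y:{0<..}. f y)"
    by (simp add: g_def[abs_def] set_lebesgue_integral_def)
qed

text \<open>The jump measure of the stable law, normalized to mass \<open>1/2\<close> on each of \<open>(-\<infinity>, -1]\<close> and \<open>[1, \<infinity>)\<close>.
At \<open>y = 0\<close> the density has the default value \<open>0 powr _ = 0\<close>.\<close>

definition stable_levy_measure :: "real \<Rightarrow> real measure" where
  "stable_levy_measure \<alpha> = density lborel (\<lambda>y. ennreal (\<alpha> / 2 * \<bar>y\<bar> powr (-1 - \<alpha>)))"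

lemma one_minus_cos_le: "1 - cos x \<le> x\<^sup>2 / 2" for x :: real
proof -
  have "1 - cos x = 2 * (sin (x/2))\<^sup>2" using cos_double_sin[of "x/2"] by simp
  also have "\<dots> \<le> 2 * (x/2)\<^sup>2"
    using power_mono[OF abs_sin_x_le_abs_x[of "x/2"], of 2] by (simp add: power_divide)
  finally show ?thesis by (simp add: power2_eq_square)
qed

context
  fixes \<alpha> :: real
  assumes alpha: "0 < \<alpha>" "\<alpha> < 2"
begin

text \<open>Near \<open>0\<close> the factor \<open>1 - cos (t * y)\<close> is at most \<open>(t * y)\<^sup>2 / 2\<close>, which beats the singularity because
\<open>\<alpha> < 2\<close>; at infinity it is bounded and \<open>\<alpha> > 0\<close> suffices.\<close>

lemma set_integrable_one_minus_cos:
  "set_integrable lborel {0<..} (\<lambda>y. (1 - cos (t * y)) * \<bar>y\<bar> powr (-1 - \<alpha>))"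
proof -
  define w where "w y = indicator {0<..<1} y * (t\<^sup>2 / 2 * y powr (1 - \<alpha>)) + indicator {1<..} y * (2 * y powr (-1 - \<alpha>))" for y
  have 1: "integrable lborel (\<lambda>y. indicator {0<..<1} y * (t\<^sup>2 / 2 * y powr (1 - \<alpha>)))"
    using set_integrable_powr_0_1[of "1 - \<alpha>"] alpha
    by (auto simp: set_integrable_def mult.left_commute[of "indicator _ _"])
  have 2: "integrable lborel (\<lambda>y. indicator {1<..} y * (2 * y powr (-1 - \<alpha>)))"
    using set_integrable_powr_tail(1)[of \<alpha>] alpha
    by (auto simp: set_integrable_def mult.left_commute[of "indicator _ _"])
  have w: "integrable lborel w" unfolding w_def using 1 2 by simp
  have ae: "AE y in lborel. norm (indicator {0<..} y * ((1 - cos (t * y)) * \<bar>y\<bar> powr (-1 - \<alpha>))) \<le> norm (w y)"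
    using AE_lborel_singleton[of "1::real"]
  proof eventually_elim
    case (elim y)
    consider "y \<le> 0" | "0 < y" "y < 1" | "1 < y" using elim by linarith
    then show ?case
    proof cases
      case 2
      have "(1 - cos (t * y)) * \<bar>y\<bar> powr (-1 - \<alpha>) \<le> (t * y)\<^sup>2 / 2 * y powr (-1 - \<alpha>)"
        using 2 one_minus_cos_le[of "t * y"] by (auto intro: mult_right_mono)
      also have "\<dots> = t\<^sup>2 / 2 * (y powr 2 * y powr (-1 - \<alpha>))"
        using 2 by (simp add: power_mult_distrib powr_numeral)
      also have "\<dots> = t\<^sup>2 / 2 * y powr (1 - \<alpha>)" by (subst powr_add[symmetric]) simp
      finally show ?thesis using 2 by (simp add: w_def)
    next
      case 3
      have "1 - cos (t * y) \<le> 2" using cos_ge_minus_one[of "t * y"] by linarith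
      then show ?thesis using 3 by (auto simp: w_def intro!: mult_right_mono)
    qed simp
  qed
  have "integrable lborel (\<lambda>y. indicator {0<..} y * ((1 - cos (t * y)) * \<bar>y\<bar> powr (-1 - \<alpha>)))"
    by (rule Bochner_Integration.integrable_bound[OF w _ ae]) measurable
  then show ?thesis by (simp add: set_integrable_def)
qed

lemma stable_const_altdef:
  "stable_const \<alpha> = \<alpha> * (LBINT y:{0<..}. (1 - cos y) * \<bar>y\<bar> powr (-1 - \<alpha>))"
proof -
  have "(LBINT y:{0<..}. (1 - cos y) / y powr (1 + \<alpha>)) = (LBINT y:{0<..}. (1 - cos y) * \<bar>y\<bar> powr (-1 - \<alpha>))"
    by (intro set_lebesgue_integral_cong)
       (auto simp: powr_minus divide_inverse simp flip: powr_minus[of _ "1 + \<alpha>"])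
  then show ?thesis by (simp add: stable_const_def)
qed

lemma stable_const_pos: "0 < stable_const \<alpha>"
proof -
  define f where "f y = indicator {0<..} y * ((1 - cos y) * \<bar>y\<bar> powr (-1 - \<alpha>))" for y
  have nn: "f y \<ge> 0" for y by (simp add: f_def)
  have int: "integrable lborel f"
    using set_integrable_one_minus_cos[of 1] by (simp add: set_integrable_def f_def[abs_def])
  have "integral\<^sup>L lborel f \<noteq> 0"
  proof
    assume "integral\<^sup>L lborel f = 0"
    then have "AE y in lborel. f y = 0"
      using integral_nonneg_eq_0_iff_AE[OF int] nn by simp
    then have "AE y in lborel. y \<notin> {1<..<2::real}"
    proof eventually_elim
      case (elim y)
      have "cos y < cos 0" if "1 < y" "y < 2"
        using that pi_gt3 by (intro cos_monotone_0_pi) auto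
      with elim show ?case by (auto simp: f_def)
    qed
    then have "{1<..<2::real} \<in> null_sets lborel"
      by (subst AE_iff_null_sets) auto
    then show False by (simp add: null_sets_def)
  qed
  moreover have "0 \<le> integral\<^sup>L lborel f"
    using nn by (simp add: Bochner_Integration.integral_nonneg)
  ultimately have "0 < integral\<^sup>L lborel f" by simp
  moreover have "stable_const \<alpha> = \<alpha> * integral\<^sup>L lborel f"
    unfolding stable_const_altdef by (simp add: set_lebesgue_integral_def f_def[abs_def])
  ultimately show ?thesis using alpha by simp
qed

text \<open>The substitution \<open>y \<mapsto> t * y\<close> shows that the integral is homogeneous of degree \<open>\<alpha>\<close> in \<open>t\<close>. It is the
Levy exponent of the stable law, which identifies \<open>stable_levy_measure\<close> as its jump measure.\<close>

lemma stable_levy_measure_cos: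
  shows integrable_stable_levy_measure_cos: "integrable (stable_levy_measure \<alpha>) (\<lambda>y. 1 - cos (t * y))"
    and integral_stable_levy_measure_cos:
      "(\<integral>y. 1 - cos (t * y) \<partial>stable_levy_measure \<alpha>) = stable_const \<alpha> * \<bar>t\<bar> powr \<alpha>"
proof -
  define g where "g t y = (1 - cos (t * y)) * \<bar>y\<bar> powr (-1 - \<alpha>)" for t y :: real
  have [measurable]: "g t \<in> borel_measurable borel" for t unfolding g_def by measurable
  note g = even_integral[of "g t" for t, unfolded g_def, OF _ _ set_integrable_one_minus_cos, simplified, folded g_def]
  have 1: "(\<integral>y. g 1 y \<partial>lborel) * \<alpha> / 2 = stable_const \<alpha>"
    using g(2)[of 1] unfolding stable_const_altdef by (simp add: g_def)
  have t: "(\<integral>y. g t y \<partial>lborel) = \<bar>t\<bar> powr \<alpha> * (\<integral>y. g 1 y \<partial>lborel)"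
  proof (cases "t = 0")
    case True then show ?thesis by (simp add: g_def)
  next
    case False
    have "g 1 (0 + t * y) = \<bar>t\<bar> powr (-1 - \<alpha>) * g t y" for y
      by (simp add: g_def abs_mult powr_mult)
    then have "(\<integral>y. g 1 y \<partial>lborel) = \<bar>t\<bar> * (\<bar>t\<bar> powr (-1 - \<alpha>) * (\<integral>y. g t y \<partial>lborel))"
      using lborel_integral_real_affine[of t "g 1" 0] False by simp
    also have "\<bar>t\<bar> * (\<bar>t\<bar> powr (-1 - \<alpha>) * x) = \<bar>t\<bar> powr (- \<alpha>) * x" for x
      using False powr_add[of "\<bar>t\<bar>" 1 "-1 - \<alpha>"] by simp
    finally show ?thesis using False by (simp add: powr_minus field_simps)
  qed
  have dens: "\<alpha> / 2 * \<bar>y\<bar> powr (-1 - \<alpha>) \<ge> 0" for y using alpha by simp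
  have eq: "\<alpha> * \<bar>y\<bar> powr (-1 - \<alpha>) * (1 - cos (t * y)) = \<alpha> * g t y" for y
    by (simp add: g_def)
  show "integrable (stable_levy_measure \<alpha>) (\<lambda>y. 1 - cos (t * y))"
    unfolding stable_levy_measure_def using g(1)[of t] dens
    by (subst integrable_density) (auto simp: eq)
  have "(\<integral>y. 1 - cos (t * y) \<partial>stable_levy_measure \<alpha>) = (\<integral>y. \<alpha> / 2 * g t y \<partial>lborel)"
    unfolding stable_levy_measure_def using dens
    by (subst integral_density) (auto simp: eq)
  also have "\<dots> = \<alpha> / 2 * (\<bar>t\<bar> powr \<alpha> * (\<integral>y. g 1 y \<partial>lborel))"
    by (subst t[symmetric]) simp
  also have "\<dots> = stable_const \<alpha> * \<bar>t\<bar> powr \<alpha>"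
    unfolding 1[symmetric] by simp
  finally show "(\<integral>y. 1 - cos (t * y) \<partial>stable_levy_measure \<alpha>) = stable_const \<alpha> * \<bar>t\<bar> powr \<alpha>" .
qed

lemma stable_levy_measure_basic:
  shows sigma_finite_stable_levy_measure: "sigma_finite_measure (stable_levy_measure \<alpha>)"
    and sets_stable_levy_measure: "sets (stable_levy_measure \<alpha>) = sets borel"
    and symmetric_stable_levy_measure: "distr (stable_levy_measure \<alpha>) borel uminus = stable_levy_measure \<alpha>"
    and AE_stable_levy_measure: "AE y in stable_levy_measure \<alpha>. y \<noteq> x"
    and measure_stable_levy_measure: "measure (stable_levy_measure \<alpha>) {1..} = 1/2"
    and emeasure_stable_levy_measure_UNIV: "emeasure (stable_levy_measure \<alpha>) UNIV \<noteq> 0"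
proof -
  let ?f = "\<lambda>y. ennreal (\<alpha> / 2 * \<bar>y\<bar> powr (-1 - \<alpha>))"
  show "sigma_finite_measure (stable_levy_measure \<alpha>)"
    unfolding stable_levy_measure_def by (subst sigma_finite_measure.sigma_finite_iff_density_finite[OF lborel.sigma_finite_measure_axioms]) auto
  show sets: "sets (stable_levy_measure \<alpha>) = sets borel"
    by (simp add: stable_levy_measure_def)
  show "distr (stable_levy_measure \<alpha>) borel uminus = stable_levy_measure \<alpha>"
  proof -
    have "distr (stable_levy_measure \<alpha>) borel uminus = density (distr lborel borel uminus) ?f"
      unfolding stable_levy_measure_def by (subst density_distr) auto
    then show ?thesis by (simp add: lborel_distr_uminus stable_levy_measure_def)
  qed
  show "AE y in stable_levy_measure \<alpha>. y \<noteq> x"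
    unfolding stable_levy_measure_def using AE_lborel_singleton[of x]
    by (subst AE_density) auto
  have "emeasure (stable_levy_measure \<alpha>) {1..} = (\<integral>\<^sup>+y. ?f y * indicator {1..} y \<partial>lborel)"
    unfolding stable_levy_measure_def by (subst emeasure_density) auto
  also have "\<dots> = (\<integral>\<^sup>+y. ennreal (\<alpha> / 2 * (indicator {1<..} y * y powr (-1 - \<alpha>))) \<partial>lborel)"
    using AE_lborel_singleton[of "1::real"]
    by (intro nn_integral_cong_AE, eventually_elim) (auto simp: indicator_def)
  also have "\<dots> = ennreal (\<integral>y. \<alpha> / 2 * (indicator {1<..} y * y powr (-1 - \<alpha>)) \<partial>lborel)"
    using alpha set_integrable_powr_tail(1)[of \<alpha>]
    by (intro nn_integral_eq_integral) (auto simp: set_integrable_def)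
  also have "\<dots> = ennreal (1/2)"
    using alpha set_integrable_powr_tail(2)[of \<alpha>]
    by (simp add: set_lebesgue_integral_def)
  finally have em: "emeasure (stable_levy_measure \<alpha>) {1..} = ennreal (1/2)" .
  then show "measure (stable_levy_measure \<alpha>) {1..} = 1/2"
    unfolding measure_def by (simp only: enn2real_ennreal)
  have "emeasure (stable_levy_measure \<alpha>) {1..} \<le> emeasure (stable_levy_measure \<alpha>) UNIV"
    by (intro emeasure_mono) (auto simp: sets)
  then show "emeasure (stable_levy_measure \<alpha>) UNIV \<noteq> 0" using em by auto
qed

end

section \<open>Tails of symmetric stable laws\<close>

lemma continuous_on_abs_powr:
  fixes f :: "real \<Rightarrow> real"
  assumes "0 < \<alpha>" "continuous_on S f"
  shows "continuous_on S (\<lambda>x. \<bar>f x\<bar> powr \<alpha>)"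
  using assms by (intro continuous_on_powr') (auto intro!: continuous_intros)

text \<open>The mass of \<open>{x}\<close> is at most the expectation of the Gaussian bump \<open>exp (- (k (Y - x))\<^sup>2 / 2)\<close>. The bump is
itself a characteristic function, so by Fubini this expectation is an average of
\<open>char D (k v)\<close> times a phase over a standard normal \<open>v\<close>, and \<open>char D (k v)\<close> tends to \<open>0\<close> as \<open>k\<close> grows
for every \<open>v \<noteq> 0\<close>.\<close>

lemma stable_no_atom:
  assumes D: "real_distribution D" and c: "0 < c" and \<alpha>: "0 < \<alpha>"
    and char: "\<And>u. char D u = complex_of_real (exp (- c * \<bar>u\<bar> powr \<alpha>))"
  shows "measure D {x} = 0"
proof -
  interpret D: real_distribution D by fact
  define N where "N = std_normal_distribution"
  interpret N: real_distribution N unfolding N_def by (rule real_dist_normal_dist)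
  interpret pair_sigma_finite D N ..
  interpret P: pair_prob_space D N ..
  define f where "f k y v = iexp (real k * v * (y - x))" for k :: nat and y v :: real
  have f_split: "f k y v = iexp ((real k * v) * y) * iexp (- (real k * v * x))" for k y v
    unfolding f_def by (subst exp_add[symmetric]) (simp add: algebra_simps)
  have [measurable]: "case_prod (f k) \<in> borel_measurable (D \<Otimes>\<^sub>M N)" for k
    unfolding f_def by measurable
  have f_int: "integrable (D \<Otimes>\<^sub>M N) (case_prod (f k))" for k
    by (rule P.integrable_const_bound[where B=1]) (auto simp: f_def[abs_def])
  have gauss: "(\<integral>v. f k y v \<partial>N) = of_real (exp (- (real k * (y - x))\<^sup>2 / 2))" for k y
  proof -
    have "(\<integral>v. f k y v \<partial>N) = char N (real k * (y - x))"
      by (simp add: char_def f_def mult_ac)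
    then show ?thesis by (simp add: N_def char_std_normal_distribution)
  qed
  have bound: "measure D {x} \<le> (\<integral>v. exp (- c * \<bar>real k * v\<bar> powr \<alpha>) \<partial>N)" for k
  proof -
    have "measure D {x} = (\<integral>y. indicator {x} y \<partial>D)" by simp
    also have "\<dots> \<le> (\<integral>y. exp (- (real k * (y - x))\<^sup>2 / 2) \<partial>D)"
      by (intro integral_mono D.integrable_const_bound[where B=1]) (auto simp: indicator_def)
    also have "\<dots> = Re (\<integral>y. (\<integral>v. f k y v \<partial>N) \<partial>D)"
      unfolding gauss by simp
    also have "\<dots> = Re (\<integral>v. (\<integral>y. f k y v \<partial>D) \<partial>N)"
      using Fubini_integral[OF f_int] by simp
    also have "\<dots> \<le> cmod (\<integral>v. (\<integral>y. f k y v \<partial>D) \<partial>N)" by (rule complex_Re_le_cmod)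
    also have "\<dots> \<le> (\<integral>v. cmod (\<integral>y. f k y v \<partial>D) \<partial>N)" by (rule integral_norm_bound)
    also have "(\<lambda>v. cmod (\<integral>y. f k y v \<partial>D)) = (\<lambda>v. exp (- c * \<bar>real k * v\<bar> powr \<alpha>))"
    proof
      fix v
      have "(\<integral>y. f k y v \<partial>D) = char D (real k * v) * iexp (- (real k * v * x))"
        unfolding f_split char_def by simp
      then show "cmod (\<integral>y. f k y v \<partial>D) = exp (- c * \<bar>real k * v\<bar> powr \<alpha>)"
        by (simp add: char norm_mult)
    qed
    finally show ?thesis .
  qed
  have "(\<lambda>k. \<integral>v. exp (- c * \<bar>real k * v\<bar> powr \<alpha>) \<partial>N) \<longlonglongrightarrow> (\<integral>v. 0 \<partial>N)"
  proof (rule integral_dominated_convergence[where w="\<lambda>_. 1"])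
    have "AE v in N. v \<noteq> 0"
      unfolding N_def using AE_lborel_singleton[of "0::real"] by (subst AE_density) auto
    then show "AE v in N. (\<lambda>k. exp (- c * \<bar>real k * v\<bar> powr \<alpha>)) \<longlonglongrightarrow> 0"
    proof eventually_elim
      case (elim v)
      define e where "e = c * \<bar>v\<bar> powr \<alpha>"
      have "0 < e" using elim c by (simp add: e_def)
      then have "(\<lambda>k::nat. exp (- (e * real k powr \<alpha>))) \<longlonglongrightarrow> 0" using \<alpha> by real_asymp
      then show ?case by (simp add: e_def abs_mult powr_mult mult_ac)
    qed
    show "AE v in N. norm (exp (- c * \<bar>real k * v\<bar> powr \<alpha>)) \<le> 1" for k
      using c by simp
  qed auto
  then have "(\<lambda>k. \<integral>v. exp (- c * \<bar>real k * v\<bar> powr \<alpha>) \<partial>N) \<longlonglongrightarrow> 0" by simp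
  from LIMSEQ_le_const[OF this] bound have "measure D {x} \<le> 0" by blast
  then show ?thesis by (simp add: measure_le_0_iff)
qed

text \<open>The operation on Levy exponents that corresponds to the weight \<open>1 - sinc y\<close> on measures.\<close>

definition symmetrized_average :: "(real \<Rightarrow> real) \<Rightarrow> real \<Rightarrow> real" where
  "symmetrized_average \<psi> t =
     (\<integral>v. indicator {0..1} v * (\<psi> (t + v) / 2 + \<psi> (t - v) / 2 - \<psi> t) \<partial>lborel)"

text \<open>Let \<open>K\<close> be the law of \<open>Y / u\<close>. As \<open>u \<rightarrow> \<infinity>\<close>, the measures \<open>u powr \<alpha> \<cdot> K\<close> should converge to the jump measure away
from \<open>0\<close>, and the tail of \<open>Y\<close> at \<open>u\<close> is the \<open>K\<close>-mass of \<open>[1, \<infinity>)\<close>. Their exponents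
\<open>u powr \<alpha> * (1 - exp (- c \<bar>t / u\<bar> powr \<alpha>))\<close> do converge to \<open>c \<bar>t\<bar> powr \<alpha>\<close>, and are dominated by it. Hence the
normalized weighted laws \<open>sinc_distr K\<close> converge weakly to \<open>sinc_distr\<close> of the jump measure, and their
normalizing masses, times \<open>u powr \<alpha>\<close>, converge too. Undoing the weight on \<open>[1, \<infinity>)\<close> with the test
function \<open>1 / (1 - sinc y)\<close> gives the tail. In effect the factor \<open>1 - sinc\<close> gives a
Tauberian theorem by way of weak convergence.\<close>

theorem stable_tail:
  assumes D: "real_distribution D" and \<alpha>: "0 < \<alpha>" "\<alpha> < 2"
    and char: "\<And>u. char D u = complex_of_real (exp (- stable_const \<alpha> * \<bar>u\<bar> powr \<alpha>))"
  shows "((\<lambda>u. u powr \<alpha> * measure D {u..}) \<longlongrightarrow> 1/2) at_top"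
proof (rule tendsto_at_topI_sequentially)
  fix X :: "nat \<Rightarrow> real" assume X: "filterlim X at_top sequentially"
  interpret D: real_distribution D by fact
  define c where "c = stable_const \<alpha>"
  have c: "0 < c" using stable_const_pos[OF \<alpha>] by (simp add: c_def)
  note char = char[folded c_def]
  note no_atom = stable_no_atom[OF D c \<alpha>(1) char]
  \<comment> \<open>the sequence is made positive so that dividing by it makes sense\<close>
  define u where "u k = max 1 (X k)" for k
  have u_pos: "0 < u k" for k by (simp add: u_def)
  have u_ev: "eventually (\<lambda>k. u k = X k) sequentially"
    using filterlim_at_top[THEN iffD1, OF X, rule_format, of 1] by eventually_elim (simp add: u_def)
  have u: "filterlim u at_top sequentially"
    using X u_ev by (simp add: filterlim_cong[OF refl refl u_ev])
  define K where "K k = distr D borel (\<lambda>y. y / u k)" for k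
  interpret K: real_distribution "K k" for k unfolding K_def by (intro D.real_distribution_distr) auto
  define \<psi> where "\<psi> k t = 1 - exp (- c * \<bar>t / u k\<bar> powr \<alpha>)" for k t
  have charK: "char (K k) t = complex_of_real (exp (- c * \<bar>t / u k\<bar> powr \<alpha>))" for k t
  proof -
    have "char (K k) t = char D (t / u k)"
      unfolding K_def char_def by (subst integral_distr) auto
    then show ?thesis by (simp add: char)
  qed
  have cosK: "integrable (K k) (\<lambda>y. 1 - cos (t * y))" for k t
    by (rule K.integrable_const_bound[where B=2]) (auto simp: abs_le_iff)
  have psiK: "\<psi> k t = (\<integral>y. 1 - cos (t * y) \<partial>K k)" for k t
  proof -
    have i: "integrable (K k) (\<lambda>y. iexp (t * y))"
      by (rule K.integrable_const_bound[where B=1]) auto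
    have ci: "integrable (K k) (\<lambda>y. cos (t * y))"
      by (rule K.integrable_const_bound[where B=1]) auto
    have "(\<integral>y. cos (t * y) \<partial>K k) = Re (char (K k) t)"
      unfolding char_def integral_Re[OF i, symmetric]
      by (intro Bochner_Integration.integral_cong refl) (simp add: cis_conv_exp[symmetric] flip: of_real_mult)
    then show ?thesis using ci K.prob_space by (simp add: charK \<psi>_def)
  qed
  have contK: "continuous_on UNIV (\<psi> k)" for k
    unfolding \<psi>_def using \<alpha> less_imp_neq[OF u_pos[of k]]
    by (intro continuous_intros continuous_on_abs_powr) auto
  have symK: "distr (K k) borel uminus = K k" for k
  proof (rule Levy_uniqueness)
    show "real_distribution (distr (K k) borel uminus)" by (intro K.real_distribution_distr) auto
    show "real_distribution (K k)" ..
    have "char (distr (K k) borel uminus) t = char (K k) (- t)" for t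
      unfolding char_def by (subst integral_distr) auto
    then show "char (distr (K k) borel uminus) = char (K k)" by (auto simp: charK)
  qed
  have aeK: "AE y in K k. y \<noteq> 0" for k
  proof -
    have "AE y in D. y \<noteq> 0"
      using no_atom[of 0] by (subst AE_iff_measurable[of "{0}"]) (auto simp: D.emeasure_eq_measure)
    then show ?thesis unfolding K_def using u_pos[of k] by (subst AE_distr_iff) auto
  qed
  have nzK: "emeasure (K k) UNIV \<noteq> 0" for k using K.emeasure_space_1 by simp
  have sfK: "sigma_finite_measure (K k)" for k ..
  have setsK: "sets (K k) = sets borel" for k by simp
  note SK = sinc_distr[OF sfK setsK symK cosK psiK contK aeK nzK, folded symmetrized_average_def]
  define V where "V = stable_levy_measure \<alpha>"
  define \<psi>0 where "\<psi>0 t = c * \<bar>t\<bar> powr \<alpha>" for t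
  have cont0: "continuous_on UNIV \<psi>0"
    unfolding \<psi>0_def using \<alpha> by (intro continuous_intros continuous_on_abs_powr)
  have psi0: "\<psi>0 t = (\<integral>y. 1 - cos (t * y) \<partial>stable_levy_measure \<alpha>)" for t
    using \<alpha> by (simp add: integral_stable_levy_measure_cos \<psi>0_def c_def)
  note SV = sinc_distr[OF sigma_finite_stable_levy_measure[OF \<alpha>] sets_stable_levy_measure[OF \<alpha>]
      symmetric_stable_levy_measure[OF \<alpha>] integrable_stable_levy_measure_cos[OF \<alpha>] psi0 cont0
      AE_stable_levy_measure[OF \<alpha>] emeasure_stable_levy_measure_UNIV[OF \<alpha>],
      folded symmetrized_average_def V_def]
  have massK: "sinc_mass (K k) = symmetrized_average (\<psi> k) 0" for k
    using integral_cos_one_minus_sinc[OF sfK setsK cosK psiK contK, of k 0]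
    by (simp add: sinc_mass_def symmetrized_average_def)
  have massV: "sinc_mass V = symmetrized_average \<psi>0 0"
    using integral_cos_one_minus_sinc[OF sigma_finite_stable_levy_measure[OF \<alpha>] sets_stable_levy_measure[OF \<alpha>]
        integrable_stable_levy_measure_cos[OF \<alpha>] psi0 cont0, of 0]
    by (simp add: sinc_mass_def symmetrized_average_def V_def)
  have ptw: "(\<lambda>k. u k powr \<alpha> * \<psi> k t) \<longlonglongrightarrow> \<psi>0 t" for t
  proof -
    have "((\<lambda>w. w powr \<alpha> * (1 - exp (- c * (\<bar>t\<bar> / w) powr \<alpha>))) \<longlongrightarrow> c * \<bar>t\<bar> powr \<alpha>) at_top"
    proof (cases "t = 0")
      case False
      then have "\<bar>t\<bar> > 0" by simp
      then show ?thesis using c \<alpha> by real_asymp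
    qed simp
    from filterlim_compose[OF this u] show ?thesis
      using u_pos by (simp add: \<psi>_def \<psi>0_def abs_divide abs_of_pos)
  qed
  have bnd: "0 \<le> u k powr \<alpha> * \<psi> k t" "u k powr \<alpha> * \<psi> k t \<le> \<psi>0 t" for k t
  proof -
    show "0 \<le> u k powr \<alpha> * \<psi> k t" using c by (simp add: \<psi>_def)
    have "\<psi> k t \<le> c * \<bar>t / u k\<bar> powr \<alpha>"
      using exp_ge_add_one_self[of "- c * \<bar>t / u k\<bar> powr \<alpha>"] by (simp add: \<psi>_def)
    then have "u k powr \<alpha> * \<psi> k t \<le> u k powr \<alpha> * (c * \<bar>t / u k\<bar> powr \<alpha>)"
      by (intro mult_left_mono) auto
    also have "\<dots> = \<psi>0 t"
      using u_pos[of k] by (simp add: \<psi>0_def abs_divide powr_divide)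
    finally show "u k powr \<alpha> * \<psi> k t \<le> \<psi>0 t" .
  qed
  have avg: "(\<lambda>k. u k powr \<alpha> * symmetrized_average (\<psi> k) t) \<longlonglongrightarrow> symmetrized_average \<psi>0 t" for t
  proof -
    define w where "w v = indicator {0..1} v * (\<psi>0 (t + v) + \<psi>0 (t - v) + \<psi>0 t)" for v :: real
    have int_w: "integrable lborel w"
    proof -
      have "continuous_on {0..1} (\<lambda>v. \<psi>0 (t + v) + \<psi>0 (t - v) + \<psi>0 t)"
        using \<alpha> unfolding \<psi>0_def by (intro continuous_intros continuous_on_abs_powr)
      from borel_integrable_atLeastAtMost'[OF this] show ?thesis
        by (simp add: w_def[abs_def] set_integrable_def)
    qed
    have [measurable]: "\<psi> k \<in> borel_measurable borel" for k
      by (rule borel_measurable_continuous_onI[OF contK])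
    have [measurable]: "\<psi>0 \<in> borel_measurable borel"
      by (rule borel_measurable_continuous_onI[OF cont0])
    have "(\<lambda>k. \<integral>v. u k powr \<alpha> * (indicator {0..1} v * (\<psi> k (t + v) / 2 + \<psi> k (t - v) / 2 - \<psi> k t)) \<partial>lborel)
       \<longlonglongrightarrow> symmetrized_average \<psi>0 t"
      unfolding symmetrized_average_def
    proof (rule integral_dominated_convergence[OF _ _ int_w])
      have "(\<lambda>k. indicator {0..1} v * ((u k powr \<alpha> * \<psi> k (t + v)) / 2 + (u k powr \<alpha> * \<psi> k (t - v)) / 2 - u k powr \<alpha> * \<psi> k t))
        \<longlonglongrightarrow> indicator {0..1} v * (\<psi>0 (t + v) / 2 + \<psi>0 (t - v) / 2 - \<psi>0 t)" for v :: real
        by (intro tendsto_intros ptw) auto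
      then show "AE v in lborel. (\<lambda>k. u k powr \<alpha> * (indicator {0..1} v * (\<psi> k (t + v) / 2 + \<psi> k (t - v) / 2 - \<psi> k t)))
        \<longlonglongrightarrow> indicator {0..1} v * (\<psi>0 (t + v) / 2 + \<psi>0 (t - v) / 2 - \<psi>0 t)"
        by (simp add: algebra_simps)
      show "AE v in lborel. norm (u k powr \<alpha> * (indicator {0..1} v * (\<psi> k (t + v) / 2 + \<psi> k (t - v) / 2 - \<psi> k t))) \<le> w v" for k
      proof (rule AE_I2)
        fix v :: real
        have "\<bar>u k powr \<alpha> * \<psi> k (t + v) / 2 + u k powr \<alpha> * \<psi> k (t - v) / 2 - u k powr \<alpha> * \<psi> k t\<bar>
            \<le> \<psi>0 (t + v) + \<psi>0 (t - v) + \<psi>0 t"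
          using bnd[of k "t + v"] bnd[of k "t - v"] bnd[of k t] by linarith
        then show "norm (u k powr \<alpha> * (indicator {0..1} v * (\<psi> k (t + v) / 2 + \<psi> k (t - v) / 2 - \<psi> k t))) \<le> w v"
          by (auto simp: w_def indicator_def algebra_simps)
      qed
    qed measurable
    then show ?thesis by (simp add: symmetrized_average_def)
  qed
  have mass: "(\<lambda>k. u k powr \<alpha> * sinc_mass (K k)) \<longlonglongrightarrow> sinc_mass V"
    using avg[of 0] by (simp add: massK massV)
  \<comment> \<open>the powers of \<open>u k\<close> cancel in the quotient that defines the characteristic function\<close>
  have weak: "weak_conv_m (\<lambda>k. sinc_distr (K k)) (sinc_distr V)"
  proof (rule levy_continuity)
    show "(\<lambda>k. char (sinc_distr (K k)) t) \<longlonglongrightarrow> char (sinc_distr V) t" for t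
    proof -
      have "(\<lambda>k. complex_of_real ((u k powr \<alpha> * symmetrized_average (\<psi> k) t) / (u k powr \<alpha> * sinc_mass (K k))))
         \<longlonglongrightarrow> complex_of_real (symmetrized_average \<psi>0 t / sinc_mass V)"
        using SV(1) by (intro tendsto_intros avg mass) auto
      moreover have "u k powr \<alpha> \<noteq> 0" for k using u_pos[of k] by simp
      ultimately show ?thesis by (simp add: SK(3) SV(3))
    qed
  qed (use SK(2) SV(2) in auto)
  obtain d where d: "0 < d" "\<And>y. 1 \<le> y \<Longrightarrow> d \<le> 1 - sinc y" by (rule sinc_bounded_away) blast
  define f where "f y = (if 1 \<le> y then 1 / (1 - sinc y) else 0)" for y :: real
  have f_meas [measurable]: "f \<in> borel_measurable borel" unfolding f_def by measurable
  have f_cont: "isCont f y" if "y \<noteq> 1" for y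
  proof (cases "y < 1")
    case True
    have "eventually (\<lambda>y. f y = 0) (nhds y)"
      using eventually_nhds_in_open[OF open_lessThan[of 1], of y] True
      by (auto elim!: eventually_mono simp: f_def)
    then show ?thesis by (simp add: isCont_cong)
  next
    case False
    have "eventually (\<lambda>y. f y = 1 / (1 - sinc y)) (nhds y)"
      using eventually_nhds_in_open[OF open_greaterThan[of 1], of y] False that
      by (auto elim!: eventually_mono simp: f_def)
    moreover have "isCont (\<lambda>y. 1 / (1 - sinc y)) y"
      using sinc_less_1[of y] False by (intro continuous_intros isCont_sinc) auto
    ultimately show ?thesis by (simp add: isCont_cong)
  qed
  have "(\<lambda>k. \<integral>y. f y \<partial>sinc_distr (K k)) \<longlonglongrightarrow> (\<integral>y. f y \<partial>sinc_distr V)"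
  proof (rule weak_conv_imp_bdd_ae_continuous_conv[OF _ _ weak])
    show "norm (f y) \<le> 1 / d" for y
    proof (cases "1 \<le> y")
      case True
      then have "1 / (1 - sinc y) \<le> 1 / d"
        using d(2)[of y] d(1) by (intro frac_le) auto
      moreover have "norm (1 / (1 - sinc y)) = 1 / (1 - sinc y)"
        using sinc_le_1[of y] by (simp del: if_split)
      ultimately show ?thesis using True unfolding f_def by (simp only: if_True)
    qed (use d(1) in \<open>simp add: f_def\<close>)
    have "AE y in sinc_distr V. y \<noteq> 1"
      unfolding sinc_distr_def V_def using AE_stable_levy_measure[OF \<alpha>, of 1]
      by (subst AE_density) (auto simp: measurable_cong_sets[OF sets_stable_levy_measure[OF \<alpha>] refl])
    then have "emeasure (sinc_distr V) {1} = 0"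
      using real_distribution.events_eq_borel[OF SV(2)]
      by (subst (asm) AE_iff_measurable[OF _ refl]) (auto simp: sets_eq_imp_space_eq)
    moreover have "emeasure (sinc_distr V) {y. \<not> isCont f y} \<le> emeasure (sinc_distr V) {1}"
      using f_cont real_distribution.events_eq_borel[OF SV(2)] by (intro emeasure_mono) auto
    ultimately show "emeasure (sinc_distr V) {y. \<not> isCont f y} = 0" by simp
  qed (use SK(2) SV(2) in auto)
  moreover have int_f: "(\<integral>y. (1 - sinc y) * f y \<partial>m) = measure m {1..}" if "sets m = sets borel" for m
  proof -
    have "(1 - sinc y) * f y = indicator {1..} y" for y
      using sinc_less_1[of y] by (auto simp: f_def)
    then show ?thesis using that sets_eq_imp_space_eq[OF that] by simp
  qed
  ultimately have "(\<lambda>k. measure (K k) {1..} / sinc_mass (K k)) \<longlonglongrightarrow> (1/2) / sinc_mass V"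
    using sets_stable_levy_measure[OF \<alpha>, folded V_def] measure_stable_levy_measure[OF \<alpha>, folded V_def]
    by (simp add: SK(4) SV(4) int_f)
  from tendsto_mult[OF this mass]
  have "(\<lambda>k. u k powr \<alpha> * measure (K k) {1..}) \<longlonglongrightarrow> 1/2"
    using SV(1) less_imp_neq[OF SK(1)] by (simp add: field_simps)
  moreover have "measure (K k) {1..} = measure D {u k..}" for k
  proof -
    have "(\<lambda>y. y / u k) -` {1..} = {u k..}" using u_pos[of k] by (auto simp: field_simps)
    then show ?thesis unfolding K_def by (subst measure_distr) auto
  qed
  ultimately have "(\<lambda>k. u k powr \<alpha> * measure D {u k..}) \<longlonglongrightarrow> 1/2" by simp
  then show "(\<lambda>k. X k powr \<alpha> * measure D {X k..}) \<longlonglongrightarrow> 1/2"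
    by (rule Lim_transform_eventually) (use u_ev in eventually_elim, simp)
qed

section \<open>Continuity of roots and splitting of spectra\<close>

lemma prod_mset_ge_power:
  fixes g :: "'a \<Rightarrow> real"
  assumes "\<And>a. a \<in># A \<Longrightarrow> r \<le> g a" "0 \<le> r"
  shows "r ^ size A \<le> (\<Prod>a\<in>#A. g a)"
  using assms
proof (induction A)
  case (add x A)
  then have "r * r ^ size A \<le> g x * (\<Prod>a\<in>#A. g a)"
    by (intro mult_mono) (auto intro: order_trans[OF \<open>0 \<le> r\<close>])
  then show ?case by simp
qed simp

lemma norm_prod_mset: "norm (\<Prod>a\<in>#A. f a) = (\<Prod>a\<in>#A. norm (f a :: complex))"
  by (induction A) (auto simp: norm_mult)

text \<open>A value \<open>\<Prod>a. (z - a)\<close> that is small, for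
\<open>z\<close> close to a limit root \<open>l i\<close>, forces one factor to be small, so the root of \<open>A e\<close> nearest to \<open>l i\<close>
converges to \<open>l i\<close>. It is split off and the remaining roots are treated by induction. Dividing by
its linear factor loses pointwise convergence at \<open>l i\<close>; the finite exceptional set \<open>Z\<close> absorbs
this.\<close>

lemma roots_tendsto:
  fixes A :: "'e \<Rightarrow> complex multiset" and l :: "'i \<Rightarrow> complex"
  assumes "finite I" and "finite Z" and "\<And>e. size (A e) = card I"
    and "\<And>z. z \<notin> Z \<Longrightarrow> ((\<lambda>e. \<Prod>a\<in>#A e. z - a) \<longlongrightarrow> (\<Prod>i\<in>I. z - l i)) F"
  shows "\<exists>f. (\<forall>e. image_mset (f e) (mset_set I) = A e) \<and> (\<forall>i\<in>I. ((\<lambda>e. f e i) \<longlongrightarrow> l i) F)"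
  using assms
proof (induction I arbitrary: A Z rule: finite_induct)
  case empty
  then show ?case by (intro exI[of _ "\<lambda>_ _. 0"]) auto
next
  case (insert i I A Z)
  define n where "n = card (insert i I)"
  have A_ne: "\<exists>a. a \<in># A e \<and> (\<forall>b. b \<in># A e \<longrightarrow> norm (l i - a) \<le> norm (l i - b))" for e
  proof -
    have "A e \<noteq> {#}" using insert.prems(2)[of e] insert.hyps by auto
    then have "arg_min_on (\<lambda>a. norm (l i - a)) (set_mset (A e)) \<in> set_mset (A e)"
      by (intro arg_min_if_finite(1)) auto
    moreover have "norm (l i - arg_min_on (\<lambda>a. norm (l i - a)) (set_mset (A e))) \<le> norm (l i - b)" if "b \<in># A e" for b
      using that \<open>A e \<noteq> {#}\<close> by (intro arg_min_least) auto
    ultimately show ?thesis by blast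
  qed
  then obtain near where near: "\<And>e. near e \<in># A e"
      "\<And>e b. b \<in># A e \<Longrightarrow> norm (l i - near e) \<le> norm (l i - b)" by metis
  have near_lim: "(near \<longlongrightarrow> l i) F"
  proof (rule tendstoI)
    fix \<delta> :: real assume "0 < \<delta>"
    define q where "q z = (\<Prod>j\<in>insert i I. z - l j)" for z
    have "isCont q (l i)" unfolding q_def by (intro continuous_intros)
    moreover have "q (l i) = 0" unfolding q_def using insert.hyps by simp
    ultimately have "(q \<longlongrightarrow> 0) (at (l i))" by (simp add: isCont_def)
    then have "eventually (\<lambda>z. norm (q z) < (\<delta>/2) ^ n) (at (l i))"
      using \<open>0 < \<delta>\<close> by (auto dest!: tendstoD[where e="(\<delta>/2)^n"] simp: dist_norm)
    moreover have "eventually (\<lambda>z. dist z (l i) < \<delta>/2) (at (l i))"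
      unfolding eventually_at using \<open>0 < \<delta>\<close> by (intro exI[of _ "\<delta>/2"]) auto
    moreover have "eventually (\<lambda>z. z \<notin> Z) (at (l i))"
    proof -
      have "open (- (Z - {l i}))" using insert.prems(1) by (intro open_Compl finite_imp_closed) auto
      from eventually_at_in_open'[OF this, of "l i"] have "eventually (\<lambda>z. z \<in> - (Z - {l i})) (at (l i))" by simp
      moreover have "eventually (\<lambda>z. z \<noteq> l i) (at (l i))" by (simp add: eventually_at_filter)
      ultimately show ?thesis by eventually_elim auto
    qed
    ultimately have "eventually (\<lambda>z. norm (q z) < (\<delta>/2)^n \<and> dist z (l i) < \<delta>/2 \<and> z \<notin> Z) (at (l i))"
      by eventually_elim auto
    then obtain z where z: "norm (q z) < (\<delta>/2)^n" "dist z (l i) < \<delta>/2" "z \<notin> Z"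
      using eventually_happens'[of "at (l i)"] by auto
    \<comment> \<open>\<open>l i\<close> itself may be exceptional; the nearby point \<open>z\<close> is not\<close>
    have "((\<lambda>e. norm (\<Prod>a\<in>#A e. z - a)) \<longlongrightarrow> norm (q z)) F"
      unfolding q_def by (intro tendsto_norm insert.prems(3) z)
    from order_tendstoD(2)[OF this z(1)]
    show "eventually (\<lambda>e. dist (near e) (l i) < \<delta>) F"
    proof eventually_elim
      case (elim e)
      have "\<exists>a. a \<in># A e \<and> norm (z - a) < \<delta>/2"
      proof (rule ccontr)
        assume "\<not> ?thesis"
        then have "(\<delta>/2) ^ size (A e) \<le> (\<Prod>a\<in>#A e. norm (z - a))"
          using \<open>0 < \<delta>\<close> by (intro prod_mset_ge_power) (auto simp: not_less)
        then show False
          using elim insert.prems(2)[of e] by (simp add: norm_prod_mset n_def)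
      qed
      then obtain a where a: "a \<in># A e" "norm (z - a) < \<delta>/2" by blast
      have "norm (l i - near e) \<le> norm (l i - a)" using near(2) a by blast
      also have "\<dots> \<le> norm (l i - z) + norm (z - a)" using norm_triangle_ineq[of "l i - z" "z - a"] by simp
      also have "\<dots> < \<delta>" using a z by (simp add: dist_norm norm_minus_commute)
      finally show ?case by (simp add: dist_norm norm_minus_commute)
    qed
  qed
  define A' where "A' e = A e - {#near e#}" for e
  have A': "A e = add_mset (near e) (A' e)" for e using near(1) by (simp add: A'_def)
  have "\<exists>f. (\<forall>e. image_mset (f e) (mset_set I) = A' e) \<and> (\<forall>i\<in>I. ((\<lambda>e. f e i) \<longlongrightarrow> l i) F)"
  proof (rule insert.IH)
    show "finite (insert (l i) Z)" using insert.prems by simp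
    show "size (A' e) = card I" for e
      using insert.prems(2)[of e] insert.hyps by (simp add: A')
    fix z assume z: "z \<notin> insert (l i) Z"
    have "((\<lambda>e. (\<Prod>a\<in>#A e. z - a) / (z - near e)) \<longlongrightarrow> (\<Prod>j\<in>insert i I. z - l j) / (z - l i)) F"
      using z by (intro tendsto_intros near_lim insert.prems(3)) auto
    moreover have "eventually (\<lambda>e. (\<Prod>a\<in>#A e. z - a) / (z - near e) = (\<Prod>a\<in>#A' e. z - a)) F"
    proof -
      have "eventually (\<lambda>e. near e \<noteq> z) F" using near_lim z by (intro tendsto_imp_eventually_ne) auto
      then show ?thesis by eventually_elim (simp add: A')
    qed
    ultimately show "((\<lambda>e. \<Prod>a\<in>#A' e. z - a) \<longlongrightarrow> (\<Prod>j\<in>I. z - l j)) F"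
      using z insert.hyps by (auto intro: Lim_transform_eventually)
  qed
  then obtain f where f: "\<And>e. image_mset (f e) (mset_set I) = A' e"
      "\<And>j. j \<in> I \<Longrightarrow> ((\<lambda>e. f e j) \<longlongrightarrow> l j) F" by blast
  show ?case
  proof (intro exI[of _ "\<lambda>e. (f e)(i := near e)"] conjI allI ballI)
    fix e
    have "image_mset ((f e)(i := near e)) (mset_set I) = image_mset (f e) (mset_set I)"
      using insert.hyps by (intro image_mset_cong) auto
    then show "image_mset ((f e)(i := near e)) (mset_set (insert i I)) = A e"
      using insert.hyps f(1)[of e] by (simp add: A')
  next
    fix j assume "j \<in> insert i I"
    then show "((\<lambda>e. ((f e)(i := near e)) j) \<longlongrightarrow> l j) F"
      using near_lim f(2)[of j] by (cases "j = i") auto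
  qed
qed

lemma prod_mset_scale:
  "(\<Prod>a\<in>#A. c * f a) = (c::complex) ^ size A * (\<Prod>a\<in>#A. f a)"
  by (induction A) (auto simp: mult_ac)

lemma prod_mset_mset_set: "(\<Prod>a\<in>#image_mset f (mset_set I). g a) = (\<Prod>i\<in>I. g (f i))"
  by (simp add: prod_unfold_prod_mset image_mset.compositionality comp_def)

text \<open>The spectrum \<open>A e\<close> lives on two scales. On the fine scale the numbers \<open>1 + \<eta> a\<close> (the eigenvalues
of the transition matrix) approach \<open>1\<close>, \<open>n\<close> times, or \<open>0\<close>, \<open>N - n\<close> times, which is what the first limit says; the
latter group consists of \<open>a\<close> of size at least \<open>1 / (2 \<eta>)\<close>. The factors of this group, multiplied
by \<open>\<eta>\<close>, converge to \<open>1\<close>, so that the second limit is inherited by the product over the other group alone,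
whose roots therefore converge to the \<open>l i\<close>. The eigenvalue \<open>0\<close> is removed beforehand, because it has to be kept
exactly and not just in the limit.\<close>

lemma spectrum_splits:
  fixes A :: "real \<Rightarrow> complex multiset" and \<eta> :: "real \<Rightarrow> real" and l :: "nat \<Rightarrow> complex"
  assumes n: "1 \<le> n" "n \<le> N"
    and size: "\<And>e. 0 < e \<Longrightarrow> size (A e) = N"
    and \<eta>_pos: "\<And>e. 0 < e \<Longrightarrow> 0 < \<eta> e" and \<eta>: "(\<eta> \<longlongrightarrow> 0) (at_right 0)"
    and micro: "\<And>z. ((\<lambda>e. of_real (\<eta> e) ^ N * (\<Prod>a\<in>#A e. (z - 1) / of_real (\<eta> e) - a))
          \<longlongrightarrow> (z - 1) ^ n * z ^ (N - n)) (at_right 0)"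
    and macro: "\<And>z. ((\<lambda>e. of_real (\<eta> e) ^ (N - n) * (\<Prod>a\<in>#A e. z - a))
          \<longlongrightarrow> (\<Prod>i\<in>{1..n}. z - l i)) (at_right 0)"
    and l1: "l 1 = 0" and zero: "\<And>e. 0 < e \<Longrightarrow> 0 \<in># A e"
  shows "\<exists>lam \<epsilon>1. \<epsilon>1 > 0 \<and>
      (\<forall>e\<in>{0<..\<epsilon>1}. image_mset (lam e) (mset_set {1..N}) = A e \<and>
         lam e ` {1..n} \<inter> lam e ` {n+1..N} = {} \<and> lam e 1 = 0 \<and>
         (\<forall>i\<in>{n+1..N}. 1 / (2 * \<eta> e) \<le> cmod (lam e i))) \<and>
      (\<forall>i\<in>{2..n}. ((\<lambda>e. lam e i) \<longlongrightarrow> l i) (at_right 0))"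
proof -
  have pos: "eventually (\<lambda>e. 0 < e) (at_right (0::real))" by (simp add: eventually_at_right_less)
  define A' where "A' e = (if 0 < e then A e - {#0#} else replicate_mset (N - 1) 0)" for e :: real
  have A': "A e = add_mset 0 (A' e)" if "0 < e" for e using zero[OF that] that by (simp add: A'_def)
  have size': "size (A' e) = N - 1" for e
  proof (cases "0 < e")
    case True
    then show ?thesis using size[OF True] A'[OF True] by simp
  qed (simp add: A'_def)
  have split1: "{1..N} = insert 1 {2..N}" "{1..n} = insert 1 {2..n}" using n by auto
  have split2: "{2..N} = {2..n} \<union> {n+1..N}" "{2..n} \<inter> {n+1..N} = {}" using n by auto
  \<comment> \<open>On the fine scale the removed eigenvalue is \<open>1\<close>, hence the exceptional point.\<close>
  define B where "B e = image_mset (\<lambda>a. 1 + of_real (\<eta> e) * a) (A' e)" for e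
  define k where "k i = (if i \<le> n then 1 else 0 :: complex)" for i
  have "\<exists>\<mu>. (\<forall>e. image_mset (\<mu> e) (mset_set {2..N}) = B e) \<and>
      (\<forall>i\<in>{2..N}. ((\<lambda>e. \<mu> e i) \<longlongrightarrow> k i) (at_right 0))"
  proof (rule roots_tendsto[where Z="{1}"])
    show "size (B e) = card {2..N}" for e using n size'[of e] by (simp add: B_def)
    fix z :: complex assume z: "z \<notin> {1}"
    have "((\<lambda>e. (of_real (\<eta> e) ^ N * (\<Prod>a\<in>#A e. (z - 1) / of_real (\<eta> e) - a)) / (z - 1))
        \<longlongrightarrow> ((z - 1) ^ n * z ^ (N - n)) / (z - 1)) (at_right 0)"
      using z by (intro tendsto_intros micro) auto
    moreover have "eventually (\<lambda>e. (of_real (\<eta> e) ^ N * (\<Prod>a\<in>#A e. (z - 1) / of_real (\<eta> e) - a)) / (z - 1)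
        = (\<Prod>b\<in>#B e. z - b)) (at_right 0)"
      using pos
    proof eventually_elim
      case (elim e)
      have \<eta>0: "complex_of_real (\<eta> e) \<noteq> 0" using \<eta>_pos[OF elim] by simp
      have eq: "of_real (\<eta> e) * ((z - 1) / of_real (\<eta> e) - a) = z - (1 + of_real (\<eta> e) * a)" for a
        using \<eta>0 by (simp add: field_simps)
      have "(\<Prod>b\<in>#B e. z - b) = (\<Prod>a\<in>#A' e. of_real (\<eta> e) * ((z - 1) / of_real (\<eta> e) - a))"
        unfolding eq by (simp add: B_def image_mset.compositionality comp_def)
      also have "\<dots> = of_real (\<eta> e) ^ (N - 1) * (\<Prod>a\<in>#A' e. (z - 1) / of_real (\<eta> e) - a)"
        by (simp add: prod_mset_scale size')
      finally show ?case
        using n z \<eta>0 A'[OF elim] by (cases N) auto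
    qed
    moreover have "((z - 1) ^ n * z ^ (N - n)) / (z - 1) = (\<Prod>i\<in>{2..N}. z - k i)"
    proof -
      have "(\<Prod>i\<in>{2..N}. z - k i) = (\<Prod>i\<in>{2..n}. z - k i) * (\<Prod>i\<in>{n+1..N}. z - k i)"
        unfolding split2(1) using split2(2) by (intro prod.union_disjoint) auto
      also have "(\<Prod>i\<in>{2..n}. z - k i) = (z - 1) ^ (n - 1)"
        by (simp add: k_def)
      also have "(\<Prod>i\<in>{n+1..N}. z - k i) = z ^ (N - n)"
        by (simp add: k_def)
      finally show ?thesis using z n by (cases n) auto
    qed
    ultimately show "((\<lambda>e. \<Prod>b\<in>#B e. z - b) \<longlongrightarrow> (\<Prod>i\<in>{2..N}. z - k i)) (at_right 0)"
      by (auto intro: Lim_transform_eventually)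
  qed auto
  then obtain \<mu> where \<mu>: "\<And>e. image_mset (\<mu> e) (mset_set {2..N}) = B e"
      "\<And>i. i \<in> {2..N} \<Longrightarrow> ((\<lambda>e. \<mu> e i) \<longlongrightarrow> k i) (at_right 0)" by blast
  define \<nu> where "\<nu> e i = (\<mu> e i - 1) / of_real (\<eta> e)" for e i
  have \<nu>: "image_mset (\<nu> e) (mset_set {2..N}) = A' e" if "0 < e" for e
  proof -
    have "image_mset (\<nu> e) (mset_set {2..N}) = image_mset (\<lambda>b. (b - 1) / of_real (\<eta> e)) (B e)"
      unfolding \<mu>(1)[symmetric] \<nu>_def by (simp add: image_mset.compositionality comp_def)
    then show ?thesis
      using \<eta>_pos[OF that] by (simp add: B_def image_mset.compositionality comp_def)
  qed
  define G where "G e = image_mset (\<nu> e) (mset_set {2..n})" for e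
  have "\<exists>g. (\<forall>e. image_mset (g e) (mset_set {2..n}) = G e) \<and>
      (\<forall>i\<in>{2..n}. ((\<lambda>e. g e i) \<longlongrightarrow> l i) (at_right 0))"
  proof (rule roots_tendsto[where Z="{0}"])
    show "size (G e) = card {2..n}" for e by (simp add: G_def)
    fix z :: complex assume z: "z \<notin> {0}"
    \<comment> \<open>the contribution of the large eigenvalues to the second limit\<close>
    define H where "H e = (\<Prod>i\<in>{n+1..N}. of_real (\<eta> e) * z + 1 - \<mu> e i)" for e
    have H: "(H \<longlongrightarrow> (\<Prod>i\<in>{n+1..N}. of_real 0 * z + 1 - k i)) (at_right 0)"
      unfolding H_def using n by (intro tendsto_intros \<eta> \<mu>(2)) auto
    have H1: "(H \<longlongrightarrow> 1) (at_right 0)" using H by (simp add: k_def)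
    have "((\<lambda>e. (of_real (\<eta> e) ^ (N - n) * (\<Prod>a\<in>#A e. z - a)) / z / H e)
        \<longlongrightarrow> (\<Prod>i\<in>{1..n}. z - l i) / z / 1) (at_right 0)"
      using z by (intro tendsto_divide H1 macro tendsto_const) auto
    moreover have "eventually (\<lambda>e. (of_real (\<eta> e) ^ (N - n) * (\<Prod>a\<in>#A e. z - a)) / z / H e
        = (\<Prod>a\<in>#G e. z - a)) (at_right 0)"
      using pos tendsto_imp_eventually_ne[OF H1, of 0, simplified]
    proof eventually_elim
      case (elim e)
      have \<eta>0: "complex_of_real (\<eta> e) \<noteq> 0" using \<eta>_pos[OF elim(1)] by simp
      have "(\<Prod>a\<in>#A e. z - a) = z * (\<Prod>i\<in>{2..N}. z - \<nu> e i)"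
        unfolding A'[OF elim(1)] \<nu>[OF elim(1), symmetric] prod_mset_mset_set[symmetric] by simp
      also have "(\<Prod>i\<in>{2..N}. z - \<nu> e i) = (\<Prod>i\<in>{2..n}. z - \<nu> e i) * (\<Prod>i\<in>{n+1..N}. z - \<nu> e i)"
        unfolding split2(1) using split2(2) by (intro prod.union_disjoint) auto
      also have "(\<Prod>i\<in>{2..n}. z - \<nu> e i) = (\<Prod>a\<in>#G e. z - a)"
        unfolding G_def by (rule prod_mset_mset_set[symmetric])
      finally have 1: "(\<Prod>a\<in>#A e. z - a) = z * ((\<Prod>a\<in>#G e. z - a) * (\<Prod>i\<in>{n+1..N}. z - \<nu> e i))" .
      have "H e = (\<Prod>i\<in>{n+1..N}. of_real (\<eta> e) * (z - \<nu> e i))"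
        unfolding H_def \<nu>_def using \<eta>0 by (intro prod.cong) (auto simp: field_simps)
      also have "\<dots> = of_real (\<eta> e) ^ (N - n) * (\<Prod>i\<in>{n+1..N}. z - \<nu> e i)"
        by (simp add: prod.distrib)
      finally show ?case using 1 elim(2) z by (simp add: field_simps)
    qed
    moreover have "(\<Prod>i\<in>{1..n}. z - l i) / z / 1 = (\<Prod>i\<in>{2..n}. z - l i)"
      using z l1 unfolding split1(2) by simp
    ultimately show "((\<lambda>e. \<Prod>a\<in>#G e. z - a) \<longlongrightarrow> (\<Prod>i\<in>{2..n}. z - l i)) (at_right 0)"
      by (auto intro: Lim_transform_eventually)
  qed auto
  then obtain g where g: "\<And>e. image_mset (g e) (mset_set {2..n}) = G e"
      "\<And>i. i \<in> {2..n} \<Longrightarrow> ((\<lambda>e. g e i) \<longlongrightarrow> l i) (at_right 0)" by blast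
  define lam where "lam e i = (if i = 1 then 0 else if i \<le> n then g e i else \<nu> e i)" for e i
  have enum: "image_mset (lam e) (mset_set {1..N}) = A e" if "0 < e" for e
  proof -
    have "image_mset (lam e) (mset_set {2..N}) = image_mset (lam e) (mset_set {2..n}) + image_mset (lam e) (mset_set {n+1..N})"
      unfolding split2(1) using split2(2) by (subst mset_set_Union) auto
    also have "image_mset (lam e) (mset_set {2..n}) = image_mset (g e) (mset_set {2..n})"
      by (intro image_mset_cong) (auto simp: lam_def)
    also have "\<dots> = image_mset (\<nu> e) (mset_set {2..n})" by (simp add: g G_def)
    also have "image_mset (lam e) (mset_set {n+1..N}) = image_mset (\<nu> e) (mset_set {n+1..N})"
      using n by (intro image_mset_cong) (auto simp: lam_def)
    also have "image_mset (\<nu> e) (mset_set {2..n}) + \<dots> = image_mset (\<nu> e) (mset_set {2..N})"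
      unfolding split2(1) using split2(2) by (subst mset_set_Union) auto
    finally have "image_mset (lam e) (mset_set {2..N}) = A' e" using \<nu>[OF that] by simp
    then show ?thesis using A'[OF that] unfolding split1(1) by (simp add: lam_def)
  qed
  have low: "eventually (\<lambda>e. \<eta> e * cmod (lam e i) < 1/2) (at_right 0)" if "i \<in> {1..n}" for i
  proof (cases "i = 1")
    case False
    then have "((\<lambda>e. \<eta> e * cmod (g e i)) \<longlongrightarrow> 0 * cmod (l i)) (at_right 0)"
      using that by (intro tendsto_intros \<eta> g) auto
    then have "eventually (\<lambda>e. \<eta> e * cmod (g e i) < 1/2) (at_right 0)"
      by (intro order_tendstoD(2)) auto
    then show ?thesis using False that by (simp add: lam_def)
  qed (simp add: lam_def)
  have high: "eventually (\<lambda>e. 1/2 \<le> \<eta> e * cmod (lam e i)) (at_right 0)" if i: "i \<in> {n+1..N}" for i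
  proof -
    have "((\<lambda>e. cmod (\<mu> e i - 1)) \<longlongrightarrow> cmod (k i - 1)) (at_right 0)"
      using i n by (intro tendsto_intros \<mu>) auto
    then have "eventually (\<lambda>e. 1/2 < cmod (\<mu> e i - 1)) (at_right 0)"
      using i by (intro order_tendstoD(1)[where a="1/2"]) (auto simp: k_def)
    then show ?thesis using pos
    proof eventually_elim
      case (elim e)
      then show ?case using i n \<eta>_pos[of e] by (simp add: lam_def \<nu>_def norm_divide)
    qed
  qed
  have "eventually (\<lambda>e. (\<forall>i\<in>{1..n}. \<eta> e * cmod (lam e i) < 1/2) \<and> (\<forall>i\<in>{n+1..N}. 1/2 \<le> \<eta> e * cmod (lam e i))) (at_right 0)"
    using low high by (intro eventually_conj eventually_ball_finite) auto
  then obtain b where b: "0 < b" "\<And>e. 0 < e \<Longrightarrow> e < b \<Longrightarrow>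
      (\<forall>i\<in>{1..n}. \<eta> e * cmod (lam e i) < 1/2) \<and> (\<forall>i\<in>{n+1..N}. 1/2 \<le> \<eta> e * cmod (lam e i))"
    unfolding eventually_at_right_field by auto
  show ?thesis
  proof (rule exI[of _ lam], rule exI[of _ "b/2"], intro conjI ballI)
    fix e assume e: "e \<in> {0<..b/2}"
    then have e': "0 < e" "e < b" using b(1) by auto
    note b = b(2)[OF e']
    show "image_mset (lam e) (mset_set {1..N}) = A e" by (rule enum[OF e'(1)])
    show "lam e 1 = 0" by (simp add: lam_def)
    show "1 / (2 * \<eta> e) \<le> cmod (lam e i)" if "i \<in> {n+1..N}" for i
      using b that \<eta>_pos[OF e'(1)] by (auto simp: field_simps)
    show "lam e ` {1..n} \<inter> lam e ` {n+1..N} = {}"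
    proof (rule ccontr)
      assume "\<not> ?thesis"
      then obtain i j where "i \<in> {1..n}" "j \<in> {n+1..N}" "lam e i = lam e j" by force
      then show False using b by (metis not_le)
    qed
  next
    show "0 < b/2" using b by simp
    fix i assume i: "i \<in> {2..n}"
    then show "((\<lambda>e. lam e i) \<longlongrightarrow> l i) (at_right 0)" using g(2)[OF i] by (simp add: lam_def)
  qed
qed

section \<open>Determinants and characteristic polynomials\<close>

text \<open>Determinants with entries given by a function: all manipulations below are entrywise, and
dimensions then need no side conditions.\<close>

definition det_fun :: "nat \<Rightarrow> (nat \<Rightarrow> nat \<Rightarrow> complex) \<Rightarrow> complex" where
  "det_fun N f = Determinant.det (Matrix.mat N N (\<lambda>(i, j). f i j))"

lemma det_fun_expand:
  "det_fun N f = (\<Sum>p | p permutes {0..<N}. of_int (sign p) * (\<Prod>i=0..<N. f i (p i)))"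
  unfolding det_fun_def
  by (subst det_def'[of _ N]) (auto intro!: sum.cong prod.cong simp: permutes_in_image)

lemma det_fun_cong:
  "(\<And>i j. i < N \<Longrightarrow> j < N \<Longrightarrow> f i j = g i j) \<Longrightarrow> det_fun N f = det_fun N g"
  unfolding det_fun_def by (intro arg_cong[where f=Determinant.det] eq_matI) auto

lemma det_fun_scale_rows: "det_fun N (\<lambda>i j. d i * f i j) = (\<Prod>i=0..<N. d i) * det_fun N f"
  unfolding det_fun_expand by (simp add: prod.distrib sum_distrib_left mult_ac)

lemma tendsto_det_fun:
  assumes "\<And>i j. i < N \<Longrightarrow> j < N \<Longrightarrow> ((\<lambda>e. f e i j) \<longlongrightarrow> g i j) F"
  shows "((\<lambda>e. det_fun N (f e)) \<longlongrightarrow> det_fun N g) F"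
  unfolding det_fun_expand using assms
  by (intro tendsto_sum tendsto_mult tendsto_const tendsto_prod) (auto simp: permutes_in_image)

lemma det_fun_lower_triangular:
  assumes "\<And>i j. i < j \<Longrightarrow> j < N \<Longrightarrow> f i j = 0"
  shows "det_fun N f = (\<Prod>i=0..<N. f i i)"
proof -
  have "det_fun N f = prod_list (diag_mat (Matrix.mat N N (\<lambda>(i, j). f i j)))"
    unfolding det_fun_def using assms by (intro det_lower_triangular[of N]) auto
  then show ?thesis by (simp add: prod_list_diag_prod)
qed

lemma det_fun_mult:
  "det_fun N f * det_fun N g = det_fun N (\<lambda>i j. \<Sum>k=0..<N. f i k * g k j)"
  unfolding det_fun_def
  by (subst det_mult[symmetric, of _ N])
     (auto intro!: arg_cong[where f=Determinant.det] eq_matI simp: scalar_prod_def)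

lemma det_fun_block:
  assumes "n \<le> N" and zero: "\<And>i j. n \<le> i \<Longrightarrow> i < N \<Longrightarrow> j < n \<Longrightarrow> f i j = 0"
  shows "det_fun N f = det_fun n f * det_fun (N - n) (\<lambda>i j. f (i + n) (j + n))"
proof -
  let ?A = "Matrix.mat n n (\<lambda>(i, j). f i j)"
  let ?B = "Matrix.mat n (N - n) (\<lambda>(i, j). f i (j + n))"
  let ?D = "Matrix.mat (N - n) (N - n) (\<lambda>(i, j). f (i + n) (j + n))"
  have "Matrix.mat N N (\<lambda>(i, j). f i j) = four_block_mat ?A ?B (0\<^sub>m (N - n) n) ?D"
    using assms by (intro eq_matI) auto
  then show ?thesis
    unfolding det_fun_def by (simp add: det_four_block_mat_lower_left_zero[of _ n _ "N - n"])
qed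

lemma det_fun_transpose: "det_fun N (\<lambda>i j. f j i) = det_fun N f"
proof -
  have "transpose_mat (Matrix.mat N N (\<lambda>(i, j). f i j)) = Matrix.mat N N (\<lambda>(i, j). f j i)"
    by (intro eq_matI) auto
  then show ?thesis
    unfolding det_fun_def using det_transpose[of "Matrix.mat N N (\<lambda>(i, j). f i j)" N] by simp
qed

lemma det_fun_permute:
  assumes p: "p permutes {0..<N}"
  shows "det_fun N (\<lambda>i j. f (p i) (p j)) = det_fun N f"
proof -
  have rows: "det_fun N (\<lambda>i j. g (p i) j) = of_int (sign p) * det_fun N g" for g
  proof -
    have "Matrix.mat N N (\<lambda>(i, j). g (p i) j) = Matrix.mat N N (\<lambda>(i, j). Matrix.mat N N (\<lambda>(i, j). g i j) $$ (p i, j))"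
      using permutes_in_image[OF p] by (intro eq_matI) auto
    then show ?thesis
      unfolding det_fun_def using det_permute_rows[of "Matrix.mat N N (\<lambda>(i, j). g i j)" N p] p by simp
  qed
  have "det_fun N (\<lambda>i j. f (p i) (p j)) = of_int (sign p) * det_fun N (\<lambda>i j. f i (p j))"
    by (rule rows[of "\<lambda>i j. f i (p j)"])
  also have "det_fun N (\<lambda>i j. f i (p j)) = det_fun N (\<lambda>j i. f i (p j))"
    by (rule det_fun_transpose[symmetric])
  also have "\<dots> = of_int (sign p) * det_fun N (\<lambda>j i. f i j)"
    by (rule rows[of "\<lambda>j i. f i j"])
  also have "det_fun N (\<lambda>j i. f i j) = det_fun N f" by (rule det_fun_transpose)
  finally show ?thesis by (simp add: sign_def)
qed

text \<open>The determinant of a matrix indexed by a finite set does not depend on the enumeration of the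
set. This allows a triangular order of the states in place of the increasing one.\<close>

lemma det_fun_reorder:
  assumes "distinct xs" "distinct ys" "set xs = set ys"
  shows "det_fun (length xs) (\<lambda>i j. f (xs ! i) (xs ! j)) = det_fun (length ys) (\<lambda>i j. f (ys ! i) (ys ! j))"
proof -
  have m: "mset xs = mset ys" using assms set_eq_iff_mset_eq_distinct by blast
  then obtain p where p: "p permutes {..<length ys}" "permute_list p ys = xs"
    by (rule mset_eq_permutation)
  have len: "length xs = length ys" using m by (rule mset_eq_length)
  have "det_fun (length ys) (\<lambda>i j. f (xs ! i) (xs ! j)) = det_fun (length ys) (\<lambda>i j. f (ys ! p i) (ys ! p j))"
    using p permute_list_nth[OF p(1)] by (intro det_fun_cong) auto
  also have "\<dots> = det_fun (length ys) (\<lambda>i j. f (ys ! i) (ys ! j))"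
    using p(1) by (intro det_fun_permute[where f="\<lambda>i j. f (ys ! i) (ys ! j)"]) (simp add: atLeast0LessThan)
  finally show ?thesis by (simp add: len)
qed

lemma size_spec_mset:
  assumes "A \<in> carrier_mat N N" shows "size (spec_mset A) = N"
  using degree_monic_char_poly[of "map_mat complex_of_real A" N] assms
  by (simp add: spec_mset_def size_proots_complex)

lemma poly_char_poly_eq_prod:
  assumes "A \<in> carrier_mat N N"
  shows "poly (char_poly (map_mat complex_of_real A)) z = (\<Prod>a\<in>#spec_mset A. z - a)"
proof -
  let ?p = "char_poly (map_mat complex_of_real A)"
  have "poly ?p z = poly (Polynomial.smult (lead_coeff ?p) (\<Prod>x\<in>#proots ?p. [:-x, 1:])) z"
    by (simp only: complex_poly_decompose_multiset)
  also have "lead_coeff ?p = 1"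
    using degree_monic_char_poly[of "map_mat complex_of_real A" N] assms by simp
  finally show ?thesis
    by (simp add: spec_mset_def poly_prod_mset image_mset.compositionality comp_def)
qed

lemma prod_spec_mset:
  assumes "A \<in> carrier_mat N N"
  shows "(\<Prod>a\<in>#spec_mset A. z - a) = det_fun N (\<lambda>i j. (if i = j then z else 0) - complex_of_real (A $$ (i, j)))"
proof -
  have "poly (char_poly (map_mat complex_of_real A)) z = det_fun N (\<lambda>i j. (if i = j then z else 0) - complex_of_real (A $$ (i, j)))"
    using char_poly_matrix[of "map_mat complex_of_real A" N z] assms
    by (auto simp: det_fun_def char_matrix_def intro!: arg_cong[where f=Determinant.det] eq_matI)
  then show ?thesis using poly_char_poly_eq_prod[OF assms] by simp
qed

lemma zero_in_spec_mset:
  assumes A: "A \<in> carrier_mat N N" and "0 < N"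
    and rows: "\<And>i. i < N \<Longrightarrow> (\<Sum>j=0..<N. A $$ (i, j)) = 0"
  shows "0 \<in># spec_mset A"
proof -
  let ?A = "map_mat complex_of_real A"
  let ?v = "Matrix.vec N (\<lambda>_. 1 :: complex)"
  have "?A *\<^sub>v ?v = 0 \<cdot>\<^sub>v ?v"
  proof (intro eq_vecI)
    fix i assume "i < dim_vec (0 \<cdot>\<^sub>v ?v)"
    then have i: "i < N" by simp
    have "Matrix.vec_index (?A *\<^sub>v ?v) i = (\<Sum>j=0..<N. complex_of_real (A $$ (i, j)))"
      using A i by (auto simp: scalar_prod_def intro!: sum.cong)
    also have "\<dots> = complex_of_real (\<Sum>j=0..<N. A $$ (i, j))" by simp
    finally show "Matrix.vec_index (?A *\<^sub>v ?v) i = Matrix.vec_index (0 \<cdot>\<^sub>v ?v) i" using rows[OF i] i by simp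
  qed (use A in simp)
  moreover have "?v \<noteq> 0\<^sub>v N" using \<open>0 < N\<close> by (auto dest: arg_cong[where f="\<lambda>v. Matrix.vec_index v 0"])
  ultimately have "eigenvalue ?A 0"
    using A by (auto simp: eigenvalue_def eigenvector_def intro!: exI[of _ ?v])
  then have "poly (char_poly ?A) 0 = 0"
    using eigenvalue_root_char_poly[of ?A N 0] A by simp
  then have "(\<Prod>a\<in>#spec_mset A. 0 - a) = 0" using poly_char_poly_eq_prod[OF A] by simp
  then show ?thesis by (auto simp: prod_mset_zero_iff)
qed

text \<open>At \<open>\<epsilon> = 0\<close> the chain follows the map \<open>T\<close>: the first \<open>n\<close> states are fixed, all others move to a
smaller index, so the unperturbed matrix is triangular, which gives the first limit. In the second
limit the rows of the fixed states have finite limits, as \<open>P - I\<close> is of order \<open>\<eta>\<close> there, and the other rows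
are multiplied by \<open>\<eta>\<close> and tend to those of \<open>I - T\<close>. Adding, for each fixed state \<open>j\<close>, all columns
of its basin \<open>{k. w k = j}\<close> to column \<open>j\<close> annihilates the lower left block, because \<open>T\<close> preserves basins. The
upper left block becomes the matrix of rates from wells to whole basins, and the lower right one is
unitriangular.\<close>

lemma tree_determinants:
  fixes P :: "real \<Rightarrow> nat \<Rightarrow> nat \<Rightarrow> real" and \<eta> :: "real \<Rightarrow> real" and B :: "nat \<Rightarrow> nat \<Rightarrow> real"
    and T w :: "nat \<Rightarrow> nat"
  assumes n: "n \<le> N"
    and T_fix: "\<And>i. i < n \<Longrightarrow> T i = i" and T_less: "\<And>i. n \<le> i \<Longrightarrow> i < N \<Longrightarrow> T i < i"
    and w_less: "\<And>i. i < N \<Longrightarrow> w i < n" and w_fix: "\<And>i. i < n \<Longrightarrow> w i = i"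
    and w_T: "\<And>i. i < N \<Longrightarrow> w (T i) = w i"
    and \<eta>_pos: "eventually (\<lambda>e. 0 < \<eta> e) F" and \<eta>: "(\<eta> \<longlongrightarrow> 0) F"
    and P: "\<And>i j. i < N \<Longrightarrow> j < N \<Longrightarrow> ((\<lambda>e. (P e i j - of_bool (T i = j)) / \<eta> e) \<longlongrightarrow> B i j) F"
  shows tree_det_micro:
      "((\<lambda>e. det_fun N (\<lambda>i j. (if i = j then z else 0) - complex_of_real (P e i j)))
        \<longlongrightarrow> (z - 1) ^ n * z ^ (N - n)) F"
    and tree_det_macro:
      "((\<lambda>e. of_real (\<eta> e) ^ (N - n) * det_fun N (\<lambda>i j. (if i = j then z else 0) -
            complex_of_real (1 / \<eta> e * (P e i j - of_bool (i = j)))))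
        \<longlongrightarrow> det_fun n (\<lambda>i j. (if i = j then z else 0) - complex_of_real (\<Sum>k | k < N \<and> w k = j. B i k))) F"
proof -
  have P0: "((\<lambda>e. P e i j) \<longlongrightarrow> of_bool (T i = j)) F" if "i < N" "j < N" for i j
  proof -
    have "((\<lambda>e. (P e i j - of_bool (T i = j)) / \<eta> e * \<eta> e + of_bool (T i = j)) \<longlongrightarrow> B i j * 0 + of_bool (T i = j)) F"
      by (intro tendsto_intros P that \<eta>)
    moreover have "eventually (\<lambda>e. (P e i j - of_bool (T i = j)) / \<eta> e * \<eta> e + of_bool (T i = j) = P e i j) F"
      using \<eta>_pos by eventually_elim simp
    ultimately show ?thesis by (auto intro: Lim_transform_eventually)
  qed
  have T_le: "T i \<le> i" if "i < N" for i
    using T_fix[of i] T_less[of i] that by (cases "i < n") auto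
  show "((\<lambda>e. det_fun N (\<lambda>i j. (if i = j then z else 0) - complex_of_real (P e i j)))
        \<longlongrightarrow> (z - 1) ^ n * z ^ (N - n)) F"
  proof -
    define g where "g i j = (if i = j then z else 0) - complex_of_real (of_bool (T i = j))" for i j
    have "((\<lambda>e. det_fun N (\<lambda>i j. (if i = j then z else 0) - complex_of_real (P e i j))) \<longlongrightarrow> det_fun N g) F"
      unfolding g_def by (intro tendsto_det_fun tendsto_intros P0)
    also have "det_fun N g = (\<Prod>i=0..<N. g i i)"
    proof (rule det_fun_lower_triangular)
      fix i j :: nat assume "i < j" "j < N"
      then show "g i j = 0" using T_le[of i] by (simp add: g_def)
    qed
    also have "\<dots> = (\<Prod>i\<in>{0..<n}. g i i) * (\<Prod>i\<in>{n..<N}. g i i)"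
      using n by (simp add: prod.atLeastLessThan_concat)
    also have "(\<Prod>i\<in>{0..<n}. g i i) = (\<Prod>i\<in>{0..<n}. z - 1)"
      using T_fix by (intro prod.cong) (auto simp: g_def)
    also have "(\<Prod>i\<in>{n..<N}. g i i) = (\<Prod>i\<in>{n..<N}. z)"
    proof (rule prod.cong)
      fix i assume "i \<in> {n..<N}"
      then show "g i i = z" using T_less[of i] by (simp add: g_def)
    qed simp
    finally show ?thesis by simp
  qed
  define d where "d e i = (if i < n then 1 else complex_of_real (\<eta> e))" for e and i :: nat
  define G where "G e i j = d e i * ((if i = j then z else 0) - complex_of_real (1 / \<eta> e * (P e i j - of_bool (i = j))))" for e i j
  define G0 where "G0 i j = (if i < n then (if i = j then z else 0) - complex_of_real (B i j)
      else complex_of_real (of_bool (i = j) - of_bool (T i = j)))" for i j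
  have lim: "((\<lambda>e. det_fun N (G e)) \<longlongrightarrow> det_fun N G0) F"
  proof (rule tendsto_det_fun)
    fix i j assume ij: "i < N" "j < N"
    show "((\<lambda>e. G e i j) \<longlongrightarrow> G0 i j) F"
    proof (cases "i < n")
      case True
      have "((\<lambda>e. (if i = j then z else 0) - complex_of_real ((P e i j - of_bool (T i = j)) / \<eta> e)) \<longlongrightarrow> G0 i j) F"
        unfolding G0_def if_P[OF True] by (intro tendsto_diff tendsto_const tendsto_of_real P ij)
      then show ?thesis using True by (simp add: G_def d_def T_fix)
    next
      case False
      have "((\<lambda>e. complex_of_real (\<eta> e) * (if i = j then z else 0) - complex_of_real (P e i j - of_bool (i = j)))
          \<longlongrightarrow> of_real 0 * (if i = j then z else 0) - complex_of_real (of_bool (T i = j) - of_bool (i = j))) F"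
        by (intro tendsto_intros \<eta> P0 ij)
      moreover have "eventually (\<lambda>e. complex_of_real (\<eta> e) * (if i = j then z else 0) - complex_of_real (P e i j - of_bool (i = j)) = G e i j) F"
        using \<eta>_pos
      proof eventually_elim
        case (elim e)
        then have "complex_of_real (\<eta> e) * complex_of_real (1 / \<eta> e * (P e i j - of_bool (i = j))) = complex_of_real (P e i j - of_bool (i = j))"
          by (subst of_real_mult[symmetric]) simp
        then show ?case using False by (simp only: G_def d_def if_False right_diff_distrib)
      qed
      ultimately show ?thesis using False by (auto simp: G0_def intro: Lim_transform_eventually)
    qed
  qed
  have scale: "det_fun N (G e) = of_real (\<eta> e) ^ (N - n) * det_fun N (\<lambda>i j. (if i = j then z else 0) -
            complex_of_real (1 / \<eta> e * (P e i j - of_bool (i = j))))" for e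
  proof -
    have "(\<Prod>i=0..<N. d e i) = (\<Prod>i\<in>{0..<n}. d e i) * (\<Prod>i\<in>{n..<N}. d e i)"
      using n by (simp add: prod.atLeastLessThan_concat)
    also have "\<dots> = of_real (\<eta> e) ^ (N - n)" by (simp add: d_def)
    finally show ?thesis unfolding G_def by (simp only: det_fun_scale_rows)
  qed
  \<comment> \<open>right multiplication by \<open>W\<close> adds the columns of each basin to the column of its well\<close>
  define W where "W i j = (of_bool (i = j \<or> j < n \<and> w i = j) :: complex)" for i j
  define H where "H i j = (\<Sum>k=0..<N. G0 i k * W k j)" for i j
  have detW: "det_fun N W = 1"
    using w_fix by (subst det_fun_lower_triangular) (auto simp: W_def)
  have Hj: "H i j = (\<Sum>k | k < N \<and> w k = j. G0 i k)" if "j < n" for i j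
  proof -
    have "H i j = (\<Sum>k=0..<N. if w k = j then G0 i k else 0)"
      unfolding H_def using that w_fix by (intro sum.cong) (auto simp: W_def)
    also have "\<dots> = (\<Sum>k\<in>{k\<in>{0..<N}. w k = j}. G0 i k)" by (subst sum.inter_filter) auto
    also have "{k\<in>{0..<N}. w k = j} = {k. k < N \<and> w k = j}" by auto
    finally show ?thesis .
  qed
  have H1: "H i j = (if i = j then z else 0) - complex_of_real (\<Sum>k | k < N \<and> w k = j. B i k)" if "i < n" "j < n" for i j
  proof -
    have "(\<Sum>k | k < N \<and> w k = j. if i = k then z else 0) = (if i = j then z else 0)"
      using that n w_fix[of i] by (subst sum.delta') auto
    then show ?thesis using that by (simp add: Hj G0_def sum_subtractf)
  qed
  have H2: "H i j = 0" if "n \<le> i" "i < N" "j < n" for i j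
  proof -
    have TN: "T i < N" using T_less[of i] that by simp
    have delta: "(\<Sum>k | k < N \<and> w k = j. of_bool (x = k)) = (of_bool (w x = j) :: complex)" if "x < N" for x
      using that by (simp add: of_bool_def)
    have "H i j = (\<Sum>k | k < N \<and> w k = j. of_bool (i = k) - of_bool (T i = k))"
      unfolding Hj[OF that(3)] using that by (intro sum.cong) (auto simp: G0_def)
    also have "\<dots> = (\<Sum>k | k < N \<and> w k = j. of_bool (i = k)) - (\<Sum>k | k < N \<and> w k = j. of_bool (T i = k))"
      by (rule sum_subtractf)
    finally have "H i j = \<dots>" .
    then show ?thesis using delta[of i] delta[OF TN] w_T[of i] that by simp
  qed
  have H3: "H i j = G0 i j" if "n \<le> j" "j < N" for i j
  proof -
    have "H i j = (\<Sum>k=0..<N. if k = j then G0 i k else 0)"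
      unfolding H_def using that by (intro sum.cong) (auto simp: W_def)
    then show ?thesis using that by simp
  qed
  have "det_fun N G0 = det_fun N G0 * det_fun N W" by (simp add: detW)
  also have "\<dots> = det_fun N H" unfolding det_fun_mult H_def ..
  also have "\<dots> = det_fun n H * det_fun (N - n) (\<lambda>i j. H (i + n) (j + n))"
    using n H2 by (intro det_fun_block) auto
  also have "det_fun (N - n) (\<lambda>i j. H (i + n) (j + n)) = 1"
  proof -
    have less: "T (i + n) < i + n" if "i < N - n" for i using T_less[of "i + n"] that by simp
    have "det_fun (N - n) (\<lambda>i j. H (i + n) (j + n)) = (\<Prod>i=0..<N - n. H (i + n) (i + n))"
    proof (rule det_fun_lower_triangular)
      fix i j :: nat assume "i < j" "j < N - n"
      then show "H (i + n) (j + n) = 0" using less[of i] by (simp add: H3 G0_def)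
    qed
    also have "\<dots> = 1"
    proof (rule prod.neutral, rule ballI)
      fix i assume "i \<in> {0..<N - n}"
      then show "H (i + n) (i + n) = 1" using less[of i] by (simp add: H3 G0_def)
    qed
    finally show ?thesis .
  qed
  also have "det_fun n H = det_fun n (\<lambda>i j. (if i = j then z else 0) - complex_of_real (\<Sum>k | k < N \<and> w k = j. B i k))"
    using H1 by (intro det_fun_cong) auto
  finally show "((\<lambda>e. of_real (\<eta> e) ^ (N - n) * det_fun N (\<lambda>i j. (if i = j then z else 0) -
            complex_of_real (1 / \<eta> e * (P e i j - of_bool (i = j)))))
        \<longlongrightarrow> det_fun n (\<lambda>i j. (if i = j then z else 0) - complex_of_real (\<Sum>k | k < N \<and> w k = j. B i k))) F"
    using lim by (simp add: scale)
qed

section \<open>Jump rates between intervals\<close>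

definition ecell :: "ereal \<Rightarrow> ereal \<Rightarrow> real set" where
  "ecell A B = {w. A \<le> ereal w \<and> ereal w < B}"

text \<open>For an interval from \<open>A\<close> to \<open>B\<close>, the difference \<open>jump_rate \<alpha> B z - jump_rate \<alpha> A z\<close> is the limiting rate of
jumps from \<open>z\<close> into it if \<open>z\<close> lies outside, and minus the rate of jumps out of it if \<open>z\<close> lies
inside. Infinite endpoints contribute \<open>0\<close>.\<close>

definition jump_rate :: "real \<Rightarrow> ereal \<Rightarrow> real \<Rightarrow> real" where
  "jump_rate \<alpha> c z = sgn (z - real_of_ereal c) / 2 * inv_dist_powr \<alpha> c z"

lemma ecell_borel [measurable]: "ecell A B \<in> sets borel"
  unfolding ecell_def by measurable

context
  fixes D :: "real measure" and \<alpha> :: real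
  assumes D: "real_distribution D" and \<alpha>: "0 < \<alpha>" "\<alpha> < 2"
    and char: "\<And>u. char D u = complex_of_real (exp (- stable_const \<alpha> * \<bar>u\<bar> powr \<alpha>))"
begin

interpretation D: real_distribution D by (rule D)

lemma stable_point: "measure D {x} = 0"
  by (rule stable_no_atom[OF D stable_const_pos[OF \<alpha>] \<alpha>(1) char])

lemma stable_lower_tail: "measure D {..<-u} = measure D {u..}"
proof -
  have "distr D borel uminus = D"
  proof (rule Levy_uniqueness)
    show "real_distribution (distr D borel uminus)" by (intro D.real_distribution_distr) auto
    have "Characteristic_Functions.char (distr D borel uminus) t = Characteristic_Functions.char D (- t)" for t
      unfolding char_def by (subst integral_distr) auto
    then show "Characteristic_Functions.char (distr D borel uminus) = Characteristic_Functions.char D"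
      by (auto simp: char)
  qed (rule D)
  then have "measure D {u..} = measure (distr D borel uminus) {u..}" by simp
  also have "\<dots> = measure D {..-u}"
    by (subst measure_distr) (auto intro!: arg_cong[where f="measure D"])
  also have "{..-u} = {..<-u} \<union> {-u}" by auto
  also have "measure D \<dots> = measure D {..<-u} + measure D {-u}"
    by (intro D.finite_measure_Union) auto
  finally show ?thesis by (simp add: stable_point)
qed

text \<open>For \<open>c > z\<close> the event misses an upper tail of \<open>D\<close> beyond \<open>\<bar>c - z\<bar> / (\<epsilon> h powr (1/\<alpha>))\<close>, for \<open>c < z\<close> it is the
lower tail at minus this point. By symmetry and the absence of atoms both have the asymptotics of
\<open>stable_tail\<close>.\<close>

lemma stable_cdf_limit:
  fixes c :: ereal
  assumes h: "0 < h" and c: "c \<noteq> ereal z"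
  shows "((\<lambda>\<epsilon>. (measure D {y. ereal (z + \<epsilon> * h powr (1 / \<alpha>) * y) < c} - of_bool (ereal z < c)) / (h * \<epsilon> powr \<alpha>))
     \<longlongrightarrow> jump_rate \<alpha> c z) (at_right 0)"
proof (cases c)
  case PInf
  then show ?thesis using D.prob_space by (simp add: jump_rate_def inv_dist_powr_def)
next
  case MInf
  then show ?thesis by (simp add: jump_rate_def inv_dist_powr_def)
next
  case (real r)
  define \<kappa> where "\<kappa> \<epsilon> = \<epsilon> * h powr (1 / \<alpha>)" for \<epsilon>
  define d where "d = \<bar>r - z\<bar>"
  have d: "0 < d" using c real by (auto simp: d_def)
  have pos: "eventually (\<lambda>\<epsilon>. 0 < \<epsilon>) (at_right (0::real))" by (simp add: eventually_at_right_less)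
  have \<kappa>_pos: "0 < \<kappa> \<epsilon>" if "0 < \<epsilon>" for \<epsilon> using that h by (simp add: \<kappa>_def)
  have "filterlim (\<lambda>\<epsilon>. d / \<kappa> \<epsilon>) at_top (at_right 0)"
  proof -
    have "(\<kappa> \<longlongrightarrow> 0 * h powr (1 / \<alpha>)) (at_right 0)"
      unfolding \<kappa>_def by (intro tendsto_intros)
    moreover have "eventually (\<lambda>\<epsilon>. 0 < \<kappa> \<epsilon>) (at_right 0)"
      using pos by eventually_elim (rule \<kappa>_pos)
    ultimately show ?thesis
      using d by (intro LIM_at_top_divide[OF tendsto_const]) auto
  qed
  from filterlim_compose[OF stable_tail[OF D \<alpha> char] this]
  have "((\<lambda>\<epsilon>. (d / \<kappa> \<epsilon>) powr \<alpha> * measure D {d / \<kappa> \<epsilon>..} / d powr \<alpha>) \<longlongrightarrow> 1/2 / d powr \<alpha>) (at_right 0)"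
    using d by (intro tendsto_intros) auto
  moreover have "eventually (\<lambda>\<epsilon>. (d / \<kappa> \<epsilon>) powr \<alpha> * measure D {d / \<kappa> \<epsilon>..} / d powr \<alpha>
      = measure D {d / \<kappa> \<epsilon>..} / (h * \<epsilon> powr \<alpha>)) (at_right 0)"
    using pos
  proof eventually_elim
    case (elim \<epsilon>)
    have "\<kappa> \<epsilon> powr \<alpha> = h * \<epsilon> powr \<alpha>"
      using elim h \<alpha> by (simp add: \<kappa>_def powr_mult powr_powr)
    then show ?case using d \<kappa>_pos[OF elim] by (simp add: powr_divide)
  qed
  ultimately have lim: "((\<lambda>\<epsilon>. measure D {d / \<kappa> \<epsilon>..} / (h * \<epsilon> powr \<alpha>)) \<longlongrightarrow> 1/2 / d powr \<alpha>) (at_right 0)"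
    by (auto intro: Lim_transform_eventually)
  show ?thesis
  proof (cases "z < r")
    case True
    have "eventually (\<lambda>\<epsilon>. - (measure D {d / \<kappa> \<epsilon>..} / (h * \<epsilon> powr \<alpha>)) =
        (measure D {y. ereal (z + \<epsilon> * h powr (1 / \<alpha>) * y) < c} - of_bool (ereal z < c)) / (h * \<epsilon> powr \<alpha>)) (at_right 0)"
      using pos
    proof eventually_elim
      case (elim \<epsilon>)
      have "{y. ereal (z + \<epsilon> * h powr (1 / \<alpha>) * y) < c} = UNIV - {d / \<kappa> \<epsilon>..}"
        unfolding \<kappa>_def[symmetric] using \<kappa>_pos[OF elim] True real by (auto simp: d_def field_simps)
      then have "measure D {y. ereal (z + \<epsilon> * h powr (1 / \<alpha>) * y) < c} = 1 - measure D {d / \<kappa> \<epsilon>..}"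
        using D.prob_compl[of "{d / \<kappa> \<epsilon>..}"] by simp
      then show ?case using True real by simp
    qed
    moreover have "- (1/2 / d powr \<alpha>) = jump_rate \<alpha> c z"
      using True real by (simp add: jump_rate_def inv_dist_powr_def d_def)
    ultimately show ?thesis using tendsto_minus[OF lim] by (auto intro: Lim_transform_eventually)
  next
    case False
    then have "r < z" using c real by auto
    have "eventually (\<lambda>\<epsilon>. measure D {d / \<kappa> \<epsilon>..} / (h * \<epsilon> powr \<alpha>) =
        (measure D {y. ereal (z + \<epsilon> * h powr (1 / \<alpha>) * y) < c} - of_bool (ereal z < c)) / (h * \<epsilon> powr \<alpha>)) (at_right 0)"
      using pos
    proof eventually_elim
      case (elim \<epsilon>)
      have "{y. ereal (z + \<epsilon> * h powr (1 / \<alpha>) * y) < c} = {..< - (d / \<kappa> \<epsilon>)}"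
        unfolding \<kappa>_def[symmetric] using \<kappa>_pos[OF elim] \<open>r < z\<close> real by (auto simp: d_def field_simps)
      then show ?case using \<open>r < z\<close> real by (simp add: stable_lower_tail)
    qed
    moreover have "1/2 / d powr \<alpha> = jump_rate \<alpha> c z"
      using \<open>r < z\<close> real by (simp add: jump_rate_def inv_dist_powr_def d_def)
    ultimately show ?thesis using lim by (auto intro: Lim_transform_eventually)
  qed
qed

lemma stable_cell_limit:
  fixes A B :: ereal
  assumes h: "0 < h" and AB: "A \<le> B" and A: "A \<noteq> ereal z" and B: "B \<noteq> ereal z"
  shows "((\<lambda>\<epsilon>. (measure D {y. z + \<epsilon> * h powr (1 / \<alpha>) * y \<in> ecell A B} - of_bool (z \<in> ecell A B)) / (h * \<epsilon> powr \<alpha>))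
     \<longlongrightarrow> jump_rate \<alpha> B z - jump_rate \<alpha> A z) (at_right 0)"
proof -
  define F where "F c \<epsilon> = measure D {y. ereal (z + \<epsilon> * h powr (1 / \<alpha>) * y) < c}" for c :: ereal and \<epsilon> :: real
  have 1: "measure D {y. z + \<epsilon> * h powr (1 / \<alpha>) * y \<in> ecell A B} = F B \<epsilon> - F A \<epsilon>" for \<epsilon>
  proof -
    have "{y. z + \<epsilon> * h powr (1 / \<alpha>) * y \<in> ecell A B} =
        {y. ereal (z + \<epsilon> * h powr (1 / \<alpha>) * y) < B} - {y. ereal (z + \<epsilon> * h powr (1 / \<alpha>) * y) < A}"
      by (auto simp: ecell_def)
    also have "measure D \<dots> = F B \<epsilon> - F A \<epsilon>"
      unfolding F_def using AB by (intro D.finite_measure_Diff) auto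
    finally show ?thesis .
  qed
  have 2: "of_bool (z \<in> ecell A B) = (of_bool (ereal z < B) - of_bool (ereal z < A) :: real)"
    using AB by (auto simp: ecell_def)
  have lim: "((\<lambda>\<epsilon>. (F c \<epsilon> - of_bool (ereal z < c)) / (h * \<epsilon> powr \<alpha>)) \<longlongrightarrow> jump_rate \<alpha> c z) (at_right 0)"
    if "c \<noteq> ereal z" for c
    unfolding F_def by (rule stable_cdf_limit[OF h that])
  have "(measure D {y. z + \<epsilon> * h powr (1 / \<alpha>) * y \<in> ecell A B} - of_bool (z \<in> ecell A B)) / (h * \<epsilon> powr \<alpha>)
      = (F B \<epsilon> - of_bool (ereal z < B)) / (h * \<epsilon> powr \<alpha>) - (F A \<epsilon> - of_bool (ereal z < A)) / (h * \<epsilon> powr \<alpha>)" for \<epsilon>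
    by (simp only: 1 2 diff_divide_distrib[symmetric]) (simp add: algebra_simps)
  then show ?thesis
    using tendsto_diff[OF lim[OF B] lim[OF A]] by presburger
qed

end

lemma inv_dist_powr_mono:
  fixes c c' :: ereal and x :: real
  assumes "0 < \<alpha>" and "ereal x < c \<and> c \<le> c' \<or> c < ereal x \<and> c' \<le> c"
  shows "inv_dist_powr \<alpha> c' x \<le> inv_dist_powr \<alpha> c x"
proof (cases "\<bar>c'\<bar> = \<infinity>")
  case True
  then show ?thesis by (simp add: inv_dist_powr_def)
next
  case False
  then obtain r' where r': "c' = ereal r'" by (cases c') auto
  then obtain r where r: "c = ereal r" using assms(2) by (cases c) auto
  have "\<bar>r - x\<bar> \<le> \<bar>r' - x\<bar>" "0 < \<bar>r - x\<bar>" using assms(2) r r' by auto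
  then have "\<bar>r - x\<bar> powr \<alpha> \<le> \<bar>r' - x\<bar> powr \<alpha>" "0 < \<bar>r - x\<bar> powr \<alpha>"
    using assms(1) by (auto intro: powr_mono2)
  then show ?thesis by (simp add: inv_dist_powr_def r r' frac_le)
qed

lemma jump_rate_above: "ereal x < c \<Longrightarrow> jump_rate \<alpha> c x = - inv_dist_powr \<alpha> c x / 2"
  by (cases c) (auto simp: jump_rate_def inv_dist_powr_def)

lemma jump_rate_below: "c < ereal x \<Longrightarrow> jump_rate \<alpha> c x = inv_dist_powr \<alpha> c x / 2"
  by (cases c) (auto simp: jump_rate_def inv_dist_powr_def)

section \<open>Cells, wells and the deterministic step\<close>

text \<open>The first and the last cell are enlarged to half lines, since the chain sends all jumps beyond \<open>\<plusminus>R\<close> to the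
extreme states.\<close>

definition cell_lo :: "real set \<Rightarrow> (real \<Rightarrow> real) \<Rightarrow> real \<Rightarrow> ereal" where
  "cell_lo S a y = (if y = Min S then -\<infinity> else ereal (a y))"

definition cell_hi :: "real set \<Rightarrow> (real \<Rightarrow> real) \<Rightarrow> real \<Rightarrow> ereal" where
  "cell_hi S b y = (if y = Max S then \<infinity> else ereal (b y))"

locale interval_partition =
  fixes S :: "real set" and a b :: "real \<Rightarrow> real" and R :: real
  assumes R: "0 < R" and fin: "finite S"
    and cover: "(\<Union>x\<in>S. {a x..<b x}) = {-R..<R}"
    and disj: "disjoint_family_on (\<lambda>x. {a x..<b x}) S"
    and mem: "\<And>x. x \<in> S \<Longrightarrow> a x < x \<and> x < b x"
    and only: "\<And>x. x \<in> S \<Longrightarrow> {a x..<b x} \<inter> S = {x}"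
begin

lemma cells_disjoint: "x \<in> S \<Longrightarrow> y \<in> S \<Longrightarrow> p \<in> {a x..<b x} \<Longrightarrow> p \<in> {a y..<b y} \<Longrightarrow> x = y"
  using disjoint_family_onD[OF disj, of x y] by blast

lemma S_ne: "S \<noteq> {}"
  using cover R by (metis UN_empty atLeastLessThan_empty_iff neg_less_pos)

lemma MinMax: "Min S \<in> S" "Max S \<in> S" "\<And>x. x \<in> S \<Longrightarrow> Min S \<le> x \<and> x \<le> Max S"
  using fin S_ne by auto

lemma S_bounds: "x \<in> S \<Longrightarrow> -R \<le> a x \<and> x < R"
proof -
  assume x: "x \<in> S"
  then have "{a x..<b x} \<subseteq> {-R..<R}" using cover by blast
  moreover have "a x \<in> {a x..<b x}" "x \<in> {a x..<b x}" using mem[OF x] by auto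
  ultimately show ?thesis by (metis atLeastLessThan_iff subsetD)
qed

lemma cell_order:
  assumes x: "x \<in> S" and y: "y \<in> S" and "x < y"
  shows "b x \<le> a y"
proof (rule ccontr)
  assume *: "\<not> b x \<le> a y"
  define p where "p = max x (a y)"
  have "y \<notin> {a x..<b x}" using only[OF x] y \<open>x < y\<close> by auto
  then have "b x \<le> y" using mem[OF x] \<open>x < y\<close> by auto
  then have "p \<in> {a x..<b x}" "p \<in> {a y..<b y}"
    using * mem[OF x] mem[OF y] \<open>x < y\<close> by (auto simp: p_def)
  then show False using cells_disjoint[OF x y] \<open>x < y\<close> by blast
qed

lemma endpoint_not_interior:
  assumes "x \<in> S" "y \<in> S"
  shows "\<not> (a y < a x \<and> a x < b y)" "\<not> (a y < b x \<and> b x < b y)"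
proof -
  have "b x \<le> a y \<or> x = y \<or> b y \<le> a x"
    using cell_order[OF assms] cell_order[OF assms(2,1)] by linarith
  then show "\<not> (a y < a x \<and> a x < b y)" "\<not> (a y < b x \<and> b x < b y)"
    using mem[OF assms(1)] mem[OF assms(2)] by auto
qed

lemma extreme_endpoints: "a (Min S) = -R" "b (Max S) = R"
proof -
  have "-R \<in> (\<Union>x\<in>S. {a x..<b x})" using R unfolding cover by simp
  then obtain x where x: "x \<in> S" "a x \<le> -R" by auto
  have "x = Min S"
  proof (rule ccontr)
    assume "x \<noteq> Min S"
    then have "b (Min S) \<le> a x" using MinMax x by (intro cell_order) (auto simp: less_le)
    then show False using x mem[OF MinMax(1)] S_bounds[OF MinMax(1)] by linarith
  qed
  then show "a (Min S) = -R" using x S_bounds[of x] by simp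
  show "b (Max S) = R"
  proof (rule antisym)
    show "b (Max S) \<le> R"
    proof (rule ccontr)
      assume "\<not> b (Max S) \<le> R"
      then have "R \<in> {a (Max S)..<b (Max S)}"
        using mem[OF MinMax(2)] S_bounds[OF MinMax(2)] by auto
      then have "R \<in> {-R..<R}" using MinMax(2) cover by blast
      then show False by simp
    qed
    show "R \<le> b (Max S)"
    proof (rule ccontr)
      assume *: "\<not> R \<le> b (Max S)"
      then have "b (Max S) \<in> {-R..<R}"
        using mem[OF MinMax(2)] S_bounds[OF MinMax(2)] by auto
      then obtain x where x: "x \<in> S" "a x \<le> b (Max S)" "b (Max S) < b x" unfolding cover[symmetric] by auto
      then have "x < Max S" using MinMax(3)[of x] by (cases "x = Max S") auto
      then show False using cell_order[OF x(1) MinMax(2)] x mem[OF MinMax(2)] by linarith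
    qed
  qed
qed

lemma extended_cell_cases: "\<exists>!y. y \<in> S \<and> w \<in> ecell (cell_lo S a y) (cell_hi S b y)"
proof (rule ex_ex1I)
  show "\<exists>y. y \<in> S \<and> w \<in> ecell (cell_lo S a y) (cell_hi S b y)"
  proof -
    consider "w < -R" | "w \<in> {-R..<R}" | "R \<le> w" by fastforce
    then show ?thesis
    proof cases
      case 1
      then have "w < b (Min S)" using mem[OF MinMax(1)] S_bounds[OF MinMax(1)] by auto
      then show ?thesis using MinMax(1) by (intro exI[of _ "Min S"]) (auto simp: ecell_def cell_lo_def cell_hi_def)
    next
      case 2
      then obtain x where "x \<in> S" "w \<in> {a x..<b x}" unfolding cover[symmetric] by auto
      then show ?thesis by (intro exI[of _ x]) (auto simp: ecell_def cell_lo_def cell_hi_def)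
    next
      case 3
      then have "a (Max S) < w" using mem[OF MinMax(2)] S_bounds[OF MinMax(2)] by auto
      then show ?thesis using MinMax(2) by (intro exI[of _ "Max S"]) (auto simp: ecell_def cell_lo_def cell_hi_def)
    qed
  qed
  have "False" if "x \<in> S" "y \<in> S" "x < y" "w \<in> ecell (cell_lo S a x) (cell_hi S b x)" "w \<in> ecell (cell_lo S a y) (cell_hi S b y)" for x y
  proof -
    have "x \<noteq> Max S" "y \<noteq> Min S" using that MinMax(3) by force+
    then have "w < b x" "a y \<le> w" using that by (auto simp: ecell_def cell_lo_def cell_hi_def)
    then show False using cell_order[OF that(1-3)] by simp
  qed
  then show "x = y" if "x \<in> S \<and> w \<in> ecell (cell_lo S a x) (cell_hi S b x)" "y \<in> S \<and> w \<in> ecell (cell_lo S a y) (cell_hi S b y)" for x y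
    using that by (cases x y rule: linorder_cases) blast+
qed

text \<open>No endpoint of a cell lies inside another cell, so a cut at an endpoint splits the states and the extended
cells in the same way.\<close>

lemma endpoint_separates:
  assumes y: "y \<in> S" and r: "r \<in> a ` S \<union> b ` S" "-R < r" "r < R"
  shows "y < r \<and> cell_hi S b y \<le> ereal r \<or> r < y \<and> ereal r \<le> cell_lo S a y"
proof -
  have "\<not> (a y < r \<and> r < b y)" using r endpoint_not_interior y by auto
  then consider "r \<le> a y" | "b y \<le> r" by linarith
  then show ?thesis
  proof cases
    case 1
    then have "y \<noteq> Min S" using extreme_endpoints r by auto
    then show ?thesis using 1 mem[OF y] by (auto simp: cell_lo_def)
  next
    case 2
    then have "y \<noteq> Max S" using extreme_endpoints r by auto
    then show ?thesis using 2 mem[OF y] by (auto simp: cell_hi_def)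
  qed
qed

lemma cell_of_interior_point:
  assumes y: "y \<in> S" and z: "a y < z" "z < b y" and x: "x \<in> S"
  shows "cell_lo S a x \<noteq> ereal z" "cell_hi S b x \<noteq> ereal z"
    "z \<in> ecell (cell_lo S a x) (cell_hi S b x) \<longleftrightarrow> x = y"
proof -
  show "cell_lo S a x \<noteq> ereal z" "cell_hi S b x \<noteq> ereal z"
    using endpoint_not_interior[OF x y] z by (auto simp: cell_lo_def cell_hi_def)
  have "z \<in> ecell (cell_lo S a y) (cell_hi S b y)"
    using z by (auto simp: ecell_def cell_lo_def cell_hi_def)
  then show "z \<in> ecell (cell_lo S a x) (cell_hi S b x) \<longleftrightarrow> x = y"
    using extended_cell_cases[of z] x y by auto
qed

lemma cell_lo_le_hi: "x \<in> S \<Longrightarrow> cell_lo S a x \<le> cell_hi S b x"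
  using mem[of x] by (auto simp: cell_lo_def cell_hi_def)

end

locale multiwell_discretization =
  fixes n :: nat and U :: "real \<Rightarrow> real" and m s :: "nat \<Rightarrow> real"
    and R h \<delta> :: real and S :: "real set" and a b :: "real \<Rightarrow> real"
  assumes potential: "multiwell_potential n U m s"
    and discr: "discretization n U m s R h \<delta> S a b"
begin

sublocale interval_partition S a b R
  using discr unfolding discretization_def by unfold_locales auto

abbreviation "sad \<equiv> saddle n s"
abbreviation "drift x \<equiv> x - h * deriv U x"
abbreviation "T \<equiv> euler_step U h S a b"
abbreviation "lo \<equiv> cell_lo S a"
abbreviation "hi \<equiv> cell_hi S b"

lemma discretization_facts:
  shows m_subset: "m ` {1..n} \<subseteq> S"
    and s_bounds: "s ` {1..n-1} \<subseteq> {-R<..<R}"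
    and s_endpoints: "{-R, R} \<union> s ` {1..n-1} \<subseteq> a ` S \<union> b ` S"
    and drift_in: "\<forall>x\<in>S. x - h * deriv U x \<in> {-R..<R}"
    and euler_m: "\<forall>x\<in>m ` {1..n}. euler_step U h S a b x = x"
    and orbit_monoseq: "\<forall>x\<in>S. monoseq (\<lambda>k. (euler_step U h S a b ^^ k) x)"
    and orbit_reaches: "\<forall>i\<in>{1..n}. \<forall>x\<in>well_points n s S i. \<exists>k. (euler_step U h S a b ^^ k) x = m i"
    and drift_interior: "\<forall>x\<in>S. x - h * deriv U x \<in>
        interior {a (euler_step U h S a b x)..<b (euler_step U h S a b x)}"
    and h_pos: "0 < h"
  using discr unfolding discretization_def by - (elim conjE, assumption)+

lemma n2: "2 \<le> n"
  using potential by (simp add: multiwell_potential_def)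

lemma sad_0 [simp]: "sad 0 = -\<infinity>" and sad_n [simp]: "sad n = \<infinity>"
  using n2 by (auto simp: saddle_def)

lemma well_between: "i \<in> {1..n} \<Longrightarrow> sad (i - 1) < ereal (m i) \<and> ereal (m i) < sad i"
  using potential by (auto simp: multiwell_potential_def)

lemma sad_strict_mono: "i < j \<Longrightarrow> j \<le> n \<Longrightarrow> sad i < sad j"
proof (induction j)
  case (Suc j)
  have "sad j < sad (Suc j)" using well_between[of "Suc j"] Suc.prems by auto
  then show ?case using Suc by (cases "i = j") auto
qed simp

lemma sad_mono: "i \<le> j \<Longrightarrow> j \<le> n \<Longrightarrow> sad i \<le> sad j"
  using sad_strict_mono[of i j] by (cases "i = j") auto

lemma m_in: "i \<in> {1..n} \<Longrightarrow> m i \<in> S"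
  using m_subset by blast

lemma m_inj: "inj_on m {1..n}"
proof (rule linorder_inj_onI)
  fix i j assume ij: "i < j" "i \<in> {1..n}" "j \<in> {1..n}"
  have "ereal (m i) < sad i" "sad (j - 1) < ereal (m j)" using well_between ij by auto
  moreover have "sad i \<le> sad (j - 1)" using ij by (intro sad_mono) auto
  ultimately have "ereal (m i) < ereal (m j)"
    using less_le_trans[of "ereal (m i)" "sad i" "sad (j - 1)"] less_trans[of "ereal (m i)" "sad (j - 1)" "ereal (m j)"]
    by blast
  then show "m i \<noteq> m j" by simp
qed auto

lemma sad_separates:
  assumes y: "y \<in> S" and j: "j \<le> n"
  shows "ereal y < sad j \<and> hi y \<le> sad j \<or> sad j < ereal y \<and> sad j \<le> lo y"
proof -
  consider "j = 0" | "j = n" | "j \<in> {1..n-1}" using j by fastforce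
  then show ?thesis
  proof cases
    case 3
    then have "s j \<in> a ` S \<union> b ` S" "-R < s j" "s j < R"
      using s_endpoints s_bounds by (auto simp: image_subset_iff)
    from endpoint_separates[OF y this] show ?thesis using 3 by (auto simp: saddle_def)
  qed auto
qed

lemma well_ex1:
  assumes x: "x \<in> S"
  shows "\<exists>!j. j \<in> {1..n} \<and> sad (j - 1) < ereal x \<and> ereal x < sad j"
proof (rule ex_ex1I)
  define j where "j = (LEAST j. ereal x < sad j)"
  have "ereal x < sad n" by simp
  then have j: "ereal x < sad j" "j \<le> n" unfolding j_def by (rule LeastI, rule Least_le)
  have "j \<noteq> 0" using j(1) by (cases "j = 0") auto
  then have "\<not> ereal x < sad (j - 1)"
    using not_less_Least[of "j - 1" "\<lambda>j. ereal x < sad j"] unfolding j_def[symmetric] by simp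
  then have "sad (j - 1) < ereal x" using sad_separates[OF x, of "j - 1"] j by auto
  then show "\<exists>j. j \<in> {1..n} \<and> sad (j - 1) < ereal x \<and> ereal x < sad j"
    using j \<open>j \<noteq> 0\<close> by (intro exI[of _ j]) auto
next
  have False if "i \<in> {1..n}" "j \<in> {1..n}" "i < j" "ereal x < sad i" "sad (j - 1) < ereal x" for i j
  proof -
    have "sad i \<le> sad (j - 1)" using that by (intro sad_mono) auto
    then have "ereal x < sad (j - 1)" using that(4) by (rule less_le_trans[rotated])
    then show False using less_asym[OF that(5)] by blast
  qed
  then show "i = j" if "i \<in> {1..n} \<and> sad (i - 1) < ereal x \<and> ereal x < sad i" "j \<in> {1..n} \<and> sad (j - 1) < ereal x \<and> ereal x < sad j" for i j
    using that by (cases i j rule: linorder_cases) blast+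
qed

definition well :: "real \<Rightarrow> nat" where
  "well x = (THE j. j \<in> {1..n} \<and> sad (j - 1) < ereal x \<and> ereal x < sad j)"

lemma well: "x \<in> S \<Longrightarrow> well x \<in> {1..n} \<and> sad (well x - 1) < ereal x \<and> ereal x < sad (well x)"
  unfolding well_def by (rule theI'[OF well_ex1])

lemma well_eqI: "x \<in> S \<Longrightarrow> j \<in> {1..n} \<Longrightarrow> sad (j - 1) < ereal x \<Longrightarrow> ereal x < sad j \<Longrightarrow> well x = j"
  using well_ex1[of x] well[of x] by blast

lemma well_m: "i \<in> {1..n} \<Longrightarrow> well (m i) = i"
  using well_between[of i] m_in[of i] by (intro well_eqI) auto

lemma well_points_eq: "well_points n s S j = {x \<in> S. well x = j}" if "j \<in> {1..n}"
  using that well well_eqI by (auto simp: well_points_def)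

text \<open>The interval between two neighbouring maxima is exactly filled by the extended cells of the states of this
well; this is what lets rates into single states add up to rates into whole wells.\<close>

lemma ecell_well:
  assumes j: "j \<in> {1..n}"
  shows "ecell (sad (j - 1)) (sad j) = (\<Union>y\<in>well_points n s S j. ecell (lo y) (hi y))"
proof (intro equalityI subsetI)
  fix w assume w: "w \<in> ecell (sad (j - 1)) (sad j)"
  obtain y where y: "y \<in> S" "w \<in> ecell (lo y) (hi y)" using extended_cell_cases[of w] by blast
  have "\<not> sad j \<le> lo y" "\<not> hi y \<le> sad (j - 1)"
  proof -
    have w': "sad (j - 1) \<le> ereal w" "ereal w < sad j" "lo y \<le> ereal w" "ereal w < hi y"
      using w y by (simp_all add: ecell_def)
    show "\<not> sad j \<le> lo y" using order_trans[of "sad j" "lo y" "ereal w"] w' by (simp add: not_le[symmetric])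
    show "\<not> hi y \<le> sad (j - 1)" using order_trans[of "hi y" "sad (j - 1)" "ereal w"] w' by (simp add: not_le[symmetric])
  qed
  then have "ereal y < sad j" "sad (j - 1) < ereal y"
    using sad_separates[OF y(1), of j] sad_separates[OF y(1), of "j - 1"] j by auto
  then have "y \<in> well_points n s S j" using y by (simp add: well_points_def)
  then show "w \<in> (\<Union>y\<in>well_points n s S j. ecell (lo y) (hi y))" using y by blast
next
  fix w assume "w \<in> (\<Union>y\<in>well_points n s S j. ecell (lo y) (hi y))"
  then obtain y where y: "y \<in> S" "sad (j - 1) < ereal y" "ereal y < sad j" "w \<in> ecell (lo y) (hi y)"
    by (auto simp: well_points_def)
  have "j \<le> n" "j - 1 \<le> n" using j by auto
  then have "hi y \<le> sad j" "sad (j - 1) \<le> lo y"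
    using sad_separates[OF y(1), of j] sad_separates[OF y(1), of "j - 1"] less_asym[OF y(2)] less_asym[OF y(3)]
    by blast+
  then show "w \<in> ecell (sad (j - 1)) (sad j)"
    using y(4) order_trans[of "sad (j - 1)" "lo y" "ereal w"] less_le_trans[of "ereal w" "hi y" "sad j"]
    unfolding ecell_def by blast
qed

lemma T_props:
  assumes x: "x \<in> S"
  shows "T x \<in> S" "a (T x) < drift x" "drift x < b (T x)"
proof -
  have "drift x \<in> {-R..<R}" using drift_in x by blast
  then obtain y where y: "y \<in> S" "drift x \<in> {a y..<b y}" unfolding cover[symmetric] by blast
  have "\<exists>!y. y \<in> S \<and> drift x \<in> {a y..<b y}"
    using y cells_disjoint by (intro ex1I[of _ y]) blast+
  from theI'[OF this] show "T x \<in> S" by (simp add: euler_step_def)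
  have "drift x \<in> interior {a (T x)..<b (T x)}"
    using drift_interior x by blast
  then show "a (T x) < drift x" "drift x < b (T x)" by simp_all
qed

lemma T_m: "i \<in> {1..n} \<Longrightarrow> T (m i) = m i"
  using euler_m by blast

text \<open>A monotone orbit that reaches the minimum of its well cannot leave the well or overshoot, and it cannot stop
before the minimum. The distance to the minimum is therefore a strictly decreasing potential for the
deterministic step.\<close>

lemma T_closer:
  assumes x: "x \<in> S"
  shows "well (T x) = well x" and "x \<noteq> m (well x) \<Longrightarrow> \<bar>T x - m (well x)\<bar> < \<bar>x - m (well x)\<bar>"
proof -
  define j where "j = well x"
  have j: "j \<in> {1..n}" "sad (j - 1) < ereal x" "ereal x < sad j" using well[OF x] by (auto simp: j_def)
  have "x \<in> well_points n s S j" using x j by (simp add: well_points_def)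
  then obtain k where k: "(T ^^ k) x = m j"
    using orbit_reaches j(1) by blast
  have mono: "monoseq (\<lambda>k. (T ^^ k) x)" using orbit_monoseq x by blast
  have *: "(x < T x \<and> T x \<le> m j) \<or> (T x < x \<and> m j \<le> T x)" if "x \<noteq> m j"
  proof -
    have "k \<noteq> 0" using k that by (cases "k = 0") auto
    have "T x \<noteq> x"
    proof
      assume "T x = x"
      then have "(T ^^ i) x = x" for i by (induction i) auto
      then show False using k that by simp
    qed
    moreover have "(x \<le> T x \<and> T x \<le> m j) \<or> (T x \<le> x \<and> m j \<le> T x)"
    proof -
      have "0 \<le> (1::nat)" "1 \<le> k" using \<open>k \<noteq> 0\<close> by auto
      then have "((T ^^ 0) x \<le> (T ^^ 1) x \<and> (T ^^ 1) x \<le> (T ^^ k) x) \<or>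
          ((T ^^ 1) x \<le> (T ^^ 0) x \<and> (T ^^ k) x \<le> (T ^^ 1) x)"
        using mono unfolding monoseq_def by blast
      then show ?thesis using k by simp
    qed
    ultimately show ?thesis by auto
  qed
  show "\<bar>T x - m (well x)\<bar> < \<bar>x - m (well x)\<bar>" if "x \<noteq> m (well x)"
    using * that by (auto simp: j_def)
  show "well (T x) = well x"
  proof (cases "x = m j")
    case True
    then show ?thesis using T_m j by simp
  next
    case False
    from *[OF this] have "sad (j - 1) < ereal (T x) \<and> ereal (T x) < sad j"
    proof (elim disjE conjE)
      assume *: "x < T x" "T x \<le> m j"
      have "sad (j - 1) < ereal (T x)" using less_trans[OF j(2), of "ereal (T x)"] * by simp
      moreover have "ereal (T x) < sad j" using le_less_trans[of "ereal (T x)" "ereal (m j)" "sad j"] * well_between[OF j(1)] by simp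
      ultimately show "sad (j - 1) < ereal (T x) \<and> ereal (T x) < sad j" ..
    next
      assume *: "T x < x" "m j \<le> T x"
      have "ereal (T x) < sad j" using less_trans[OF _ j(3), of "ereal (T x)"] * by simp
      moreover have "sad (j - 1) < ereal (T x)" using less_le_trans[of "sad (j - 1)" "ereal (m j)" "ereal (T x)"] * well_between[OF j(1)] by simp
      ultimately show "sad (j - 1) < ereal (T x) \<and> ereal (T x) < sad j" by blast
    qed
    then show ?thesis using T_props(1)[OF x] j well_eqI by (simp add: j_def[symmetric])
  qed
qed

lemma deriv_m: "i \<in> {1..n} \<Longrightarrow> deriv U (m i) = 0"
proof -
  assume i: "i \<in> {1..n}"
  then have "local_min U (m i)" using potential by (auto simp: multiwell_potential_def)
  then obtain d where d: "0 < d" "\<And>y. \<bar>m i - y\<bar> < d \<Longrightarrow> U (m i) \<le> U y"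
    unfolding local_min_def eventually_nhds_metric by (auto simp: dist_real_def abs_minus_commute)
  have "U differentiable (at (m i))"
    using potential by (auto simp: multiwell_potential_def C_k_def dest: spec[of _ 0])
  then have "(U has_real_derivative deriv U (m i)) (at (m i))"
    by (simp add: DERIV_deriv_iff_real_differentiable)
  then show ?thesis using d by (intro DERIV_local_min) auto
qed

end

section \<open>Transition probabilities and limiting rates\<close>

locale stable_chain = multiwell_discretization +
  fixes \<alpha> :: real and M :: "'w measure" and L :: "'w \<Rightarrow> real"
  assumes alpha: "0 < \<alpha>" "\<alpha> < 2"
    and prob: "prob_space M"
    and noise: "symmetric_stable_rv \<alpha> M L"
begin

interpretation prob_space M by (rule prob)

abbreviation "D \<equiv> distr M borel L"
abbreviation "p \<equiv> p_entry \<alpha> M L U h S a b"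

lemma L_meas [measurable]: "L \<in> borel_measurable M"
  using noise by (simp add: symmetric_stable_rv_def)

lemma real_distribution_D: "real_distribution D"
  by (intro real_distribution_distr) measurable

interpretation D: real_distribution D by (rule real_distribution_D)

lemma char_D: "char D u = complex_of_real (exp (- stable_const \<alpha> * \<bar>u\<bar> powr \<alpha>))"
  using noise by (simp add: symmetric_stable_rv_def)

lemma card_S: "n \<le> card S"
  using card_mono[OF fin m_subset] unfolding card_image[OF m_inj] by simp

lemma Min_neq_Max: "Min S \<noteq> Max S"
proof
  assume eq: "Min S = Max S"
  have "S \<subseteq> {Max S}" using MinMax(3) eq by (auto intro: antisym)
  from card_mono[OF _ this] have "card S \<le> 1" by simp
  then show False using card_S n2 by simp
qed

text \<open>The transition probabilities of the extreme states use closed half lines. These differ from the extended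
cells by a point at most, which has probability \<open>0\<close>; the extended cells form a true partition of the line, so
that the rows add up to exactly \<open>1\<close>.\<close>

lemma p_eq:
  assumes y: "y \<in> S" and \<epsilon>: "0 < \<epsilon>"
  shows "p \<epsilon> x y = measure D {w. drift x + \<epsilon> * h powr (1 / \<alpha>) * w \<in> ecell (lo y) (hi y)}"
proof -
  define \<kappa> where "\<kappa> = \<epsilon> * h powr (1 / \<alpha>)"
  have \<kappa>: "0 < \<kappa>" using \<epsilon> h_pos by (simp add: \<kappa>_def)
  have M_D: "measure M {\<omega> \<in> space M. drift x + \<kappa> * L \<omega> \<in> A} = measure D {w. drift x + \<kappa> * w \<in> A}"
    if [measurable]: "A \<in> sets borel" for A
    by (subst measure_distr) (auto intro!: arg_cong[where f="measure M"])
  consider "y = Min S" | "y = Max S" "y \<noteq> Min S" | "y \<noteq> Min S" "y \<noteq> Max S" by blast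
  then show ?thesis
  proof cases
    case 1
    have "p \<epsilon> x y = measure D {w. drift x + \<kappa> * w \<in> {..b y}}"
      using 1 M_D[of "{..b y}"] by (simp add: p_entry_def Let_def \<kappa>_def)
    also have "{w. drift x + \<kappa> * w \<in> {..b y}} = {w. drift x + \<kappa> * w < b y} \<union> {(b y - drift x) / \<kappa>}"
      using \<kappa> by (auto simp: field_simps)
    also have "measure D \<dots> = measure D {w. drift x + \<kappa> * w < b y} + measure D {(b y - drift x) / \<kappa>}"
      using \<kappa> by (intro D.finite_measure_Union) auto
    also have "measure D {(b y - drift x) / \<kappa>} = 0"
      by (rule stable_point[OF real_distribution_D alpha char_D])
    finally show ?thesis
      using 1 Min_neq_Max by (simp add: ecell_def cell_lo_def cell_hi_def \<kappa>_def)
  next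
    case 2
    then show ?thesis
      using M_D[of "{a y..}"] by (simp add: p_entry_def Let_def ecell_def cell_lo_def cell_hi_def \<kappa>_def)
  next
    case 3
    then show ?thesis
      using M_D[of "{a y..<b y}"] by (simp add: p_entry_def Let_def ecell_def cell_lo_def cell_hi_def \<kappa>_def)
  qed
qed

lemma sum_p:
  assumes Y: "Y \<subseteq> S" and \<epsilon>: "0 < \<epsilon>"
  shows "(\<Sum>y\<in>Y. p \<epsilon> x y) = measure D {w. drift x + \<epsilon> * h powr (1 / \<alpha>) * w \<in> (\<Union>y\<in>Y. ecell (lo y) (hi y))}"
proof -
  let ?C = "\<lambda>y. {w :: real. drift x + \<epsilon> * h powr (1 / \<alpha>) * w \<in> ecell (lo y) (hi y)}"
  have "(\<Sum>y\<in>Y. p \<epsilon> x y) = (\<Sum>y\<in>Y. measure D (?C y))"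
    using Y \<epsilon> by (intro sum.cong) (auto simp: p_eq)
  also have "\<dots> = measure D (\<Union>y\<in>Y. ?C y)"
  proof (rule D.finite_measure_finite_Union[symmetric])
    show "finite Y" using Y fin by (rule finite_subset)
    show "disjoint_family_on ?C Y"
      unfolding disjoint_family_on_def using extended_cell_cases Y by blast
  qed auto
  also have "(\<Union>y\<in>Y. ?C y) = {w. drift x + \<epsilon> * h powr (1 / \<alpha>) * w \<in> (\<Union>y\<in>Y. ecell (lo y) (hi y))}"
    by auto
  finally show ?thesis .
qed

lemma row_sum: "0 < \<epsilon> \<Longrightarrow> (\<Sum>y\<in>S. p \<epsilon> x y) = 1"
proof -
  assume \<epsilon>: "0 < \<epsilon>"
  have "(\<Union>y\<in>S. ecell (lo y) (hi y)) = UNIV" using extended_cell_cases by blast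
  then show ?thesis using sum_p[OF subset_refl \<epsilon>, of x] D.prob_space by simp
qed

definition rate :: "real \<Rightarrow> real \<Rightarrow> real" where
  "rate x y = jump_rate \<alpha> (hi y) (drift x) - jump_rate \<alpha> (lo y) (drift x)"

lemma p_limit:
  assumes x: "x \<in> S" and y: "y \<in> S"
  shows "((\<lambda>\<epsilon>. (p \<epsilon> x y - of_bool (T x = y)) / (h * \<epsilon> powr \<alpha>)) \<longlongrightarrow> rate x y) (at_right 0)"
proof -
  note c = cell_of_interior_point[OF T_props(1)[OF x] T_props(2)[OF x] T_props(3)[OF x] y]
  note lim = stable_cell_limit[OF real_distribution_D alpha char_D h_pos cell_lo_le_hi[OF y] c(1) c(2)]
  have "eventually (\<lambda>\<epsilon>. (measure D {w. drift x + \<epsilon> * h powr (1 / \<alpha>) * w \<in> ecell (lo y) (hi y)} -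
        of_bool (drift x \<in> ecell (lo y) (hi y))) / (h * \<epsilon> powr \<alpha>) = (p \<epsilon> x y - of_bool (T x = y)) / (h * \<epsilon> powr \<alpha>)) (at_right 0)"
    using eventually_at_right_less[of 0]
  proof eventually_elim
    case (elim \<epsilon>)
    have "(drift x \<in> ecell (lo y) (hi y)) = (T x = y)" using c(3) by blast
    then show ?case using p_eq[OF y elim] by simp
  qed
  with lim show ?thesis unfolding rate_def by (rule Lim_transform_eventually)
qed

text \<open>The probabilities of the cells of a well add up to that of the interval between two maxima, to which the
limit of interval probabilities applies directly; uniqueness of limits then identifies the sum of the rates.\<close>

lemma sum_rate:
  assumes i: "i \<in> {1..n}" and j: "j \<in> {1..n}"
  shows "(\<Sum>y\<in>well_points n s S j. rate (m i) y) = q_entry n \<alpha> m s i j"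
proof -
  let ?W = "well_points n s S j" and ?A = "sad (j - 1)" and ?B = "sad j"
  have W: "?W \<subseteq> S" "finite ?W" using fin by (auto simp: well_points_def)
  have mi: "m i \<in> S" "deriv U (m i) = 0" "T (m i) = m i" using i m_in deriv_m T_m by auto
  have AB: "?A \<le> ?B" using j by (intro sad_mono) auto
  have ne: "sad k \<noteq> ereal (m i)" if "k \<le> n" for k
    using sad_separates[OF mi(1) that] by auto
  have A: "?A \<noteq> ereal (drift (m i))" and B: "?B \<noteq> ereal (drift (m i))"
    using ne[of "j - 1"] ne[of j] j mi(2) by (simp_all add: le_diff_conv)
  have lim1: "((\<lambda>\<epsilon>. \<Sum>y\<in>?W. (p \<epsilon> (m i) y - of_bool (T (m i) = y)) / (h * \<epsilon> powr \<alpha>))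
      \<longlongrightarrow> (\<Sum>y\<in>?W. rate (m i) y)) (at_right 0)"
    using W mi(1) by (intro tendsto_sum p_limit) auto
  have "eventually (\<lambda>\<epsilon>. (\<Sum>y\<in>?W. (p \<epsilon> (m i) y - of_bool (T (m i) = y)) / (h * \<epsilon> powr \<alpha>)) =
     (measure D {w. drift (m i) + \<epsilon> * h powr (1 / \<alpha>) * w \<in> ecell ?A ?B} - of_bool (drift (m i) \<in> ecell ?A ?B)) / (h * \<epsilon> powr \<alpha>)) (at_right 0)"
    using eventually_at_right_less[of 0]
  proof eventually_elim
    case (elim \<epsilon>)
    have "(\<Sum>y\<in>?W. of_bool (m i = y)) = (of_bool (m i \<in> ?W) :: real)"
      using W(2) by (simp add: of_bool_def)
    moreover have "m i \<in> ?W \<longleftrightarrow> m i \<in> ecell ?A ?B"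
      using mi(1) A mi(2) by (auto simp: well_points_def ecell_def less_le)
    ultimately show ?case
      using sum_p[OF W(1) elim, of "m i", folded ecell_well[OF j]] mi
      by (simp add: sum_divide_distrib[symmetric] sum_subtractf)
  qed
  from Lim_transform_eventually[OF lim1 this]
  have "(\<Sum>y\<in>?W. rate (m i) y) = jump_rate \<alpha> ?B (drift (m i)) - jump_rate \<alpha> ?A (drift (m i))"
    by (rule tendsto_unique[OF trivial_limit_at_right_real _ stable_cell_limit[OF real_distribution_D alpha char_D h_pos AB A B]])
  also have "\<dots> = q_entry n \<alpha> m s i j"
  proof (cases i j rule: linorder_cases)
    case equal
    then show ?thesis
      using well_between[OF i] mi(2) by (simp add: q_entry_def jump_rate_above jump_rate_below field_simps)
  next
    case less
    have "ereal (m i) < ?A"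
      using well_between[OF i] sad_mono[of i "j - 1"] less j less_le_trans[of "ereal (m i)" "sad i" ?A] by simp
    moreover have "ereal (m i) < ?B" using calculation AB by (rule less_le_trans)
    moreover have "inv_dist_powr \<alpha> ?B (m i) \<le> inv_dist_powr \<alpha> ?A (m i)"
      using calculation AB alpha by (intro inv_dist_powr_mono) auto
    ultimately show ?thesis using less by (simp add: mi(2) q_entry_def jump_rate_above)
  next
    case greater
    have "?B < ereal (m i)"
      using well_between[OF i] sad_mono[of j "i - 1"] greater i le_less_trans[of ?B "sad (i - 1)" "ereal (m i)"] by simp
    moreover have "?A < ereal (m i)" using AB calculation by (rule le_less_trans)
    moreover have "inv_dist_powr \<alpha> ?A (m i) \<le> inv_dist_powr \<alpha> ?B (m i)"
      using calculation AB alpha by (intro inv_dist_powr_mono) auto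
    ultimately show ?thesis using greater by (simp add: mi(2) q_entry_def jump_rate_below)
  qed
  finally show ?thesis .
qed

text \<open>The states in triangular order: the minima first, the others by increasing distance from the minimum of
their well, so that the deterministic step goes to an earlier state.\<close>

lemma state_list:
  obtains xs where "distinct xs" "set xs = S" "\<And>i. i < n \<Longrightarrow> xs ! i = m (Suc i)"
    "\<And>i. n \<le> i \<Longrightarrow> i < card S \<Longrightarrow> \<exists>k<i. xs ! k = T (xs ! i)"
proof -
  define key where "key x = \<bar>x - m (well x)\<bar>" for x
  define ms where "ms = map m [1..<Suc n]"
  define rest where "rest = sort_key key (sorted_list_of_set (S - m ` {1..n}))"
  define xs where "xs = ms @ rest"
  have ms: "set ms = m ` {1..n}" "distinct ms" "length ms = n"
    using m_inj by (auto simp: ms_def distinct_map atLeastLessThanSuc_atLeastAtMost simp del: upt_Suc)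
  have rest: "set rest = S - m ` {1..n}" "distinct rest" "sorted (map key rest)"
    using fin by (auto simp: rest_def)
  have xs: "distinct xs" "set xs = S"
    using ms rest m_in by (auto simp: xs_def)
  have len: "length xs = card S" using distinct_card[OF xs(1)] xs(2) by simp
  show ?thesis
  proof (rule that[OF xs])
    show "xs ! i = m (Suc i)" if "i < n" for i
      using that ms(3) by (simp add: xs_def nth_append) (simp add: ms_def nth_map[of i "[1..<Suc n]"] del: upt_Suc)
    fix i assume i: "n \<le> i" "i < card S"
    define x where "x = xs ! i"
    have x_rest: "x = rest ! (i - n)" "i - n < length rest"
      using i ms(3) len by (auto simp: x_def xs_def nth_append)
    then have "x \<in> set rest" by simp
    then have x: "x \<in> S" "x \<notin> m ` {1..n}" using rest by auto
    have "x \<noteq> m (well x)" using x well[OF x(1)] by auto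
    then have key: "key (T x) < key x" using T_closer[OF x(1)] by (simp add: key_def)
    have "T x \<in> set xs" using T_props(1)[OF x(1)] xs by simp
    then obtain k where k: "k < length xs" "xs ! k = T x" by (auto simp: in_set_conv_nth)
    have "k < i"
    proof (rule ccontr)
      assume "\<not> k < i"
      then have "i - n \<le> k - n" "k - n < length rest" "T x = rest ! (k - n)"
        using i k ms(3) len by (auto simp: xs_def nth_append)
      then have "key x \<le> key (T x)"
        using sorted_nth_mono[OF rest(3), of "i - n" "k - n"] x_rest by simp
      then show False using key by simp
    qed
    then show "\<exists>k<i. xs ! k = T (xs ! i)" using k by (auto simp: x_def)
  qed
qed

end

section \<open>Convergence of the eigenvalues\<close>

lemma obtain_enumeration:
  assumes "size A = N" "a \<in># A"
  obtains l :: "nat \<Rightarrow> 'a" where "image_mset l (mset_set {1..N}) = A" "l 1 = a"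
proof -
  obtain xs where xs: "mset xs = A - {#a#}" using ex_mset by blast
  have A: "A = mset (a # xs)" using xs assms(2) by simp
  have len: "length (a # xs) = N" using assms(1) unfolding A by simp
  define l where "l i = (a # xs) ! (i - 1)" for i
  have "image_mset l (mset_set {1..N}) = mset (map l [1..<Suc N])"
    by (simp only: mset_map mset_upt atLeastLessThanSuc_atLeastAtMost)
  also have "map l [1..<Suc N] = a # xs"
    using len by (intro nth_equalityI) (auto simp: l_def simp del: upt_Suc)
  finally have "image_mset l (mset_set {1..N}) = A" unfolding A .
  moreover have "l 1 = a" by (simp add: l_def)
  ultimately show ?thesis by (rule that)
qed

context stable_chain
begin

definition \<eta> :: "real \<Rightarrow> real" where "\<eta> \<epsilon> = h * \<epsilon> powr \<alpha>"

abbreviation "Q\<epsilon> \<equiv> Q_eps_mat \<alpha> M L U h S a b"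

lemma eta_pos: "0 < \<epsilon> \<Longrightarrow> 0 < \<eta> \<epsilon>"
  using h_pos by (simp add: \<eta>_def)

lemma eta_tendsto: "(\<eta> \<longlongrightarrow> 0) (at_right 0)"
proof -
  have "((\<lambda>\<epsilon>. h * \<epsilon> powr \<alpha>) \<longlongrightarrow> 0) (at_right 0)"
    using h_pos alpha by real_asymp
  then show ?thesis by (simp add: \<eta>_def[abs_def])
qed

lemma Q_eps_carrier: "Q\<epsilon> \<epsilon> \<in> carrier_mat (card S) (card S)"
  by (rule carrier_matI) (simp_all add: Q_eps_mat_def)

lemma Q_eps_entry:
  assumes "i < card S" "j < card S"
  shows "Q\<epsilon> \<epsilon> $$ (i, j) = 1 / \<eta> \<epsilon> * (p \<epsilon> (sorted_list_of_set S ! i) (sorted_list_of_set S ! j) - of_bool (i = j))"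
  using assms by (auto simp: Q_eps_mat_def P_mat_def \<eta>_def)

lemma prod_spec_Q_eps:
  assumes xs: "distinct xs" "set xs = S"
  shows "(\<Prod>v\<in>#spec_mset (Q\<epsilon> \<epsilon>). z - v) = det_fun (card S) (\<lambda>i j. (if i = j then z else 0) -
            complex_of_real (1 / \<eta> \<epsilon> * (p \<epsilon> (xs ! i) (xs ! j) - of_bool (i = j))))"
proof -
  define f where "f x y = (if x = y then z else 0) - complex_of_real (1 / \<eta> \<epsilon> * (p \<epsilon> x y - of_bool (x = y)))" for x y
  have f: "det_fun (length ys) (\<lambda>i j. f (ys ! i) (ys ! j)) = det_fun (length ys) (\<lambda>i j. (if i = j then z else 0) -
            complex_of_real (1 / \<eta> \<epsilon> * (p \<epsilon> (ys ! i) (ys ! j) - of_bool (i = j))))" if "distinct ys" for ys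
    using that by (intro det_fun_cong) (simp add: f_def nth_eq_iff_index_eq)
  let ?ys = "sorted_list_of_set S"
  have len: "length xs = card S" "length ?ys = card S" using distinct_card[OF xs(1)] xs(2) by auto
  have "(\<Prod>v\<in>#spec_mset (Q\<epsilon> \<epsilon>). z - v) = det_fun (length ?ys) (\<lambda>i j. (if i = j then z else 0) -
            complex_of_real (1 / \<eta> \<epsilon> * (p \<epsilon> (?ys ! i) (?ys ! j) - of_bool (i = j))))"
    unfolding prod_spec_mset[OF Q_eps_carrier] len
    by (intro det_fun_cong) (simp add: Q_eps_entry)
  also have "\<dots> = det_fun (length ?ys) (\<lambda>i j. f (?ys ! i) (?ys ! j))"
    by (rule f[symmetric]) simp
  also have "\<dots> = det_fun (length xs) (\<lambda>i j. f (xs ! i) (xs ! j))"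
    using xs fin by (intro det_fun_reorder) auto
  also note f[OF xs(1)]
  finally show ?thesis unfolding len .
qed

lemma zero_in_spec_Q_eps:
  assumes \<epsilon>: "0 < \<epsilon>"
  shows "0 \<in># spec_mset (Q\<epsilon> \<epsilon>)"
proof (rule zero_in_spec_mset[OF Q_eps_carrier])
  show "0 < card S" using card_S n2 by simp
  let ?ys = "sorted_list_of_set S"
  fix i assume i: "i < card S"
  have "(\<Sum>j=0..<card S. p \<epsilon> (?ys ! i) (?ys ! j)) = (\<Sum>y\<in>S. p \<epsilon> (?ys ! i) y)"
    using bij_betw_nth[of ?ys "{0..<card S}" S] fin
    by (intro sum.reindex_bij_betw[of "\<lambda>j. ?ys ! j"]) (auto simp: atLeast0LessThan)
  then have 1: "(\<Sum>j=0..<card S. p \<epsilon> (?ys ! i) (?ys ! j)) = 1" using row_sum[OF \<epsilon>] by simp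
  have "(\<Sum>j=0..<card S. Q\<epsilon> \<epsilon> $$ (i, j)) =
      (\<Sum>j=0..<card S. 1 / \<eta> \<epsilon> * (p \<epsilon> (?ys ! i) (?ys ! j) - of_bool (i = j)))"
    using i by (intro sum.cong) (auto simp: Q_eps_entry)
  also have "\<dots> = 1 / \<eta> \<epsilon> * ((\<Sum>j=0..<card S. p \<epsilon> (?ys ! i) (?ys ! j)) - (\<Sum>j=0..<card S. of_bool (i = j)))"
    by (simp only: sum_distrib_left[symmetric] sum_subtractf)
  also have "\<dots> = 0" using 1 i by (simp add: of_bool_def)
  finally show "(\<Sum>j=0..<card S. Q\<epsilon> \<epsilon> $$ (i, j)) = 0" .
qed

lemma prod_spec_Q:
  "(\<Prod>v\<in>#spec_mset (Q_mat n \<alpha> m s). z - v) =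
     det_fun n (\<lambda>i j. (if i = j then z else 0) - complex_of_real (q_entry n \<alpha> m s (Suc i) (Suc j)))"
  by (subst prod_spec_mset[of _ n]) (auto simp: Q_mat_def intro!: det_fun_cong)

text \<open>The two hypotheses of \<open>spectrum_splits\<close>, obtained from \<open>tree_determinants\<close> for the states in triangular
order.\<close>

lemma spectral_limits:
  shows micro: "((\<lambda>\<epsilon>. of_real (\<eta> \<epsilon>) ^ card S * (\<Prod>v\<in>#spec_mset (Q\<epsilon> \<epsilon>). (z - 1) / of_real (\<eta> \<epsilon>) - v))
          \<longlongrightarrow> (z - 1) ^ n * z ^ (card S - n)) (at_right 0)"
    and macro: "((\<lambda>\<epsilon>. of_real (\<eta> \<epsilon>) ^ (card S - n) * (\<Prod>v\<in>#spec_mset (Q\<epsilon> \<epsilon>). z - v))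
          \<longlongrightarrow> (\<Prod>v\<in>#spec_mset (Q_mat n \<alpha> m s). z - v)) (at_right 0)"
proof -
  obtain xs where xs: "distinct xs" "set xs = S" "\<And>i. i < n \<Longrightarrow> xs ! i = m (Suc i)"
    "\<And>i. n \<le> i \<Longrightarrow> i < card S \<Longrightarrow> \<exists>k<i. xs ! k = T (xs ! i)" by (rule state_list) blast
  define N where "N = card S"
  have len: "length xs = N" using distinct_card[OF xs(1)] xs(2) by (simp add: N_def)
  have in_S: "xs ! i \<in> S" if "i < N" for i using that len xs(2) nth_mem by blast
  \<comment> \<open>\<open>\<tau>\<close> is the deterministic step on positions in the list\<close>
  define \<tau> where "\<tau> i = (if i < n then i else SOME k. k < i \<and> xs ! k = T (xs ! i))" for i
  have \<tau>_less: "\<tau> i < i" "xs ! \<tau> i = T (xs ! i)" if "n \<le> i" "i < N" for i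
    using someI_ex[of "\<lambda>k. k < i \<and> xs ! k = T (xs ! i)"] xs(4)[of i] that by (auto simp: \<tau>_def N_def)
  have \<tau>_T: "xs ! \<tau> i = T (xs ! i)" if "i < N" for i
  proof (cases "i < n")
    case True
    then show ?thesis using xs(3)[of i] T_m[of "Suc i"] by (simp add: \<tau>_def)
  qed (use \<tau>_less that in auto)
  have \<tau>_N: "\<tau> i < N" if "i < N" for i
    using \<tau>_less(1)[of i] that by (cases "i < n") (auto simp: \<tau>_def)
  \<comment> \<open>positions start at \<open>0\<close>, wells at \<open>1\<close>\<close>
  define w where "w i = well (xs ! i) - 1" for i
  have w_Suc: "Suc (w i) = well (xs ! i)" if "i < N" for i
    using well[OF in_S[OF that]] by (auto simp: w_def)
  have nN: "n \<le> N" using card_S by (simp add: N_def)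
  define B where "B i j = rate (xs ! i) (xs ! j)" for i j
  have B: "((\<lambda>\<epsilon>. (p \<epsilon> (xs ! i) (xs ! j) - of_bool (\<tau> i = j)) / \<eta> \<epsilon>) \<longlongrightarrow> B i j) (at_right 0)"
    if "i < N" "j < N" for i j
  proof -
    have "(\<tau> i = j) = (T (xs ! i) = xs ! j)"
      using \<tau>_T[OF that(1)] \<tau>_N[OF that(1)] that xs(1) len by (metis nth_eq_iff_index_eq)
    then show ?thesis using p_limit[OF in_S[OF that(1)] in_S[OF that(2)]] by (simp add: \<eta>_def B_def)
  qed
  have q: "(\<Sum>k | k < N \<and> w k = j. B i k) = q_entry n \<alpha> m s (Suc i) (Suc j)" if "i < n" "j < n" for i j
  proof -
    have "(\<Sum>k | k < N \<and> w k = j. B i k) = (\<Sum>y\<in>well_points n s S (Suc j). rate (m (Suc i)) y)"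
      unfolding B_def xs(3)[OF that(1)]
    proof (rule sum.reindex_bij_betw)
      show "bij_betw (\<lambda>k. xs ! k) {k. k < N \<and> w k = j} (well_points n s S (Suc j))"
        unfolding bij_betw_def
      proof
        show "inj_on ((!) xs) {k. k < N \<and> w k = j}"
          using xs(1) len by (auto simp: inj_on_def nth_eq_iff_index_eq)
        have "well_points n s S (Suc j) = {x \<in> S. well x = Suc j}"
          using that by (intro well_points_eq) auto
        also have "\<dots> = (\<lambda>k. xs ! k) ` {k. k < N \<and> w k = j}"
        proof (intro equalityI subsetI)
          fix x assume x: "x \<in> {x \<in> S. well x = Suc j}"
          then obtain k where "k < N" "xs ! k = x" using xs(2) len by (auto simp: in_set_conv_nth)
          then show "x \<in> (\<lambda>k. xs ! k) ` {k. k < N \<and> w k = j}" using x by (auto simp: w_def)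
        next
          fix x assume "x \<in> (\<lambda>k. xs ! k) ` {k. k < N \<and> w k = j}"
          then show "x \<in> {x \<in> S. well x = Suc j}" using in_S w_Suc by auto
        qed
        finally show "(\<lambda>k. xs ! k) ` {k. k < N \<and> w k = j} = well_points n s S (Suc j)" ..
      qed
    qed
    then show ?thesis using sum_rate[of "Suc i" "Suc j"] that by simp
  qed
  have pos: "eventually (\<lambda>\<epsilon>. 0 < \<eta> \<epsilon>) (at_right 0)"
    using eventually_at_right_less[of 0] by eventually_elim (rule eta_pos)
  have \<tau>_fix: "\<tau> i = i" if "i < n" for i using that by (simp add: \<tau>_def)
  have w_less: "w i < n" if "i < N" for i using well[OF in_S[OF that]] by (auto simp: w_def)
  have w_fix: "w i = i" if "i < n" for i using that xs(3)[OF that] well_m[of "Suc i"] by (simp add: w_def)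
  have w_\<tau>: "w (\<tau> i) = w i" if "i < N" for i
    using \<tau>_T[OF that] T_closer(1)[OF in_S[OF that]] by (simp add: w_def)
  note tree = tree_determinants[where P="\<lambda>\<epsilon> i j. p \<epsilon> (xs ! i) (xs ! j)" and T=\<tau> and w=w and B=B and F="at_right 0",
      OF nN \<tau>_fix \<tau>_less(1) w_less w_fix w_\<tau> pos eta_tendsto B]
  show "((\<lambda>\<epsilon>. of_real (\<eta> \<epsilon>) ^ card S * (\<Prod>v\<in>#spec_mset (Q\<epsilon> \<epsilon>). (z - 1) / of_real (\<eta> \<epsilon>) - v))
          \<longlongrightarrow> (z - 1) ^ n * z ^ (card S - n)) (at_right 0)"
  proof -
    have "eventually (\<lambda>\<epsilon>. det_fun N (\<lambda>i j. (if i = j then z else 0) - complex_of_real (p \<epsilon> (xs ! i) (xs ! j))) =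
        of_real (\<eta> \<epsilon>) ^ card S * (\<Prod>v\<in>#spec_mset (Q\<epsilon> \<epsilon>). (z - 1) / of_real (\<eta> \<epsilon>) - v)) (at_right 0)"
      using pos
    proof eventually_elim
      case (elim \<epsilon>)
      then have nz: "complex_of_real (\<eta> \<epsilon>) \<noteq> 0" by simp
      define y where "y = (z - 1) / of_real (\<eta> \<epsilon>)"
      have "of_real (\<eta> \<epsilon>) ^ card S * (\<Prod>v\<in>#spec_mset (Q\<epsilon> \<epsilon>). y - v) =
          (\<Prod>i=0..<N. of_real (\<eta> \<epsilon>)) * det_fun N (\<lambda>i j. (if i = j then y else 0) -
            complex_of_real (1 / \<eta> \<epsilon> * (p \<epsilon> (xs ! i) (xs ! j) - of_bool (i = j))))"
        unfolding prod_spec_Q_eps[OF xs(1,2)] by (simp add: N_def)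
      also have "\<dots> = det_fun N (\<lambda>i j. of_real (\<eta> \<epsilon>) * ((if i = j then y else 0) -
            complex_of_real (1 / \<eta> \<epsilon> * (p \<epsilon> (xs ! i) (xs ! j) - of_bool (i = j)))))"
        by (rule det_fun_scale_rows[symmetric])
      also have "\<dots> = det_fun N (\<lambda>i j. (if i = j then z else 0) - complex_of_real (p \<epsilon> (xs ! i) (xs ! j)))"
        using nz by (intro det_fun_cong) (auto simp: y_def field_simps)
      finally show ?case by (simp add: y_def)
    qed
    from Lim_transform_eventually[OF tree(1) this] show ?thesis by (simp add: N_def)
  qed
  have "det_fun n (\<lambda>i j. (if i = j then z else 0) - complex_of_real (\<Sum>k | k < N \<and> w k = j. B i k)) =
      (\<Prod>v\<in>#spec_mset (Q_mat n \<alpha> m s). z - v)"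
    unfolding prod_spec_Q by (intro det_fun_cong) (simp add: q)
  then show "((\<lambda>\<epsilon>. of_real (\<eta> \<epsilon>) ^ (card S - n) * (\<Prod>v\<in>#spec_mset (Q\<epsilon> \<epsilon>). z - v))
          \<longlongrightarrow> (\<Prod>v\<in>#spec_mset (Q_mat n \<alpha> m s). z - v)) (at_right 0)"
    using tree(2)[of z] unfolding prod_spec_Q_eps[OF xs(1,2)] N_def by simp
qed

text \<open>Singularity of \<open>Q\<close> is inherited from the approximating generators, by the second limit at \<open>z = 0\<close>.\<close>

lemma zero_in_spec_Q: "0 \<in># spec_mset (Q_mat n \<alpha> m s)"
proof -
  have "eventually (\<lambda>\<epsilon>. of_real (\<eta> \<epsilon>) ^ (card S - n) * (\<Prod>v\<in>#spec_mset (Q\<epsilon> \<epsilon>). 0 - v) = 0) (at_right 0)"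
    using eventually_at_right_less[of 0]
  proof eventually_elim
    case (elim \<epsilon>)
    then show ?case using zero_in_spec_Q_eps[OF elim] by (simp add: prod_mset_zero_iff)
  qed
  from tendsto_unique[OF trivial_limit_at_right_real[of 0] Lim_transform_eventually[OF macro[of 0] this] tendsto_const]
  have "(\<Prod>v\<in>#spec_mset (Q_mat n \<alpha> m s). 0 - v) = 0" .
  then show ?thesis by (auto simp: prod_mset_zero_iff)
qed

theorem eigenvalues_converge:
  assumes lQ: "enumerates_spec lQ n (Q_mat n \<alpha> m s)" "lQ 1 = 0"
  shows "\<exists>lam \<epsilon>1. \<epsilon>1 > 0 \<and>
      (\<forall>\<epsilon>\<in>{0<..\<epsilon>1}. enumerates_spec (lam \<epsilon>) (card S) (Q\<epsilon> \<epsilon>) \<and>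
         lam \<epsilon> ` {1..n} \<inter> lam \<epsilon> ` {n+1..card S} = {} \<and> lam \<epsilon> 1 = 0 \<and>
         (\<forall>i\<in>{n+1..card S}. 1 / (2 * \<eta> \<epsilon>) \<le> cmod (lam \<epsilon> i))) \<and>
      (\<forall>i\<in>{2..n}. ((\<lambda>\<epsilon>. lam \<epsilon> i) \<longlongrightarrow> lQ i) (at_right 0))"
  unfolding enumerates_spec_def
proof (rule spectrum_splits)
  show "1 \<le> n" "n \<le> card S" using n2 card_S by auto
  show "size (spec_mset (Q\<epsilon> \<epsilon>)) = card S" for \<epsilon> by (rule size_spec_mset[OF Q_eps_carrier])
  show "((\<lambda>\<epsilon>. of_real (\<eta> \<epsilon>) ^ (card S - n) * (\<Prod>v\<in>#spec_mset (Q\<epsilon> \<epsilon>). z - v))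
          \<longlongrightarrow> (\<Prod>i\<in>{1..n}. z - lQ i)) (at_right 0)" for z
  proof -
    have "(\<Prod>v\<in>#spec_mset (Q_mat n \<alpha> m s). z - v) = (\<Prod>i\<in>{1..n}. z - lQ i)"
      using lQ(1) unfolding enumerates_spec_def by (subst prod_mset_mset_set[symmetric]) simp
    then show ?thesis using macro[of z] by simp
  qed
qed (use eta_pos eta_tendsto micro lQ(2) zero_in_spec_Q_eps in auto)

text \<open>The gap \<open>1 / (2 \<eta>)\<close> is of order \<open>\<epsilon> powr (-\<alpha>)\<close>, whereas \<open>r\<close> is eventually below
\<open>\<epsilon> powr (-\<alpha> / (n + 1))\<close>.\<close>

lemma rate_below_gap:
  assumes "((\<lambda>\<epsilon>. r \<epsilon> * \<epsilon> powr (\<alpha> / (real n + 1))) \<longlongrightarrow> 0) (at_right 0)"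
  shows "eventually (\<lambda>\<epsilon>. r \<epsilon> \<le> 1 / (2 * \<eta> \<epsilon>)) (at_right 0)"
proof -
  define \<beta> where "\<beta> = \<alpha> / (real n + 1)"
  have \<beta>: "\<beta> < \<alpha>" using alpha n2 by (simp add: \<beta>_def field_simps)
  have "((\<lambda>\<epsilon>. h * \<epsilon> powr (\<alpha> - \<beta>)) \<longlongrightarrow> 0) (at_right 0)"
    using \<beta> h_pos by real_asymp
  then have "eventually (\<lambda>\<epsilon>. h * \<epsilon> powr (\<alpha> - \<beta>) < 1/2) (at_right 0)"
    by (rule order_tendstoD(2)) simp
  moreover have "eventually (\<lambda>\<epsilon>. r \<epsilon> * \<epsilon> powr \<beta> < 1) (at_right 0)"
    using assms unfolding \<beta>_def by (rule order_tendstoD(2)) simp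
  ultimately show ?thesis
    using eventually_at_right_less[of 0]
  proof eventually_elim
    case (elim \<epsilon>)
    have "r \<epsilon> * \<eta> \<epsilon> = (r \<epsilon> * \<epsilon> powr \<beta>) * (h * \<epsilon> powr (\<alpha> - \<beta>))"
      using elim(3) by (simp add: \<eta>_def powr_diff)
    also have "\<dots> \<le> 1 * (h * \<epsilon> powr (\<alpha> - \<beta>))"
      using elim h_pos by (intro mult_right_mono) auto
    also have "\<dots> \<le> 1/2" using elim by simp
    finally show ?case using eta_pos[OF elim(3)] by (simp add: field_simps)
  qed
qed

end

theorem theorem2p3:
  fixes n :: nat and U :: "real \<Rightarrow> real" and m s :: "nat \<Rightarrow> real"
    and \<alpha> R h \<delta> :: real and S :: "real set" and a b :: "real \<Rightarrow> real"
    and M :: "'w measure" and L :: "'w \<Rightarrow> real"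
  assumes potential: "multiwell_potential n U m s"
    and alpha: "0 < \<alpha>" "\<alpha> < 2"
    and prob: "prob_space M"
    and noise: "symmetric_stable_rv \<alpha> M L"
    and discr: "discretization n U m s R h \<delta> S a b"
  shows "(\<exists>lQ. enumerates_spec lQ n (Q_mat n \<alpha> m s) \<and> lQ 1 = 0) \<and>
    (\<forall>lQ. enumerates_spec lQ n (Q_mat n \<alpha> m s) \<and> lQ 1 = 0 \<longrightarrow>
      (\<exists>(lam :: real \<Rightarrow> nat \<Rightarrow> complex) \<epsilon>1. \<epsilon>1 > 0 \<and>
        (\<forall>\<epsilon>\<in>{0<..\<epsilon>1}.
           enumerates_spec (lam \<epsilon>) (card S) (Q_eps_mat \<alpha> M L U h S a b \<epsilon>) \<and>
           lam \<epsilon> ` {1..n} \<inter> lam \<epsilon> ` {n+1..card S} = {} \<and>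
           lam \<epsilon> 1 = 0) \<and>
        (\<forall>i\<in>{2..n}. ((\<lambda>\<epsilon>. lam \<epsilon> i) \<longlongrightarrow> lQ i) (at_right 0)) \<and>
        (\<forall>r :: real \<Rightarrow> real.
           filterlim r at_top (at_right 0) \<longrightarrow>
           ((\<lambda>\<epsilon>. r \<epsilon> * \<epsilon> powr (\<alpha> / (real n + 1))) \<longlongrightarrow> 0) (at_right 0) \<longrightarrow>
           (\<exists>\<epsilon>0>0. \<forall>\<epsilon>\<in>{0<..\<epsilon>0}. \<forall>i\<in>{n+1..card S}. cmod (lam \<epsilon> i) \<ge> r \<epsilon>))))"
proof -
  interpret stable_chain n U m s R h \<delta> S a b \<alpha> M L
    by (intro stable_chain.intro multiwell_discretization.intro stable_chain_axioms.intro assms)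
  show ?thesis
  proof (intro conjI allI impI)
    have "size (spec_mset (Q_mat n \<alpha> m s)) = n" by (rule size_spec_mset) (simp add: Q_mat_def)
    from obtain_enumeration[OF this zero_in_spec_Q]
    show "\<exists>lQ. enumerates_spec lQ n (Q_mat n \<alpha> m s) \<and> lQ 1 = 0"
      unfolding enumerates_spec_def by metis
  next
    fix lQ assume "enumerates_spec lQ n (Q_mat n \<alpha> m s) \<and> lQ 1 = 0"
    then have lQ: "enumerates_spec lQ n (Q_mat n \<alpha> m s)" "lQ 1 = 0" by blast+
    obtain lam \<epsilon>1 where lam': "0 < \<epsilon>1 \<and>
      (\<forall>\<epsilon>\<in>{0<..\<epsilon>1}. enumerates_spec (lam \<epsilon>) (card S) (Q\<epsilon> \<epsilon>) \<and>
         lam \<epsilon> ` {1..n} \<inter> lam \<epsilon> ` {n+1..card S} = {} \<and> lam \<epsilon> 1 = 0 \<and>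
         (\<forall>i\<in>{n+1..card S}. 1 / (2 * \<eta> \<epsilon>) \<le> cmod (lam \<epsilon> i))) \<and>
      (\<forall>i\<in>{2..n}. ((\<lambda>\<epsilon>. lam \<epsilon> i) \<longlongrightarrow> lQ i) (at_right 0))"
      using eigenvalues_converge[OF lQ] by (elim exE)
    note lam = conjunct1[OF lam'] bspec[OF conjunct1[OF conjunct2[OF lam']]] conjunct2[OF conjunct2[OF lam']]
    have gap: "\<exists>\<epsilon>0>0. \<forall>\<epsilon>\<in>{0<..\<epsilon>0}. \<forall>i\<in>{n+1..card S}. cmod (lam \<epsilon> i) \<ge> r \<epsilon>"
      if r: "((\<lambda>\<epsilon>. r \<epsilon> * \<epsilon> powr (\<alpha> / (real n + 1))) \<longlongrightarrow> 0) (at_right 0)" for r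
    proof -
      obtain c where c: "0 < c" "\<And>\<epsilon>. 0 < \<epsilon> \<Longrightarrow> \<epsilon> < c \<Longrightarrow> r \<epsilon> \<le> 1 / (2 * \<eta> \<epsilon>)"
        using rate_below_gap[OF r] unfolding eventually_at_right_field by auto
      show ?thesis
      proof (intro exI[of _ "min \<epsilon>1 (c/2)"] conjI ballI)
        show "0 < min \<epsilon>1 (c/2)" using lam(1) c(1) by simp
        fix \<epsilon> i assume \<epsilon>: "\<epsilon> \<in> {0<..min \<epsilon>1 (c/2)}" and i: "i \<in> {n+1..card S}"
        have "r \<epsilon> \<le> 1 / (2 * \<eta> \<epsilon>)" using \<epsilon> c(1) by (intro c(2)) auto
        also have "\<dots> \<le> cmod (lam \<epsilon> i)" using lam(2)[of \<epsilon>] \<epsilon> i by auto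
        finally show "r \<epsilon> \<le> cmod (lam \<epsilon> i)" .
      qed
    qed
    show "\<exists>(lam :: real \<Rightarrow> nat \<Rightarrow> complex) \<epsilon>1. \<epsilon>1 > 0 \<and>
        (\<forall>\<epsilon>\<in>{0<..\<epsilon>1}.
           enumerates_spec (lam \<epsilon>) (card S) (Q\<epsilon> \<epsilon>) \<and>
           lam \<epsilon> ` {1..n} \<inter> lam \<epsilon> ` {n+1..card S} = {} \<and>
           lam \<epsilon> 1 = 0) \<and>
        (\<forall>i\<in>{2..n}. ((\<lambda>\<epsilon>. lam \<epsilon> i) \<longlongrightarrow> lQ i) (at_right 0)) \<and>
        (\<forall>r :: real \<Rightarrow> real.
           filterlim r at_top (at_right 0) \<longrightarrow>
           ((\<lambda>\<epsilon>. r \<epsilon> * \<epsilon> powr (\<alpha> / (real n + 1))) \<longlongrightarrow> 0) (at_right 0) \<longrightarrow>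
           (\<exists>\<epsilon>0>0. \<forall>\<epsilon>\<in>{0<..\<epsilon>0}. \<forall>i\<in>{n+1..card S}. cmod (lam \<epsilon> i) \<ge> r \<epsilon>))"
    proof (rule exI[of _ lam], rule exI[of _ \<epsilon>1], intro conjI ballI allI impI)
      show "0 < \<epsilon>1" by (rule lam(1))
      fix \<epsilon> assume "\<epsilon> \<in> {0<..\<epsilon>1}"
      note props = lam(2)[OF this]
      show "enumerates_spec (lam \<epsilon>) (card S) (Q\<epsilon> \<epsilon>)" "lam \<epsilon> 1 = 0"
        "lam \<epsilon> ` {1..n} \<inter> lam \<epsilon> ` {n+1..card S} = {}"
        using props by - (elim conjE, assumption)+
    next
      fix i assume "i \<in> {2..n}"
      then show "((\<lambda>\<epsilon>. lam \<epsilon> i) \<longlongrightarrow> lQ i) (at_right 0)" by (rule bspec[OF lam(3)])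
    next
      fix r :: "real \<Rightarrow> real"
      assume "((\<lambda>\<epsilon>. r \<epsilon> * \<epsilon> powr (\<alpha> / (real n + 1))) \<longlongrightarrow> 0) (at_right 0)"
      then show "\<exists>\<epsilon>0>0. \<forall>\<epsilon>\<in>{0<..\<epsilon>0}. \<forall>i\<in>{n+1..card S}. cmod (lam \<epsilon> i) \<ge> r \<epsilon>"
        by (rule gap)
    qed
  qed
qed

end
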